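(* Fix $\alpha>0$. Let $\mathbf{u}_h=\tfrac12\nabla^\perp h\in W^{3,2}_{\mathrm{div}}(\mathbb{T}^2;\mathbb{R}^2)$, $f\in W^{2,2}(\mathbb{T}^2)$ and $(b_0,\omega_0)\in\mathcal{M}=W^{3,2}(\mathbb{T}^2)\times W^{2,2}(\mathbb{T}^2)$, and let $(b^\alpha,\omega^\alpha,T^\alpha_{\max})$ be a maximal solution of the $\alpha$-TQG system with data $\mathbf{u}_h,f$ and initial condition $(b_0,\omega_0)$. If $T^\alpha_{\max}<\infty$, then $$\int_0^{T^\alpha_{\max}}\|\nabla b^\alpha(t)\|_{\infty}\,dt=\infty.$$
   Context: $\mathbb{T}^2$ is the two-dimensional flat torus, $\nabla^\perp=(-\partial_y,\partial_x)$, $W^{k,2}(\mathbb{T}^2)$ are the usual $L^2$-based Sobolev spaces with norm $\|\cdot\|_{k,2}$, $\|\cdot\|_\infty$ is the $L^\infty(\mathbb{T}^2)$ norm, and $W^{k,2}_{\mathrm{div}}(\mathbb{T}^2;\mathbb{R}^2)$ is the space of weakly divergence-free vector fields in $W^{k,2}$. $\mathcal{M}=W^{3,2}(\mathbb{T}^2)\times W^{2,2}(\mathbb{T}^2)$ has norm $\|(b,\omega)\|_{\mathcal{M}}=\|b\|_{3,2}+\|\omega\|_{2,2}$. Standing assumption: all functions under consideration have zero average over $\mathbb{T}^2$. The $\alpha$-TQG system ($\alpha>0$) for $(b^\alpha,\omega^\alpha)$ is $$\partial_t b^\alpha+\mathbf{u}^\alpha\cdot\nabla b^\alpha=0,\qquad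 \partial_t\omega^\alpha+\mathbf{u}^\alpha\cdot\nabla(\omega^\alpha-b^\alpha)=-\mathbf{u}_h\cdot\nabla b^\alpha,$$ $$\mathbf{u}^\alpha=\nabla^\perp\psi^\alpha,\qquad \mathbf{u}_h=\tfrac12\nabla^\perp h,\qquad \omega^\alpha=(\Delta-1)(1-\alpha\Delta)\psi^\alpha+f,$$ where $h$ and $f$ are given time-independent functions. Local strong solution: given $T>0$, $(b^\alpha,\omega^\alpha,T)$ is a local strong solution with initial condition $(b_0,\omega_0)$ if $b^\alpha\in C([0,T];W^{3,2}(\mathbb{T}^2))$, $\omega^\alpha\in C([0,T];W^{2,2}(\mathbb{T}^2))$, and for all $t\in[0,T]$ $$b^\alpha(t)=b_0-\int_0^t\mathrm{div}(b^\alpha\mathbf{u}^\alpha)\,d\tau,\qquad \omega^\alpha(t)=\omega_0-\int_0^t\big[\mathrm{div}((\omega^\alpha-b^\alpha)\mathbf{u}^\alpha)+\mathrm{div}(b^\alpha\mathbf{u}_h)\big]\,d\tau,$$ with $\mathbf{u}^\alpha=\nabla^\perp(1-\alpha\Delta)^{-1}(\Delta-1)^{-1}(\omega^\alpha-f)$. Maximal solution: $(b^\alpha,\omega^\alpha,T^\alpha_{\max})$ is a maximal solution with initial condition $(b_0,\omega_0)$ if (i) there is an increasing sequence of times $(T_n)_{n\in\mathbb{N}}$ with limit $T^\alpha_{\max}\in(0,\infty]$; (ii) for each $n$, $(b^\alpha,\omega^\alpha,T_n)$ is a local strong solution with initial condition $(b_0,\omega_0)$; (iii) if $T^\alpha_{\max}<\infty$,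 then $\limsup_{T_n\to T^\alpha_{\max}}\|(b^\alpha,\omega^\alpha)(T_n)\|_{\mathcal{M}}^2=\infty$. *)

theory Defs
  imports "HOL-Analysis.Analysis" "HOL-Probability.Essential_Supremum"
begin

section \<open>The space \<open>L\<^sup>2\<close> of the flat torus\<close>

text \<open>
  The flat torus is \<open>\<real>\<^sup>2 / \<int>\<^sup>2\<close>. Measurable functions on it are identified with functions on the
  fundamental cell \<open>[0,1) \<times> [0,1)\<close> up to null sets; the values of a representative
  outside the cell are irrelevant. That opposite sides of the cell are glued together is encoded in
  the test functions below, which are smooth and periodic on the plane.
\<close>

definition torus :: "(real \<times> real) measure" where
  "torus = restrict_space lborel ({0..<1} \<times> {0..<1})"

definition square_integrable :: "(real \<times> real \<Rightarrow> real) \<Rightarrow> bool" where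
  "square_integrable f \<longleftrightarrow> f \<in> borel_measurable torus \<and> integrable torus (\<lambda>p. (f p)\<^sup>2)"

definition L2_rel :: "(real \<times> real \<Rightarrow> real) \<Rightarrow> (real \<times> real \<Rightarrow> real) \<Rightarrow> bool" where
  "L2_rel f g \<longleftrightarrow> square_integrable f \<and> square_integrable g \<and> (AE p in torus. f p = g p)"

lemma square_integrable_mult:
  assumes "square_integrable f" "square_integrable g"
  shows "integrable torus (\<lambda>p. f p * g p)"
proof (rule Bochner_Integration.integrable_bound)
  show "integrable torus (\<lambda>p. (f p)\<^sup>2 + (g p)\<^sup>2)"
    using assms by (auto simp: square_integrable_def)
  show "(\<lambda>p. f p * g p) \<in> borel_measurable torus"
    using assms by (auto simp: square_integrable_def)
  have "\<bar>a * b\<bar> \<le> \<bar>a\<^sup>2 + b\<^sup>2\<bar>" for a b :: real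
  proof -
    have "2 * \<bar>a * b\<bar> \<le> a\<^sup>2 + b\<^sup>2"
      using sum_squares_bound[of "\<bar>a\<bar>" "\<bar>b\<bar>"] by (simp add: abs_mult)
    then show ?thesis by (smt (verit) abs_ge_zero)
  qed
  then show "AE p in torus. norm (f p * g p) \<le> norm ((f p)\<^sup>2 + (g p)\<^sup>2)"
    by (auto simp: real_norm_def)
qed

lemma square_integrable_zero: "square_integrable (\<lambda>_. 0)"
  by (simp add: square_integrable_def)

lemma square_integrable_scale:
  "square_integrable f \<Longrightarrow> square_integrable (\<lambda>p. c * f p)"
  by (auto simp: square_integrable_def power_mult_distrib)

lemma square_integrable_add:
  assumes "square_integrable f" "square_integrable g"
  shows "square_integrable (\<lambda>p. f p + g p)"
  using square_integrable_mult[OF assms] assms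
  by (auto simp: square_integrable_def power2_sum mult.assoc)

quotient_type l2_torus = "real \<times> real \<Rightarrow> real" / partial: L2_rel
proof (rule part_equivpI)
  show "\<exists>f. L2_rel f f"
    using square_integrable_zero by (auto simp: L2_rel_def)
  show "symp L2_rel"
    by (auto simp: symp_def L2_rel_def)
  show "transp L2_rel"
    by (auto simp: transp_def L2_rel_def elim: eventually_elim2)
qed

instantiation l2_torus :: real_inner
begin

lift_definition zero_l2_torus :: l2_torus is "\<lambda>_. 0"
  using square_integrable_zero by (simp add: L2_rel_def)

lift_definition plus_l2_torus :: "l2_torus \<Rightarrow> l2_torus \<Rightarrow> l2_torus" is "\<lambda>f g p. f p + g p"
  by (auto simp: L2_rel_def square_integrable_add)

lift_definition scaleR_l2_torus :: "real \<Rightarrow> l2_torus \<Rightarrow> l2_torus" is "\<lambda>c f p. c * f p"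
  by (auto simp: L2_rel_def square_integrable_scale)

definition uminus_l2_torus :: "l2_torus \<Rightarrow> l2_torus" where
  "- f = (-1) *\<^sub>R f" for f :: l2_torus

definition minus_l2_torus :: "l2_torus \<Rightarrow> l2_torus \<Rightarrow> l2_torus" where
  "f - g = f + (- g)" for f g :: l2_torus

lift_definition inner_l2_torus :: "l2_torus \<Rightarrow> l2_torus \<Rightarrow> real"
  is "\<lambda>f g. LINT p|torus. f p * g p"
  by (rule Bochner_Integration.integral_cong_AE) (auto simp: L2_rel_def square_integrable_def)

definition norm_l2_torus :: "l2_torus \<Rightarrow> real" where
  "norm f = sqrt (f \<bullet> f)" for f :: l2_torus

definition dist_l2_torus :: "l2_torus \<Rightarrow> l2_torus \<Rightarrow> real" where
  "dist f g = norm (f - g)" for f g :: l2_torus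

definition sgn_l2_torus :: "l2_torus \<Rightarrow> l2_torus" where
  "sgn f = inverse (norm f) *\<^sub>R f" for f :: l2_torus

definition uniformity_l2_torus :: "(l2_torus \<times> l2_torus) filter" where
  "uniformity_l2_torus = (INF e\<in>{0<..}. principal {(x, y). dist x y < e})"

definition open_l2_torus :: "l2_torus set \<Rightarrow> bool" where
  "open_l2_torus U \<longleftrightarrow> (\<forall>x\<in>U. \<forall>\<^sub>F (x', y) in uniformity. x' = x \<longrightarrow> y \<in> U)"

instance
proof
  fix f g k :: l2_torus and c d :: real
  show "f + g + k = f + (g + k)"
    by transfer (auto simp: L2_rel_def square_integrable_add add.assoc)
  show "f + g = g + f"
    by transfer (auto simp: L2_rel_def square_integrable_add add.commute)
  show "0 + f = f"
    by transfer (auto simp: L2_rel_def)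
  show "- f + f = 0"
    unfolding uminus_l2_torus_def
    by transfer (use square_integrable_zero in \<open>auto simp: L2_rel_def\<close>)
  show "f - g = f + - g"
    by (simp add: minus_l2_torus_def)
  show "c *\<^sub>R (f + g) = c *\<^sub>R f + c *\<^sub>R g"
    by transfer
      (auto simp: L2_rel_def square_integrable_add square_integrable_scale distrib_left
            intro!: square_integrable_add[of "\<lambda>p. c * _ p"])
  show "(c + d) *\<^sub>R f = c *\<^sub>R f + d *\<^sub>R f"
    by transfer
      (simp add: L2_rel_def square_integrable_add square_integrable_scale distrib_right)
  show "c *\<^sub>R d *\<^sub>R f = (c * d) *\<^sub>R f"
    by transfer (auto simp: L2_rel_def square_integrable_scale mult.assoc)
  show "1 *\<^sub>R f = f"
    by transfer (auto simp: L2_rel_def)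
  show "dist f g = norm (f - g)"
    by (simp add: dist_l2_torus_def)
  show "sgn f = inverse (norm f) *\<^sub>R f"
    by (simp add: sgn_l2_torus_def)
  show "uniformity = (INF e\<in>{0<..}. principal {(x, y :: l2_torus). dist x y < e})"
    by (simp add: uniformity_l2_torus_def)
  show "open U \<longleftrightarrow> (\<forall>x\<in>U. \<forall>\<^sub>F (x', y) in uniformity. x' = x \<longrightarrow> y \<in> U)" for U :: "l2_torus set"
    by (simp add: open_l2_torus_def)
  show "f \<bullet> g = g \<bullet> f"
    by transfer (simp add: mult.commute)
  show "(f + g) \<bullet> k = f \<bullet> k + g \<bullet> k"
    by transfer (simp add: L2_rel_def distrib_right square_integrable_mult)
  show "(c *\<^sub>R f) \<bullet> g = c * (f \<bullet> g)"
    by transfer (simp add: mult.assoc)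
  show "0 \<le> f \<bullet> f"
    by transfer simp
  show "f \<bullet> f = 0 \<longleftrightarrow> f = 0"
  proof transfer
    fix f :: "real \<times> real \<Rightarrow> real"
    assume "L2_rel f f"
    then have sq: "square_integrable f" by (simp add: L2_rel_def)
    have "(LINT p|torus. f p * f p) = 0 \<longleftrightarrow> (AE p in torus. f p * f p = 0)"
      by (rule integral_nonneg_eq_0_iff_AE) (use sq in \<open>auto simp: square_integrable_mult\<close>)
    then show "((LINT p|torus. f p * f p) = 0) = L2_rel f (\<lambda>_. 0)"
      using sq square_integrable_zero by (simp add: L2_rel_def)
  qed
  show "norm f = sqrt (f \<bullet> f)"
    by (simp add: norm_l2_torus_def)
qed

end

text \<open>
  The class of a function; meaningful only for functions that are square integrable over the cell.
\<close>

abbreviation to_L2 :: "(real \<times> real \<Rightarrow> real) \<Rightarrow> l2_torus" where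
  "to_L2 \<equiv> abs_l2_torus"

text \<open>Some representative of a class, well defined up to null sets of the cell.\<close>

abbreviation repr :: "l2_torus \<Rightarrow> real \<times> real \<Rightarrow> real" where
  "repr \<equiv> rep_l2_torus"

text \<open>Meaningful only if the product is again square integrable.\<close>

definition mult_L2 :: "l2_torus \<Rightarrow> l2_torus \<Rightarrow> l2_torus" where
  "mult_L2 f g = to_L2 (\<lambda>p. repr f p * repr g p)"

definition zero_average :: "l2_torus set" where
  "zero_average = {f. (LINT p|torus. repr f p) = 0}"

section \<open>Weak derivatives and Sobolev spaces\<close>

definition partial_x :: "(real \<times> real \<Rightarrow> real) \<Rightarrow> real \<times> real \<Rightarrow> real" where
  "partial_x \<phi> p = frechet_derivative \<phi> (at p) (1, 0)"

definition partial_y :: "(real \<times> real \<Rightarrow> real) \<Rightarrow> real \<times> real \<Rightarrow> real" where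
  "partial_y \<phi> p = frechet_derivative \<phi> (at p) (0, 1)"

primrec smooth_upto :: "nat \<Rightarrow> (real \<times> real \<Rightarrow> real) \<Rightarrow> bool" where
  "smooth_upto 0 \<phi> \<longleftrightarrow> continuous_on UNIV \<phi>"
| "smooth_upto (Suc k) \<phi> \<longleftrightarrow>
     (\<forall>p. \<phi> differentiable (at p)) \<and> smooth_upto k (partial_x \<phi>) \<and> smooth_upto k (partial_y \<phi>)"

text \<open>The smooth functions on the torus, as periodic functions on the plane.\<close>

definition test_functions :: "(real \<times> real \<Rightarrow> real) set" where
  "test_functions =
     {\<phi>. (\<forall>k. smooth_upto k \<phi>) \<and> (\<forall>x y. \<phi> (x + 1, y) = \<phi> (x, y) \<and> \<phi> (x, y + 1) = \<phi> (x, y))}"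

text \<open>\<open>g\<close> is the weak derivative of \<open>f\<close> of order \<open>m\<close> in \<open>x\<close> and \<open>n\<close> in \<open>y\<close>.\<close>

definition is_weak_deriv :: "nat \<Rightarrow> nat \<Rightarrow> l2_torus \<Rightarrow> l2_torus \<Rightarrow> bool" where
  "is_weak_deriv m n f g \<longleftrightarrow>
     (\<forall>\<phi>\<in>test_functions.
        (LINT p|torus. repr f p * (partial_x ^^ m) ((partial_y ^^ n) \<phi>) p)
          = (-1) ^ (m + n) * (LINT p|torus. repr g p * \<phi> p))"

definition weak_deriv :: "nat \<Rightarrow> nat \<Rightarrow> l2_torus \<Rightarrow> l2_torus" where
  "weak_deriv m n f = (THE g. is_weak_deriv m n f g)"

text \<open>The space \<open>W\<^sup>k\<^sup>,\<^sup>2\<close> and its norm.\<close>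

definition sobolev :: "nat \<Rightarrow> l2_torus set" where
  "sobolev k = {f. \<forall>m n. m + n \<le> k \<longrightarrow> (\<exists>g. is_weak_deriv m n f g)}"

definition sobolev_norm :: "nat \<Rightarrow> l2_torus \<Rightarrow> real" where
  "sobolev_norm k f = sqrt (\<Sum>(m, n)\<in>{(m, n). m + n \<le> k}. (norm (weak_deriv m n f))\<^sup>2)"

text \<open>Weakly divergence-free vector fields with components in \<open>W\<^sup>k\<^sup>,\<^sup>2\<close>.\<close>

definition sobolev_div :: "nat \<Rightarrow> (l2_torus \<times> l2_torus) set" where
  "sobolev_div k =
     {(u, v). u \<in> sobolev k \<and> v \<in> sobolev k \<and>
        (\<forall>\<phi>\<in>test_functions.
           (LINT p|torus. repr u p * partial_x \<phi> p + repr v p * partial_y \<phi> p) = 0)}"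

definition grad :: "l2_torus \<Rightarrow> l2_torus \<times> l2_torus" where
  "grad f = (weak_deriv 1 0 f, weak_deriv 0 1 f)"

definition grad_perp :: "l2_torus \<Rightarrow> l2_torus \<times> l2_torus" where
  "grad_perp f = (- weak_deriv 0 1 f, weak_deriv 1 0 f)"

definition divergence :: "l2_torus \<times> l2_torus \<Rightarrow> l2_torus" where
  "divergence u = weak_deriv 1 0 (fst u) + weak_deriv 0 1 (snd u)"

definition laplacian :: "l2_torus \<Rightarrow> l2_torus" where
  "laplacian f = weak_deriv 2 0 f + weak_deriv 0 2 f"

definition mult_vec :: "l2_torus \<Rightarrow> l2_torus \<times> l2_torus \<Rightarrow> l2_torus \<times> l2_torus" where
  "mult_vec f u = (mult_L2 f (fst u), mult_L2 f (snd u))"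

text \<open>The \<open>L\<^sup>\<infinity>\<close> norm of a vector field (possibly infinite), with the Euclidean norm of its values.\<close>

definition Linf_norm :: "l2_torus \<times> l2_torus \<Rightarrow> ennreal" where
  "Linf_norm u = esssup torus (\<lambda>p. ennreal (norm (repr (fst u) p, repr (snd u) p)))"

section \<open>Solutions of the \<open>\<alpha>\<close>-TQG system\<close>

text \<open>
  The operators \<open>\<Delta> - 1\<close> and \<open>1 - \<alpha> \<Delta>\<close> (\<open>\<alpha> > 0\<close>) are bijections from
  \<open>W\<^sup>2\<^sup>,\<^sup>2\<close> onto \<open>L\<^sup>2\<close>.
\<close>

definition velocity :: "real \<Rightarrow> l2_torus \<Rightarrow> l2_torus \<Rightarrow> l2_torus \<times> l2_torus" where
  "velocity \<alpha> f \<omega> =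
     grad_perp
       (inv_into (sobolev 2) (\<lambda>\<psi>. \<psi> - \<alpha> *\<^sub>R laplacian \<psi>)
         (inv_into (sobolev 2) (\<lambda>\<psi>. laplacian \<psi> - \<psi>) (\<omega> - f)))"

text \<open>
  Membership in \<open>C([0,T]; W\<^sup>k\<^sup>,\<^sup>2)\<close>. Only the values of the function on \<open>[0,T]\<close> matter.
\<close>

definition continuous_sobolev :: "real \<Rightarrow> nat \<Rightarrow> (real \<Rightarrow> l2_torus) \<Rightarrow> bool" where
  "continuous_sobolev T k c \<longleftrightarrow>
     (\<forall>t\<in>{0..T}. c t \<in> sobolev k) \<and>
     (\<forall>t\<in>{0..T}. ((\<lambda>s. sobolev_norm k (c s - c t)) \<longlongrightarrow> 0) (at t within {0..T}))"

text \<open>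
  The time integrals are integrals of \<open>L\<^sup>2\<close>-valued functions. The integrands are continuous into
  \<open>L\<^sup>2\<close>, so the gauge integral used here coincides with the Bochner integral. The two
  conditions on the average express the convention that all functions have zero average.
\<close>

definition local_strong_solution ::
  "real \<Rightarrow> l2_torus \<times> l2_torus \<Rightarrow> l2_torus \<Rightarrow> l2_torus \<Rightarrow> l2_torus \<Rightarrow>
   (real \<Rightarrow> l2_torus) \<Rightarrow> (real \<Rightarrow> l2_torus) \<Rightarrow> real \<Rightarrow> bool" where
  "local_strong_solution \<alpha> uh f b0 \<omega>0 b \<omega> T \<longleftrightarrow>
     T > 0 \<and> continuous_sobolev T 3 b \<and> continuous_sobolev T 2 \<omega> \<and>
     (\<forall>t\<in>{0..T}. b t \<in> zero_average \<and> \<omega> t \<in> zero_average) \<and>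
     (let F = (\<lambda>\<tau>. divergence (mult_vec (b \<tau>) (velocity \<alpha> f (\<omega> \<tau>))));
          G = (\<lambda>\<tau>. divergence (mult_vec (\<omega> \<tau> - b \<tau>) (velocity \<alpha> f (\<omega> \<tau>)))
                    + divergence (mult_vec (b \<tau>) uh))
      in \<forall>t\<in>{0..T}.
           F integrable_on {0..t} \<and> b t = b0 - integral {0..t} F \<and>
           G integrable_on {0..t} \<and> \<omega> t = \<omega>0 - integral {0..t} G)"

definition M_norm :: "l2_torus \<times> l2_torus \<Rightarrow> real" where
  "M_norm z = sobolev_norm 3 (fst z) + sobolev_norm 2 (snd z)"

text \<open>
  \<open>b\<close> and \<open>\<omega>\<close> are total functions of time; nothing is required of them from the maximal time on.
\<close>

definition maximal_solution ::
  "real \<Rightarrow> l2_torus \<times> l2_torus \<Rightarrow> l2_torus \<Rightarrow> l2_torus \<Rightarrow> l2_torus \<Rightarrow>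
   (real \<Rightarrow> l2_torus) \<Rightarrow> (real \<Rightarrow> l2_torus) \<Rightarrow> ereal \<Rightarrow> bool" where
  "maximal_solution \<alpha> uh f b0 \<omega>0 b \<omega> Tmax \<longleftrightarrow>
     0 < Tmax \<and>
     (\<exists>T :: nat \<Rightarrow> real.
        incseq T \<and> (\<lambda>n. ereal (T n)) \<longlonglongrightarrow> Tmax \<and>
        (\<forall>n. local_strong_solution \<alpha> uh f b0 \<omega>0 b \<omega> (T n)) \<and>
        (Tmax < \<infinity> \<longrightarrow>
           limsup (\<lambda>n. ereal ((M_norm (b (T n), \<omega> (T n)))\<^sup>2)) = \<infinity>))"

end

theory Submission
  imports Defs "HOL-Probability.Probability_Measure"
begin

text \<open>
  Everything is read off Fourier coefficients. The velocity gains three derivatives over the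
  vorticity, so a bound on \<open>\<omega>\<close> in \<open>L\<^sup>2\<close> bounds \<open>u\<close> in \<open>W\<^sup>3\<^sup>,\<^sup>2\<close>. In the \<open>L\<^sup>2\<close> balance of \<open>\<omega>\<close> the
  transport term cancels and the sources are at most \<open>\<parallel>\<nabla>b\<parallel>\<^sub>\<infinity> (\<parallel>u\<parallel> + \<parallel>u\<^sub>h\<parallel>)\<close>; Gronwall's inequality thus
  bounds \<open>\<omega>\<close> in \<open>L\<^sup>2\<close> if \<open>\<parallel>\<nabla>b\<parallel>\<^sub>\<infinity>\<close> is integrable in time. With \<open>u\<close> bounded in \<open>W\<^sup>3\<^sup>,\<^sup>2\<close>, a
  commutator estimate and Gronwall's inequality bound first \<open>b\<close> in \<open>W\<^sup>3\<^sup>,\<^sup>2\<close> and then \<open>\<omega>\<close> in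
  \<open>W\<^sup>2\<^sup>,\<^sup>2\<close>, which excludes blow-up. The solution is not regular enough to differentiate its top
  order norms in time; they are approximated by finite sums with the weights
  \<open>\<lambda>\<^sup>2\<^sup>s max 0 (1 - \<lambda>/N)\<close>, where \<open>\<lambda>(k) = 1 + |k\<^sub>1| + |k\<^sub>2|\<close>, whose differences obey commutator bounds
  uniform in \<open>N\<close>.
\<close>

text \<open>The sup norm of the gradient of \<open>b\<close> cannot be recovered from the absolute
  values of its Fourier coefficients, so the integral assumed finite can be exploited only through a
  pointwise product. That happens once, in \<open>source_L2\<close>. Afterwards a velocity in
  W^{3,2} has absolutely summable \<open>lam l * cmod (u l)\<close>, every further growth rate is
  linear in the squared norm, and Gronwall's bounds stay finite on bounded time intervals. A sharp
  truncation of the weighted sums would fail: across its edge two neighbouring modes have weights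
  that differ by about N^{2s}, which no commutator estimate absorbs. The tapered factor decreases
  linearly to 0, and the differences of the tapered weights have the same order as those of
  \<open>lam k ^ (2 * s)\<close> itself. The type \<open>l2_torus\<close> is an inner product space
  without a completeness instance. Classes with prescribed coefficients are therefore built from
  absolutely summable series or as explicit products, never as abstract L2 limits.\<close>

lemma torus_cell_sets [measurable, simp]: "{0..<1::real} \<times> {0..<1::real} \<in> sets borel"
  by (simp add: borel_prod[symmetric] pair_measureI)

lemma space_torus: "space torus = {0..<1} \<times> {0..<1}"
  by (simp add: torus_def space_restrict_space)

lemma emeasure_torus_space: "emeasure torus (space torus) = 1"
proof -
  have "emeasure torus ({0..<1} \<times> {0..<1}) = emeasure lborel ({0..<1::real} \<times> {0..<1::real})"
    unfolding torus_def by (subst emeasure_restrict_space) auto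
  also have "\<dots> = emeasure (lborel \<Otimes>\<^sub>M lborel) ({0..<1::real} \<times> {0..<1::real})"
    by (simp add: lborel_prod)
  also have "\<dots> = 1"
    by (subst lborel.emeasure_pair_measure_Times) auto
  finally show ?thesis by (simp add: space_torus)
qed

interpretation torus: prob_space torus
  by (rule prob_spaceI) (rule emeasure_torus_space)

lemma measurable_torus: "f \<in> borel_measurable borel \<Longrightarrow> f \<in> borel_measurable torus"
  unfolding torus_def by (rule measurable_restrict_space1) simp

lemma continuous_measurable_torus:
  "continuous_on UNIV f \<Longrightarrow> f \<in> borel_measurable torus"
  by (intro measurable_torus borel_measurable_continuous_onI)

lemma continuous_integrable_torus:
  fixes f :: "real \<times> real \<Rightarrow> 'a :: {banach, second_countable_topology}"
  assumes "continuous_on UNIV f"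
  shows "integrable torus f"
proof -
  have "compact (f ` ({0..1} \<times> {0..1}))"
    by (intro compact_continuous_image compact_Times) (auto intro: continuous_on_subset[OF assms])
  then obtain B where "\<And>x. x \<in> {0..1} \<times> {0..1} \<Longrightarrow> norm (f x) \<le> B"
    using bounded_iff compact_imp_bounded by (metis image_eqI)
  then show ?thesis
    by (intro torus.integrable_const_bound[of _ B])
       (auto simp: space_torus continuous_measurable_torus assms)
qed

section \<open>Integrals of derivatives over the cell\<close>

lemma torus_integral_lborel:
  fixes f :: "real \<times> real \<Rightarrow> 'a :: euclidean_space"
  shows "(LINT p|torus. f p) = (LINT p|lborel. indicator ({0..<1} \<times> {0..<1}) p *\<^sub>R f p)"
  unfolding torus_def by (rule integral_restrict_space) simp

lemma integrable_torus_lborel: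
  fixes f :: "real \<times> real \<Rightarrow> 'a :: euclidean_space"
  assumes "continuous_on UNIV f"
  shows "integrable lborel (\<lambda>p. indicator ({0..<1} \<times> {0..<1}) p *\<^sub>R f p)"
  using continuous_integrable_torus[OF assms]
  unfolding torus_def by (subst (asm) integrable_restrict_space) (auto simp: set_integrable_def)

lemma integral_FTC_Ico:
  fixes f :: "real \<Rightarrow> 'a :: euclidean_space"
  assumes "\<And>x. (F has_vector_derivative f x) (at x)" "continuous_on UNIV f"
  shows "(LINT x|lborel. indicator {0..<1} x *\<^sub>R f x) = F 1 - F 0"
proof -
  have "(LINT x|lborel. indicator {0..<1} x *\<^sub>R f x) = (LINT x|lborel. indicator {0..1} x *\<^sub>R f x)"
  proof (rule integral_cong_AE)
    have "AE x in lborel. x \<noteq> (1::real)" by (rule AE_lborel_singleton)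
    then show "AE x in lborel. indicator {0..<1} x *\<^sub>R f x = indicator {0..1::real} x *\<^sub>R f x"
      by eventually_elim (auto simp: indicator_def)
  qed (use borel_measurable_continuous_onI[OF assms(2)] in measurable)
  also have "\<dots> = F 1 - F 0"
    by (rule integral_FTC_Icc) (auto intro: has_vector_derivative_at_within assms(1)
        continuous_on_subset[OF assms(2)])
  finally show ?thesis .
qed

text \<open>By Fubini the inner integral in x is the difference of the values on two glued edges,
  which is 0. Orthogonality of the exponentials (\<open>integral_ek\<close>) and integration by
  parts (\<open>fc_partial\<close>) both rest on this and on its analogue in y.\<close>

lemma torus_integral_deriv_fst:
  fixes \<Phi> \<Phi>' :: "real \<times> real \<Rightarrow> 'a :: euclidean_space"
  assumes d: "\<And>x y. ((\<lambda>x. \<Phi> (x, y)) has_vector_derivative \<Phi>' (x, y)) (at x)"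
    and c: "continuous_on UNIV \<Phi>'" and p: "\<And>y. \<Phi> (1, y) = \<Phi> (0, y)"
  shows "(LINT p|torus. \<Phi>' p) = 0"
proof -
  let ?h = "\<lambda>p. indicator ({0..<1} \<times> {0..<1}) p *\<^sub>R \<Phi>' p"
  have i: "integrable (lborel \<Otimes>\<^sub>M lborel) (\<lambda>(x, y). ?h (x, y))"
    using integrable_torus_lborel[OF c] by (simp add: lborel_prod split_beta')
  have "(LINT p|torus. \<Phi>' p) = (LINT p|(lborel \<Otimes>\<^sub>M lborel). ?h p)"
    by (simp add: torus_integral_lborel lborel_prod)
  also have "\<dots> = (LINT y|lborel. LINT x|lborel. ?h (x, y))"
    using lborel_pair.integral_snd[OF i] by (simp add: split_beta')
  also have "\<dots> = (LINT y|lborel. indicator {0..<1::real} y *\<^sub>R (LINT x|lborel. indicator {0..<1::real} x *\<^sub>R \<Phi>' (x, y)))"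
    by (intro Bochner_Integration.integral_cong refl)
       (auto simp: indicator_times mult.commute scaleR_scaleR[symmetric] simp del: scaleR_scaleR)
  also have "\<dots> = (LINT y|lborel. indicator {0..<1::real} y *\<^sub>R (0::'a))"
    by (subst integral_FTC_Ico[OF d]) (auto simp: p intro!: continuous_on_compose2[OF c] continuous_intros)
  finally show ?thesis by simp
qed

lemma torus_integral_deriv_snd:
  fixes \<Phi> \<Phi>' :: "real \<times> real \<Rightarrow> 'a :: euclidean_space"
  assumes d: "\<And>x y. ((\<lambda>y. \<Phi> (x, y)) has_vector_derivative \<Phi>' (x, y)) (at y)"
    and c: "continuous_on UNIV \<Phi>'" and p: "\<And>x. \<Phi> (x, 1) = \<Phi> (x, 0)"
  shows "(LINT p|torus. \<Phi>' p) = 0"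
proof -
  let ?h = "\<lambda>p. indicator ({0..<1} \<times> {0..<1}) p *\<^sub>R \<Phi>' p"
  have i: "integrable (lborel \<Otimes>\<^sub>M lborel) (\<lambda>(x, y). ?h (x, y))"
    using integrable_torus_lborel[OF c] by (simp add: lborel_prod split_beta')
  have "(LINT p|torus. \<Phi>' p) = (LINT p|(lborel \<Otimes>\<^sub>M lborel). ?h p)"
    by (simp add: torus_integral_lborel lborel_prod)
  also have "\<dots> = (LINT x|lborel. LINT y|lborel. ?h (x, y))"
    using lborel_pair.integral_fst[OF i] by (simp add: split_beta')
  also have "\<dots> = (LINT x|lborel. indicator {0..<1::real} x *\<^sub>R (LINT y|lborel. indicator {0..<1::real} y *\<^sub>R \<Phi>' (x, y)))"
    by (intro Bochner_Integration.integral_cong refl)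
       (auto simp: indicator_times mult.commute scaleR_scaleR[symmetric] simp del: scaleR_scaleR)
  also have "\<dots> = (LINT x|lborel. indicator {0..<1::real} x *\<^sub>R (0::'a))"
    by (subst integral_FTC_Ico[OF d]) (auto simp: p intro!: continuous_on_compose2[OF c] continuous_intros)
  finally show ?thesis by simp
qed

section \<open>Trigonometric functions and Fourier coefficients\<close>

definition ek :: "int \<times> int \<Rightarrow> real \<times> real \<Rightarrow> complex" where
  "ek k p = cis (2 * pi * (of_int (fst k) * fst p + of_int (snd k) * snd p))"

lemma norm_ek [simp]: "cmod (ek k p) = 1"
  by (simp add: ek_def)

lemma ek_0 [simp]: "ek 0 p = 1"
  by (simp add: ek_def)

lemma ek_add: "ek (j + k) p = ek j p * ek k p"
  by (simp add: ek_def cis_mult algebra_simps)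

lemma cnj_ek: "cnj (ek k p) = ek (- k) p"
  by (simp add: ek_def cis_cnj flip: minus_add_distrib) (simp add: algebra_simps)

lemma ek_periodic: "ek k (x + 1, y) = ek k (x, y)" "ek k (x, y + 1) = ek k (x, y)"
proof -
  have "cis (2 * pi * of_int n + a) = cis a" for n :: int and a
    using cis_multiple_2pi[of "of_int n"] by (simp add: cis_mult[symmetric] mult.commute)
  note * = this
  show "ek k (x + 1, y) = ek k (x, y)"
    using *[of "fst k" "2 * pi * (of_int (fst k) * x + of_int (snd k) * y)"]
    by (simp add: ek_def algebra_simps)
  show "ek k (x, y + 1) = ek k (x, y)"
    using *[of "snd k" "2 * pi * (of_int (fst k) * x + of_int (snd k) * y)"]
    by (simp add: ek_def algebra_simps)
qed

lemma continuous_on_ek [continuous_intros]: "continuous_on A (ek k)"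
  unfolding ek_def by (intro continuous_intros)

lemma measurable_ek [measurable]: "ek k \<in> borel_measurable torus"
  by (intro continuous_measurable_torus continuous_intros)

lemma ek_deriv:
  "((\<lambda>x. ek k (x, y)) has_vector_derivative 2 * pi * \<i> * of_int (fst k) * ek k (x, y)) (at x)"
  "((\<lambda>y. ek k (x, y)) has_vector_derivative 2 * pi * \<i> * of_int (snd k) * ek k (x, y)) (at y)"
proof -
  have "((\<lambda>z. exp (\<i> * (2 * pi * (of_int (fst k) * z + of_int (snd k) * y)))) has_field_derivative
      2 * pi * \<i> * of_int (fst k) * exp (\<i> * (2 * pi * (of_int (fst k) * of_real x + of_int (snd k) * y)))) (at (of_real x))"
    by (auto intro!: derivative_eq_intros)
  from has_vector_derivative_real_field[OF this]
  show "((\<lambda>x. ek k (x, y)) has_vector_derivative 2 * pi * \<i> * of_int (fst k) * ek k (x, y)) (at x)"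
    by (simp add: ek_def cis_conv_exp o_def)
  have "((\<lambda>z. exp (\<i> * (2 * pi * (of_int (fst k) * x + of_int (snd k) * z)))) has_field_derivative
      2 * pi * \<i> * of_int (snd k) * exp (\<i> * (2 * pi * (of_int (fst k) * x + of_int (snd k) * of_real y)))) (at (of_real y))"
    by (auto intro!: derivative_eq_intros)
  from has_vector_derivative_real_field[OF this]
  show "((\<lambda>y. ek k (x, y)) has_vector_derivative 2 * pi * \<i> * of_int (snd k) * ek k (x, y)) (at y)"
    by (simp add: ek_def cis_conv_exp o_def)
qed

text \<open>The two partial derivatives of \<open>ek k\<close> are multiples of \<open>ek k\<close>
  by the components of \<open>k\<close> and integrate to 0; for \<open>k\<close> nonzero one of
  these factors can be cancelled.\<close>

lemma integral_ek: "(LINT p|torus. ek k p) = (if k = 0 then 1 else 0)"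
proof -
  have 1: "(LINT p|torus. 2 * pi * \<i> * of_int (fst k) * ek k p) = 0"
    by (rule torus_integral_deriv_fst[where \<Phi> = "ek k"])
       (use ek_deriv ek_periodic(1)[of k 0] in \<open>auto intro!: continuous_intros\<close>)
  have 2: "(LINT p|torus. 2 * pi * \<i> * of_int (snd k) * ek k p) = 0"
    by (rule torus_integral_deriv_snd[where \<Phi> = "ek k"])
       (use ek_deriv ek_periodic(2)[of k _ 0] in \<open>auto intro!: continuous_intros\<close>)
  show ?thesis
  proof (cases "k = 0")
    case True
    have "ek 0 = (\<lambda>_. 1)" by auto
    then show ?thesis using True torus.prob_space by simp
  next
    case False
    then have "fst k \<noteq> 0 \<or> snd k \<noteq> 0" by (auto simp: prod_eq_iff)
    then show ?thesis using 1 2 False by auto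
  qed
qed

section \<open>Representatives of L2 classes and their Fourier coefficients\<close>

lemma square_integrable_repr: "square_integrable (repr f)"
  using Quotient_rep_reflp[OF Quotient_l2_torus, of f] by (simp add: L2_rel_def)

lemma repr_measurable [measurable]: "repr f \<in> borel_measurable torus"
  using square_integrable_repr by (auto simp: square_integrable_def)

lemma repr_to_L2: "square_integrable f \<Longrightarrow> AE p in torus. repr (to_L2 f) p = f p"
  using Quotient_rep_abs[OF Quotient_l2_torus, of f] by (auto simp: L2_rel_def)

lemma to_L2_repr: "to_L2 (repr f) = f"
  by (rule Quotient_abs_rep[OF Quotient_l2_torus])

lemma to_L2_add:
  assumes "square_integrable f" "square_integrable g"
  shows "to_L2 (\<lambda>p. f p + g p) = to_L2 f + to_L2 g"
  using assms by (subst plus_l2_torus.abs_eq) (auto simp: L2_rel_def)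

lemma to_L2_scale:
  assumes "square_integrable f"
  shows "to_L2 (\<lambda>p. c * f p) = c *\<^sub>R to_L2 f"
  using assms by (subst scaleR_l2_torus.abs_eq) (auto simp: L2_rel_def)

lemma square_integrable_diff:
  assumes "square_integrable f" "square_integrable g"
  shows "square_integrable (\<lambda>p. f p - g p)"
  using square_integrable_add[OF assms(1) square_integrable_scale[OF assms(2), of "-1"]] by simp

lemma to_L2_diff:
  assumes "square_integrable f" "square_integrable g"
  shows "to_L2 (\<lambda>p. f p - g p) = to_L2 f - to_L2 g"
  using to_L2_add[OF assms(1) square_integrable_scale[OF assms(2), of "-1"]]
    to_L2_scale[OF assms(2), of "-1"] by simp

lemma repr_diff: "AE p in torus. repr (f - g) p = repr f p - repr g p"
  using repr_to_L2[OF square_integrable_diff[OF square_integrable_repr[of f] square_integrable_repr[of g]]]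
  by (simp add: to_L2_diff square_integrable_repr to_L2_repr)

lemma inner_to_L2:
  assumes "square_integrable f" "square_integrable g"
  shows "to_L2 f \<bullet> to_L2 g = (LINT p|torus. f p * g p)"
  using assms by (subst inner_l2_torus.abs_eq) (auto simp: L2_rel_def)

lemma inner_repr: "f \<bullet> g = (LINT p|torus. repr f p * repr g p)"
  using inner_to_L2[OF square_integrable_repr[of f] square_integrable_repr[of g]]
  by (simp add: to_L2_repr)

lemma norm_repr: "(norm f)\<^sup>2 = (LINT p|torus. (repr f p)\<^sup>2)"
  unfolding power2_norm_eq_inner inner_repr by (simp add: power2_eq_square)

lemma norm_to_L2:
  assumes "square_integrable f"
  shows "(norm (to_L2 f))\<^sup>2 = (LINT p|torus. (f p)\<^sup>2)"
  unfolding power2_norm_eq_inner inner_to_L2[OF assms assms] by (simp add: power2_eq_square)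

lemma square_integrable_bounded:
  assumes "f \<in> borel_measurable torus" "AE p in torus. \<bar>f p\<bar> \<le> c"
  shows "square_integrable f"
  unfolding square_integrable_def
proof
  have "AE p in torus. norm ((f p)\<^sup>2) \<le> c\<^sup>2"
    using assms(2)
  proof eventually_elim
    case (elim p)
    then show ?case using power_mono[of "\<bar>f p\<bar>" c 2] by simp
  qed
  then show "integrable torus (\<lambda>p. (f p)\<^sup>2)"
    by (rule torus.integrable_const_bound) (use assms(1) in measurable)
qed (fact assms)

lemma norm_to_L2_le:
  assumes "f \<in> borel_measurable torus" "AE p in torus. \<bar>f p\<bar> \<le> c"
  shows "norm (to_L2 f) \<le> c"
proof -
  have "AE p in torus. 0 \<le> c" using assms(2) by eventually_elim linarith
  then have c: "0 \<le> c" by simp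
  have sq: "square_integrable f" by (rule square_integrable_bounded[OF assms])
  have "(norm (to_L2 f))\<^sup>2 \<le> (LINT p|torus. c\<^sup>2)"
    unfolding norm_to_L2[OF sq]
  proof (rule integral_mono_AE)
    show "AE p in torus. (f p)\<^sup>2 \<le> c\<^sup>2"
      using assms(2)
    proof eventually_elim
      case (elim p)
      then show ?case using power_mono[of "\<bar>f p\<bar>" c 2] by simp
    qed
  qed (use sq in \<open>auto simp: square_integrable_def\<close>)
  then show ?thesis using c by (simp add: torus.prob_space power2_le_iff_abs_le)
qed

lemma square_integrable_continuous:
  assumes "continuous_on UNIV f" shows "square_integrable f"
  using assms unfolding square_integrable_def
  by (intro conjI continuous_integrable_torus continuous_measurable_torus continuous_intros) auto

lemma integrable_of_square_integrable:
  assumes "square_integrable f" shows "integrable torus f"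
  using square_integrable_mult[OF assms square_integrable_continuous[of "\<lambda>_. 1"]] by simp

lemma integrable_mult_bounded:
  fixes g :: "real \<times> real \<Rightarrow> complex"
  assumes "integrable torus f" "g \<in> borel_measurable torus" "\<And>p. cmod (g p) \<le> c"
  shows "integrable torus (\<lambda>p. complex_of_real (f p) * g p)"
proof (rule Bochner_Integration.integrable_bound)
  show "integrable torus (\<lambda>p. c * f p)" using assms(1) by simp
  show "(\<lambda>p. complex_of_real (f p) * g p) \<in> borel_measurable torus"
    using assms(2) borel_measurable_integrable[OF assms(1)] by measurable
  show "AE p in torus. norm (complex_of_real (f p) * g p) \<le> norm (c * f p)"
  proof (rule AE_I2)
    fix p
    have "\<bar>f p\<bar> * cmod (g p) \<le> \<bar>f p\<bar> * \<bar>c\<bar>"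
      using assms(3)[of p] by (intro mult_left_mono) auto
    then show "norm (complex_of_real (f p) * g p) \<le> norm (c * f p)"
      by (simp add: norm_mult abs_mult mult.commute)
  qed
qed

lemma integrable_ek:
  "integrable torus f \<Longrightarrow> integrable torus (\<lambda>p. complex_of_real (f p) * ek k p)"
  by (rule integrable_mult_bounded[of _ _ 1]) auto

lemmas integrable_repr = integrable_of_square_integrable[OF square_integrable_repr]

definition fc :: "l2_torus \<Rightarrow> int \<times> int \<Rightarrow> complex" where
  "fc f k = (LINT p|torus. complex_of_real (repr f p) * ek (- k) p)"

lemma fc_to_L2:
  assumes "square_integrable f"
  shows "fc (to_L2 f) k = (LINT p|torus. complex_of_real (f p) * ek (- k) p)"
  unfolding fc_def
proof (rule integral_cong_AE)
  show "AE p in torus. complex_of_real (repr (to_L2 f) p) * ek (- k) p = complex_of_real (f p) * ek (- k) p"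
    using repr_to_L2[OF assms] by eventually_elim simp
qed (use assms in \<open>auto simp: square_integrable_def\<close>)

lemma fc_add: "fc (f + g) k = fc f k + fc g k"
proof -
  have "f + g = to_L2 (\<lambda>p. repr f p + repr g p)"
    by (simp add: to_L2_add square_integrable_repr to_L2_repr)
  then have "fc (f + g) k = (LINT p|torus. complex_of_real (repr f p + repr g p) * ek (- k) p)"
    by (simp only: fc_to_L2 square_integrable_add square_integrable_repr)
  then show ?thesis
    by (simp add: distrib_right integrable_ek integrable_repr fc_def)
qed

lemma fc_scaleR: "fc (c *\<^sub>R f) k = c *\<^sub>R fc f k"
proof -
  have "c *\<^sub>R f = to_L2 (\<lambda>p. c * repr f p)"
    by (simp add: to_L2_scale square_integrable_repr to_L2_repr)
  then have "fc (c *\<^sub>R f) k = (LINT p|torus. complex_of_real (c * repr f p) * ek (- k) p)"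
    by (simp only: fc_to_L2 square_integrable_scale square_integrable_repr)
  then show ?thesis
    by (simp add: fc_def mult.assoc scaleR_conv_of_real)
qed

lemma fc_minus: "fc (- f) k = - fc f k"
  using fc_scaleR[of "-1" f k] by simp

lemma fc_diff: "fc (f - g) k = fc f k - fc g k"
  using fc_add[of f "- g" k] by (simp add: fc_minus)

lemma fc_0 [simp]: "fc 0 k = 0"
  using fc_scaleR[of 0 0 k] by simp

lemma fc_cnj: "fc f (- k) = cnj (fc f k)"
proof -
  have "cnj (fc f k) = (LINT p|torus. cnj (complex_of_real (repr f p) * ek (- k) p))"
    unfolding fc_def by (rule Bochner_Integration.integral_cnj[symmetric])
  then show ?thesis by (simp add: cnj_ek fc_def)
qed

lemma integral_trig_sum:
  assumes "finite K"
  shows "(LINT p|torus. (\<Sum>k\<in>K. c k * ek k p) * ek (- j) p) = (if j \<in> K then c j else 0)"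
proof -
  have "(LINT p|torus. (\<Sum>k\<in>K. c k * ek k p) * ek (- j) p) = (LINT p|torus. (\<Sum>k\<in>K. c k * ek (k - j) p))"
    by (simp add: sum_distrib_right mult.assoc flip: ek_add)
  also have "\<dots> = (\<Sum>k\<in>K. LINT p|torus. c k * ek (k - j) p)"
    by (intro Bochner_Integration.integral_sum) (auto intro!: continuous_integrable_torus continuous_intros)
  also have "\<dots> = (\<Sum>k\<in>K. if k = j then c k else 0)"
    by (intro sum.cong) (auto simp: integral_ek)
  finally show ?thesis using assms by simp
qed

lemma integral_mult_trig_sum:
  assumes "finite K"
  shows "(LINT p|torus. complex_of_real (repr f p) * cnj (\<Sum>k\<in>K. c k * ek k p)) = (\<Sum>k\<in>K. cnj (c k) * fc f k)"
proof -
  have "(LINT p|torus. complex_of_real (repr f p) * cnj (\<Sum>k\<in>K. c k * ek k p)) =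
    (LINT p|torus. (\<Sum>k\<in>K. cnj (c k) * (complex_of_real (repr f p) * ek (- k) p)))"
    by (simp add: sum_distrib_left cnj_ek algebra_simps)
  also have "\<dots> = (\<Sum>k\<in>K. LINT p|torus. cnj (c k) * (complex_of_real (repr f p) * ek (- k) p))"
    by (intro Bochner_Integration.integral_sum) (auto intro!: integrable_ek integrable_repr)
  finally show ?thesis by (simp add: fc_def)
qed

text \<open>With \<open>s\<close> the partial sum over \<open>K\<close> and \<open>Q\<close> the sum
  of the squared coefficients, both the pairing of \<open>f\<close> with \<open>s\<close> and the
  squared norm of \<open>s\<close> equal \<open>Q\<close>. Hence the squared distance from
  \<open>f\<close> to \<open>s\<close> is the squared norm of \<open>f\<close> minus
  \<open>Q\<close>, and it is nonnegative.\<close>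

lemma Bessel:
  assumes K: "finite K"
  shows "(\<Sum>k\<in>K. (cmod (fc f k))\<^sup>2) \<le> (norm f)\<^sup>2"
proof -
  define s where "s p = (\<Sum>k\<in>K. fc f k * ek k p)" for p
  define Q where "Q = (\<Sum>k\<in>K. (cmod (fc f k))\<^sup>2)"
  have cs: "continuous_on UNIV s" unfolding s_def by (intro continuous_intros)
  have Q: "complex_of_real Q = (\<Sum>k\<in>K. cnj (fc f k) * fc f k)"
    unfolding Q_def of_real_sum by (intro sum.cong refl) (simp add: complex_norm_square mult.commute del: of_real_power)
  have 1: "(LINT p|torus. complex_of_real (repr f p) * cnj (s p)) = Q"
    unfolding s_def integral_mult_trig_sum[OF K] Q ..
  have 2: "(LINT p|torus. s p * cnj (s p)) = Q"
  proof -
    have "(LINT p|torus. s p * cnj (s p)) = (LINT p|torus. (\<Sum>k\<in>K. cnj (fc f k) * (s p * ek (- k) p)))"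
      by (subst (2) s_def) (simp add: sum_distrib_left cnj_ek algebra_simps)
    also have "\<dots> = (\<Sum>k\<in>K. LINT p|torus. cnj (fc f k) * (s p * ek (- k) p))"
      by (intro Bochner_Integration.integral_sum)
        (auto intro!: continuous_integrable_torus continuous_intros cs)
    also have "\<dots> = (\<Sum>k\<in>K. cnj (fc f k) * fc f k)"
      using integral_trig_sum[OF K, of "fc f"] by (intro sum.cong) (auto simp: s_def)
    finally show ?thesis by (simp add: Q)
  qed
  have i1: "integrable torus (\<lambda>p. (repr f p)\<^sup>2)"
    using square_integrable_repr by (simp add: square_integrable_def)
  obtain B where B: "\<And>p. cmod (s p) \<le> B"
  proof
    show "cmod (s p) \<le> (\<Sum>k\<in>K. cmod (fc f k))" for p
      unfolding s_def by (rule order.trans[OF norm_sum]) (simp add: norm_mult)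
  qed
  have i2: "integrable torus (\<lambda>p. complex_of_real (repr f p) * cnj (s p))"
    by (rule integrable_mult_bounded[OF integrable_repr, of _ B])
       (auto simp: B intro!: continuous_measurable_torus continuous_intros cs)
  have i3: "integrable torus (\<lambda>p. s p * cnj (s p))"
    by (auto intro!: continuous_integrable_torus continuous_intros cs)
  have "(LINT p|torus. (cmod (complex_of_real (repr f p) - s p))\<^sup>2) =
      (LINT p|torus. (repr f p)\<^sup>2 - 2 * Re (complex_of_real (repr f p) * cnj (s p)) + Re (s p * cnj (s p)))"
  proof (intro Bochner_Integration.integral_cong refl)
    have "(cmod (complex_of_real a - z))\<^sup>2 = a\<^sup>2 - 2 * Re (complex_of_real a * cnj z) + Re (z * cnj z)" for a z
    proof -
      have "Re (z * cnj z) = Re z * Re z + Im z * Im z" by (simp only: times_complex.sel) simp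
      then show ?thesis
        unfolding cmod_power2 by (simp add: power2_eq_square algebra_simps del: complex_mult_cnj)
    qed
    then show "(cmod (complex_of_real (repr f p) - s p))\<^sup>2 =
        (repr f p)\<^sup>2 - 2 * Re (complex_of_real (repr f p) * cnj (s p)) + Re (s p * cnj (s p))" for p .
  qed
  also have "\<dots> = (norm f)\<^sup>2 - 2 * Re (LINT p|torus. complex_of_real (repr f p) * cnj (s p))
      + Re (LINT p|torus. s p * cnj (s p))"
  proof -
    have r2: "integrable torus (\<lambda>p. 2 * Re (complex_of_real (repr f p) * cnj (s p)))"
      using i2 by (intro integrable_mult_right integrable_Re)
    have r3: "integrable torus (\<lambda>p. Re (s p * cnj (s p)))"
      using i3 by (rule integrable_Re)
    have e2: "(LINT p|torus. 2 * Re (complex_of_real (repr f p) * cnj (s p))) = 2 * Re (LINT p|torus. complex_of_real (repr f p) * cnj (s p))"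
      by (simp only: integral_mult_right_zero Bochner_Integration.integral_Re[OF i2])
    show ?thesis
      unfolding norm_repr Bochner_Integration.integral_Re[OF i3, symmetric] e2[symmetric]
      unfolding Bochner_Integration.integral_add[OF Bochner_Integration.integrable_diff[OF i1 r2] r3]
        Bochner_Integration.integral_diff[OF i1 r2] ..
  qed
  also have "\<dots> = (norm f)\<^sup>2 - Q" unfolding 1 2 by simp
  finally have "(norm f)\<^sup>2 - Q = (LINT p|torus. (cmod (complex_of_real (repr f p) - s p))\<^sup>2)" ..
  then have "0 \<le> (norm f)\<^sup>2 - Q" by (metis (no_types, lifting) Bochner_Integration.integral_nonneg zero_le_power2)
  then show ?thesis by (simp add: Q_def)
qed

lemma norm_fc_le: "cmod (fc f k) \<le> norm f"
  using Bessel[of "{k}" f] by (simp add: power2_le_iff_abs_le)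

lemma bounded_linear_fc: "bounded_linear (\<lambda>f. fc f k)"
  by (rule bounded_linear_intro[of _ 1]) (auto simp: fc_add fc_scaleR norm_fc_le)

section \<open>Density of trigonometric polynomials and Parseval's identity\<close>

definition trig :: "(real \<times> real \<Rightarrow> complex) \<Rightarrow> bool" where
  "trig h \<longleftrightarrow> (\<exists>K c. finite K \<and> (\<forall>p. h p = (\<Sum>k\<in>K. c k * ek k p)))"

lemma trig_ek: "trig (\<lambda>p. a * ek k p)"
  unfolding trig_def by (rule exI[of _ "{k}"], rule exI[of _ "\<lambda>_. a"]) auto

lemma trig_add:
  assumes "trig g" "trig h" shows "trig (\<lambda>p. g p + h p)"
proof -
  obtain K c L d where *: "finite K" "\<And>p. g p = (\<Sum>k\<in>K. c k * ek k p)"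
    "finite L" "\<And>p. h p = (\<Sum>k\<in>L. d k * ek k p)"
    using assms unfolding trig_def by blast
  have "g p + h p = (\<Sum>k\<in>K \<union> L. ((if k \<in> K then c k else 0) + (if k \<in> L then d k else 0)) * ek k p)" for p
  proof -
    have "g p = (\<Sum>k\<in>K \<union> L. (if k \<in> K then c k else 0) * ek k p)"
      unfolding * by (rule sum.mono_neutral_cong_left) (use * in auto)
    moreover have "h p = (\<Sum>k\<in>K \<union> L. (if k \<in> L then d k else 0) * ek k p)"
      unfolding * by (rule sum.mono_neutral_cong_left) (use * in auto)
    ultimately show ?thesis by (simp add: distrib_right sum.distrib)
  qed
  then show ?thesis
    unfolding trig_def using * by (intro exI[of _ "K \<union> L"] exI[of _ "\<lambda>k. (if k \<in> K then c k else 0) + (if k \<in> L then d k else 0)"]) auto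
qed

lemma trig_const: "trig (\<lambda>p. a)"
  using trig_ek[of a 0] by simp

lemma trig_sum: "(\<And>i. i \<in> I \<Longrightarrow> trig (h i)) \<Longrightarrow> trig (\<lambda>p. \<Sum>i\<in>I. h i p)"
  by (induction I rule: infinite_finite_induct) (auto simp: trig_const trig_add)

lemma trig_mult:
  assumes "trig g" "trig h" shows "trig (\<lambda>p. g p * h p)"
proof -
  obtain K c L d where *: "finite K" "\<And>p. g p = (\<Sum>k\<in>K. c k * ek k p)"
    "finite L" "\<And>p. h p = (\<Sum>k\<in>L. d k * ek k p)"
    using assms unfolding trig_def by blast
  have "g p * h p = (\<Sum>k\<in>K. \<Sum>l\<in>L. (c k * d l) * ek (k + l) p)" for p
    unfolding * sum_product by (simp add: ek_add algebra_simps)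
  then show ?thesis by (simp add: trig_sum trig_ek)
qed

lemma trig_Re_ek: "trig (\<lambda>p. complex_of_real (Re (ek k p)))"
proof -
  have "complex_of_real (Re (ek k p)) = (1/2) * ek k p + (1/2) * ek (- k) p" for p
    by (simp add: cnj_ek[symmetric] complex_eq_iff)
  note * = this
  show ?thesis unfolding * by (intro trig_add trig_ek)
qed

lemma trig_Im_ek: "trig (\<lambda>p. complex_of_real (Im (ek k p)))"
proof -
  have "complex_of_real (Im (ek k p)) = (-\<i>/2) * ek k p + (\<i>/2) * ek (- k) p" for p
    by (simp add: cnj_ek[symmetric] complex_eq_iff)
  note * = this
  show ?thesis unfolding * by (intro trig_add trig_ek)
qed

text \<open>Embeds the torus in the plane of two complex variables as a product of unit circles.
  Periodicity becomes automatic, Stone-Weierstrass applies on a compact set, and real polynomials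
  pull back to trigonometric ones.\<close>

definition circ :: "real \<times> real \<Rightarrow> complex \<times> complex" where
  "circ p = (ek (1, 0) p, ek (0, 1) p)"

lemma continuous_on_circ: "continuous_on A circ"
  unfolding circ_def by (intro continuous_intros)

lemma trig_polynomial_circ:
  "real_polynomial_function g \<Longrightarrow> trig (\<lambda>p. complex_of_real (g (circ p)))"
proof (induction rule: real_polynomial_function.induct)
  case (linear g)
  interpret bounded_linear g by fact
  have "g (z, w) = Re z * g (1, 0) + Im z * g (\<i>, 0) + Re w * g (0, 1) + Im w * g (0, \<i>)" for z w
  proof -
    have "(z, w) = Re z *\<^sub>R (1, 0) + Im z *\<^sub>R (\<i>, 0) + Re w *\<^sub>R (0, 1) + Im w *\<^sub>R (0, \<i>)"
      by (simp add: complex_eq_iff)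
    then show ?thesis by (simp only: add scale) simp
  qed
  from this[of "ek (1,0) p" "ek (0,1) p" for p] have "complex_of_real (g (circ p)) =
      of_real (Re (ek (1,0) p)) * of_real (g (1, 0)) + of_real (Im (ek (1,0) p)) * of_real (g (\<i>, 0)) +
      of_real (Re (ek (0,1) p)) * of_real (g (0, 1)) + of_real (Im (ek (0,1) p)) * of_real (g (0, \<i>))" for p
    unfolding circ_def by (simp only: of_real_add of_real_mult)
  then show ?case by (simp only:) (intro trig_add trig_mult trig_const trig_Re_ek trig_Im_ek)
qed (auto intro: trig_const trig_add trig_mult)

definition trig_closure :: "l2_torus set" where
  "trig_closure = closure (to_L2 ` {g. trig (\<lambda>p. complex_of_real (g p))})"

lemma continuous_on_trig:
  assumes "trig (\<lambda>p. complex_of_real (g p))" shows "continuous_on UNIV g"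
proof -
  obtain K c where *: "\<And>p. complex_of_real (g p) = (\<Sum>k\<in>K. c k * ek k p)"
    using assms unfolding trig_def by blast
  have "continuous_on UNIV (\<lambda>p. Re (\<Sum>k\<in>K. c k * ek k p))" by (intro continuous_intros)
  then show ?thesis by (simp flip: *)
qed

lemma square_integrable_trig: "trig (\<lambda>p. complex_of_real (g p)) \<Longrightarrow> square_integrable g"
  by (intro square_integrable_continuous continuous_on_trig)

lemma trig_closure_add:
  assumes "f \<in> trig_closure" "g \<in> trig_closure" shows "f + g \<in> trig_closure"
proof -
  let ?T = "to_L2 ` {g. trig (\<lambda>p. complex_of_real (g p))}"
  have "x + y \<in> ?T" if xy: "x \<in> ?T" "y \<in> ?T" for x y
  proof -
    obtain u v where uv: "x = to_L2 u" "trig (\<lambda>p. complex_of_real (u p))"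
      "y = to_L2 v" "trig (\<lambda>p. complex_of_real (v p))" using xy by blast
    then have "x + y = to_L2 (\<lambda>p. u p + v p)" by (simp add: to_L2_add square_integrable_trig)
    moreover have "trig (\<lambda>p. complex_of_real (u p + v p))" using trig_add[OF uv(2,4)] by simp
    ultimately show ?thesis by blast
  qed
  moreover obtain F G where "\<And>n. F n \<in> ?T" "F \<longlonglongrightarrow> f" "\<And>n. G n \<in> ?T" "G \<longlonglongrightarrow> g"
    using assms unfolding trig_closure_def closure_sequential by blast
  ultimately show ?thesis
    unfolding trig_closure_def closure_sequential
    by (intro exI[of _ "\<lambda>n. F n + G n"] conjI allI tendsto_add) auto
qed

lemma trig_closure_scaleR:
  assumes "f \<in> trig_closure" shows "a *\<^sub>R f \<in> trig_closure"
proof -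
  let ?T = "to_L2 ` {g. trig (\<lambda>p. complex_of_real (g p))}"
  have "a *\<^sub>R x \<in> ?T" if x: "x \<in> ?T" for x
  proof -
    obtain u where u: "x = to_L2 u" "trig (\<lambda>p. complex_of_real (u p))" using x by blast
    then have "a *\<^sub>R x = to_L2 (\<lambda>p. a * u p)" by (simp add: to_L2_scale square_integrable_trig)
    moreover have "trig (\<lambda>p. complex_of_real (a * u p))" using trig_mult[OF trig_const[of a] u(2)] by simp
    ultimately show ?thesis by blast
  qed
  moreover obtain F where "\<And>n. F n \<in> ?T" "F \<longlonglongrightarrow> f"
    using assms unfolding trig_closure_def closure_sequential by blast
  ultimately show ?thesis
    unfolding trig_closure_def closure_sequential
    by (intro exI[of _ "\<lambda>n. a *\<^sub>R F n"] conjI allI tendsto_scaleR tendsto_const) auto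
qed

lemma trig_closure_limit:
  "(\<And>n. F n \<in> trig_closure) \<Longrightarrow> F \<longlonglongrightarrow> f \<Longrightarrow> f \<in> trig_closure"
  unfolding trig_closure_def using closed_sequentially closed_closure by blast

text \<open>Stone-Weierstrass gives a uniform polynomial approximation of \<open>h\<close>; on a
  space of total mass 1 a uniform error bounds the L2 error.\<close>

lemma trig_closure_continuous:
  assumes h: "continuous_on UNIV h"
  shows "to_L2 (\<lambda>p. h (circ p)) \<in> trig_closure"
  unfolding trig_closure_def closure_approachable
proof (intro allI impI)
  fix e :: real assume e: "e > 0"
  \<comment> \<open>A compact set containing the range of \<open>circ\<close>.\<close>
  let ?S = "cball 0 1 \<times> cball 0 (1::real) :: (complex \<times> complex) set"
  have "compact ?S" by (intro compact_Times compact_cball)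
  then obtain g where g: "real_polynomial_function g" "\<And>x. x \<in> ?S \<Longrightarrow> \<bar>h x - g x\<bar> < e/2"
    using Stone_Weierstrass_real_polynomial_function[of ?S h "e/2"] continuous_on_subset[OF h] e by auto
  let ?g = "\<lambda>p. g (circ p)"
  have t: "trig (\<lambda>p. complex_of_real (?g p))" by (rule trig_polynomial_circ) fact
  have sg: "square_integrable ?g" by (rule square_integrable_trig) fact
  have ch: "continuous_on UNIV (\<lambda>p. h (circ p))"
    by (intro continuous_on_compose2[OF h continuous_on_circ]) auto
  have "dist (to_L2 ?g) (to_L2 (\<lambda>p. h (circ p))) = norm (to_L2 (\<lambda>p. h (circ p) - ?g p))"
    by (simp add: to_L2_diff square_integrable_continuous ch sg dist_norm norm_minus_commute)
  also have "\<dots> \<le> e/2"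
  proof (rule norm_to_L2_le)
    show "(\<lambda>p. h (circ p) - ?g p) \<in> borel_measurable torus"
      using square_integrable_diff[OF square_integrable_continuous[OF ch] sg] by (simp add: square_integrable_def)
    have "\<bar>h (circ p) - ?g p\<bar> \<le> e/2" for p
      using g(2)[of "circ p"] by (simp add: circ_def)
    then show "AE p in torus. \<bar>h (circ p) - ?g p\<bar> \<le> e/2" by simp
  qed
  finally show "\<exists>y\<in>to_L2 ` {g. trig (\<lambda>p. complex_of_real (g p))}. dist y (to_L2 (\<lambda>p. h (circ p))) < e"
    using t e by (intro bexI[of _ "to_L2 ?g"]) auto
qed

text \<open>Dominated convergence for the squared differences: both \<open>F n\<close> and
  \<open>f\<close> are bounded by \<open>w\<close>, so \<open>4 * (w p)\<^sup>2\<close> is an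
  integrable majorant.\<close>

lemma to_L2_limit:
  assumes F: "\<And>n. F n \<in> borel_measurable torus" and f: "f \<in> borel_measurable torus"
    and w: "square_integrable w" and le: "\<And>n p. p \<in> space torus \<Longrightarrow> \<bar>F n p\<bar> \<le> w p"
    and lim: "\<And>p. p \<in> space torus \<Longrightarrow> (\<lambda>n. F n p) \<longlonglongrightarrow> f p"
  shows "square_integrable f" "(\<lambda>n. to_L2 (F n)) \<longlonglongrightarrow> to_L2 f"
proof -
  have fle: "\<bar>f p\<bar> \<le> w p" if "p \<in> space torus" for p
    using LIMSEQ_le_const2[OF tendsto_rabs[OF lim[OF that]]] le[OF that] by blast
  have sq: "square_integrable g" if "g \<in> borel_measurable torus" "\<And>p. p \<in> space torus \<Longrightarrow> \<bar>g p\<bar> \<le> w p" for g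
    unfolding square_integrable_def
  proof
    show "integrable torus (\<lambda>p. (g p)\<^sup>2)"
    proof (rule Bochner_Integration.integrable_bound)
      show "integrable torus (\<lambda>p. (w p)\<^sup>2)" using w by (simp add: square_integrable_def)
      show "AE p in torus. norm ((g p)\<^sup>2) \<le> norm ((w p)\<^sup>2)"
      proof (rule AE_I2)
        fix p assume "p \<in> space torus"
        then show "norm ((g p)\<^sup>2) \<le> norm ((w p)\<^sup>2)"
          using power_mono[of "\<bar>g p\<bar>" "w p" 2] that(2) by simp
      qed
    qed (use that in measurable)
  qed fact
  show sf: "square_integrable f" by (rule sq) (use f fle in auto)
  have sF: "square_integrable (F n)" for n by (rule sq) (use F le in auto)
  have "(\<lambda>n. (LINT p|torus. (F n p - f p)\<^sup>2)) \<longlonglongrightarrow> (LINT p|torus. 0)"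
  proof (rule integral_dominated_convergence[where w = "\<lambda>p. 4 * (w p)\<^sup>2"])
    show "integrable torus (\<lambda>p. 4 * (w p)\<^sup>2)" using w by (simp add: square_integrable_def)
    show "AE p in torus. (\<lambda>n. (F n p - f p)\<^sup>2) \<longlonglongrightarrow> 0"
    proof (rule AE_I2)
      fix p assume p: "p \<in> space torus"
      show "(\<lambda>n. (F n p - f p)\<^sup>2) \<longlonglongrightarrow> 0"
        using tendsto_power[OF tendsto_diff[OF lim[OF p] tendsto_const[of "f p"]], of 2] by simp
    qed
    show "AE p in torus. norm ((F n p - f p)\<^sup>2) \<le> 4 * (w p)\<^sup>2" for n
    proof (rule AE_I2)
      fix p assume p: "p \<in> space torus"
      have "\<bar>F n p - f p\<bar> \<le> 2 * w p" using le[OF p, of n] fle[OF p] by linarith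
      then show "norm ((F n p - f p)\<^sup>2) \<le> 4 * (w p)\<^sup>2"
        using power_mono[of "\<bar>F n p - f p\<bar>" "2 * w p" 2] by (simp add: power_mult_distrib)
    qed
  qed (use F f in measurable)
  moreover have "(LINT p|torus. (F n p - f p)\<^sup>2) = (norm (to_L2 (F n) - to_L2 f))\<^sup>2" for n
    by (simp add: norm_to_L2[OF square_integrable_diff[OF sF sf], symmetric] to_L2_diff sF sf)
  ultimately have "(\<lambda>n. (norm (to_L2 (F n) - to_L2 f))\<^sup>2) \<longlonglongrightarrow> 0" by simp
  from tendsto_real_sqrt[OF this] have "(\<lambda>n. norm (to_L2 (F n) - to_L2 f)) \<longlonglongrightarrow> 0" by simp
  then show "(\<lambda>n. to_L2 (F n)) \<longlonglongrightarrow> to_L2 f"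
    using LIM_zero_iff tendsto_norm_zero_iff by blast
qed

lemma measurable_circ: "circ \<in> torus \<rightarrow>\<^sub>M borel"
  by (intro continuous_measurable_torus continuous_on_circ)

lemma trig_closure_indicator_open:
  assumes U: "open U"
  shows "to_L2 (\<lambda>p. indicator U (circ p)) \<in> trig_closure"
proof (cases "U = UNIV")
  \<comment> \<open>Treated apart because \<open>infdist\<close> to the empty complement is 0 by
    convention, so the functions \<open>F n\<close> below would vanish.\<close>
  case True
  then show ?thesis using trig_closure_continuous[of "\<lambda>_. 1"] by simp
next
  case False
  \<comment> \<open>Continuous functions that vanish off \<open>U\<close> and increase to 1 at each
    point of \<open>U\<close>, since the distance to the closed complement is positive
    there.\<close>
  define F where "F n z = min 1 (real n * infdist z (- U))" for n z
  have cF: "continuous_on UNIV (F n)" for n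
    unfolding F_def by (intro continuous_intros)
  have "(\<lambda>n. to_L2 (\<lambda>p. F n (circ p))) \<longlonglongrightarrow> to_L2 (\<lambda>p. indicator U (circ p))"
  proof (rule to_L2_limit(2)[where w = "\<lambda>_. 1"])
    show "(\<lambda>p. F n (circ p)) \<in> borel_measurable torus" for n
      by (intro measurable_compose[OF measurable_circ] borel_measurable_continuous_onI cF)
    show "(\<lambda>p. indicator U (circ p)) \<in> borel_measurable torus"
      using U by (intro measurable_compose[OF measurable_circ]) simp
    show "square_integrable (\<lambda>_. 1)" by (intro square_integrable_continuous continuous_intros)
    show "\<bar>F n (circ p)\<bar> \<le> 1" for n p by (simp add: F_def infdist_nonneg)
    show "(\<lambda>n. F n (circ p)) \<longlonglongrightarrow> indicator U (circ p)" for p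
    proof (cases "circ p \<in> U")
      case True
      then have pos: "infdist (circ p) (- U) > 0"
        using in_closed_iff_infdist_zero[of "- U" "circ p"] infdist_nonneg[of "circ p" "- U"] U \<open>U \<noteq> UNIV\<close>
        by (metis ComplD Compl_empty_eq closed_Compl double_compl less_eq_real_def)
      then obtain N :: nat where N: "1 / infdist (circ p) (- U) \<le> real N" using real_arch_simple by blast
      have "F n (circ p) = 1" if "n \<ge> N" for n
      proof -
        have "1 / infdist (circ p) (- U) \<le> real n" using N that by linarith
        then show ?thesis using pos by (simp add: F_def field_simps)
      qed
      then have "\<forall>\<^sub>F n in sequentially. F n (circ p) = 1" by (auto simp: eventually_sequentially)
      then show ?thesis using True by (simp add: tendsto_eventually)
    next
      case False
      then show ?thesis by (simp add: F_def)
    qed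
  qed
  then show ?thesis
    by (rule trig_closure_limit[rotated]) (rule trig_closure_continuous[OF cF])
qed

lemma square_integrable_indicator_circ:
  assumes "B \<in> sets borel" shows "square_integrable (\<lambda>p. indicator B (circ p))"
  by (rule square_integrable_bounded[of _ 1])
     (use assms in \<open>auto intro!: measurable_compose[OF measurable_circ] simp: indicator_def\<close>)

text \<open>Induction from the intersection-stable generator of open sets: complements are
  differences of classes, and a countable disjoint union is the dominated limit of finite ones. Both
  stay inside a closed linear subspace.\<close>

lemma trig_closure_indicator:
  assumes "B \<in> sets borel"
  shows "to_L2 (\<lambda>p. indicator B (circ p)) \<in> trig_closure"
proof -
  have B: "B \<in> sigma_sets UNIV {S :: (complex \<times> complex) set. open S}"
    using assms by (simp add: borel_def)
  have *: "A \<in> sets borel" if "A \<in> sigma_sets UNIV {S :: (complex \<times> complex) set. open S}" for A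
    using that by (simp add: borel_def)
  have "Int_stable {S :: (complex \<times> complex) set. open S}" by (auto simp: Int_stable_def)
  then show ?thesis
  proof (rule sigma_sets_induct_disjoint[OF _ _ B, where P = "\<lambda>B. to_L2 (\<lambda>p. indicator B (circ p)) \<in> trig_closure"])
    show "to_L2 (\<lambda>p. indicator {} (circ p)) \<in> trig_closure"
      using trig_closure_indicator_open[of "{}"] by simp
  next
    fix A assume A: "A \<in> sigma_sets UNIV {S :: (complex \<times> complex) set. open S}"
      "to_L2 (\<lambda>p. indicator A (circ p)) \<in> trig_closure"
    have "to_L2 (\<lambda>p. indicator (UNIV - A) (circ p)) = to_L2 (\<lambda>p. indicator UNIV (circ p) - indicator A (circ p))"
      by (intro arg_cong[of _ _ to_L2] ext) (simp split: split_indicator)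
    also have "\<dots> = to_L2 (\<lambda>p. indicator UNIV (circ p)) - to_L2 (\<lambda>p. indicator A (circ p))"
      using *[OF A(1)] by (intro to_L2_diff square_integrable_indicator_circ) auto
    finally show "to_L2 (\<lambda>p. indicator (UNIV - A) (circ p)) \<in> trig_closure"
      using trig_closure_add[OF trig_closure_indicator_open[of UNIV] trig_closure_scaleR[OF A(2), of "-1"]] by simp
  next
    fix A :: "nat \<Rightarrow> (complex \<times> complex) set"
    assume d: "disjoint_family A" and A: "range A \<subseteq> sigma_sets UNIV {S. open S}"
      and P: "\<And>i. to_L2 (\<lambda>p. indicator (A i) (circ p)) \<in> trig_closure"
    have Am: "A i \<in> sets borel" for i using A * by blast
    have fin: "to_L2 (\<lambda>p. indicator (\<Union>i<n. A i) (circ p)) \<in> trig_closure" for n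
    proof (induction n)
      case 0
      then show ?case using trig_closure_indicator_open[of "{}"] by simp
    next
      case (Suc n)
      have "(\<Union>i<n. A i) \<inter> A n = {}" using d
        by (auto simp: disjoint_family_on_def) (metis IntI empty_iff less_irrefl)
      then have "to_L2 (\<lambda>p. indicator (\<Union>i<Suc n. A i) (circ p)) =
          to_L2 (\<lambda>p. indicator (\<Union>i<n. A i) (circ p) + indicator (A n) (circ p))"
        by (intro arg_cong[of _ _ to_L2] ext) (auto simp: lessThan_Suc split: split_indicator)
      also have "\<dots> = to_L2 (\<lambda>p. indicator (\<Union>i<n. A i) (circ p)) + to_L2 (\<lambda>p. indicator (A n) (circ p))"
        using Am by (intro to_L2_add square_integrable_indicator_circ) auto
      finally show ?case using trig_closure_add[OF Suc P] by simp
    qed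
    have "(\<lambda>n. to_L2 (\<lambda>p. indicator (\<Union>i<n. A i) (circ p))) \<longlonglongrightarrow> to_L2 (\<lambda>p. indicator (\<Union>i. A i) (circ p))"
    proof (rule to_L2_limit(2)[where w = "\<lambda>_. 1"])
      show "(\<lambda>n. indicator (\<Union>i<n. A i) (circ p)) \<longlonglongrightarrow> indicat_real (\<Union>i. A i) (circ p)" for p
        by (rule LIMSEQ_indicator_UN)
    qed (use Am in \<open>auto intro!: measurable_compose[OF measurable_circ] square_integrable_continuous simp: indicator_def\<close>)
    then show "to_L2 (\<lambda>p. indicator (\<Union>(range A)) (circ p)) \<in> trig_closure"
      using trig_closure_limit[OF fin] by simp
  qed (auto intro: trig_closure_indicator_open)
qed

text \<open>Inverts \<open>x \<mapsto> cis (2 * pi * x)\<close> on \<open>[0,1)\<close>. Clamping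
  the argument of \<open>arccos\<close> makes that part continuous on all complex numbers, so
  measurability follows without restricting to the circle.\<close>

definition angle :: "complex \<Rightarrow> real" where
  "angle z = (if Im z \<ge> 0 then arccos (max (-1) (min 1 (Re z))) / (2 * pi)
     else 1 - arccos (max (-1) (min 1 (Re z))) / (2 * pi))"

lemma measurable_angle [measurable]: "angle \<in> borel_measurable borel"
proof -
  have "continuous_on UNIV (\<lambda>z. arccos (max (-1) (min 1 (Re z))))"
    by (intro continuous_intros) auto
  then have [measurable]: "(\<lambda>z. arccos (max (-1) (min 1 (Re z)))) \<in> borel_measurable borel"
    by (rule borel_measurable_continuous_onI)
  show ?thesis unfolding angle_def by measurable
qed

lemma angle_cis:
  assumes "0 \<le> x" "x < 1" shows "angle (cis (2 * pi * x)) = x"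
proof (cases "x \<le> 1/2")
  case True
  then have "2 * pi * x \<le> pi" by (simp add: mult_le_cancel_left1 field_simps)
  moreover have "0 \<le> 2 * pi * x" using assms by simp
  ultimately show ?thesis using sin_ge_zero[of "2 * pi * x"] by (simp add: angle_def arccos_cos)
next
  case False
  have "2 * pi * x = 2 * pi - 2 * pi * (1 - x)" by (simp add: algebra_simps)
  then have c: "cos (2 * pi * x) = cos (2 * pi * (1 - x))" and s: "sin (2 * pi * x) = - sin (2 * pi * (1 - x))"
    by (metis cos_2pi_minus, metis sin_2pi_minus)
  have "2 * pi * (1 - x) < 2 * pi * (1/2)" using False by (intro mult_strict_left_mono) auto
  then have l: "2 * pi * (1 - x) < pi" by simp
  have g: "0 < 2 * pi * (1 - x)" using assms by simp
  have "sin (2 * pi * (1 - x)) > 0" using l g by (intro sin_gt_zero) auto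
  then show ?thesis using l g by (simp add: angle_def s c arccos_cos)
qed

text \<open>
  \<open>angle\<close> inverts \<open>circ\<close> on the cell, so every function on the cell factors through \<open>circ\<close>.
\<close>

lemma trig_closure_UNIV: "f \<in> trig_closure"
proof -
  define \<Psi> where "\<Psi> z = (angle (fst z), angle (snd z))" for z :: "complex \<times> complex"
  define C where "C = {0..<1::real} \<times> {0..<1::real}"
  have inv: "\<Psi> (circ p) = p" if "p \<in> space torus" for p
    using that by (auto simp: \<Psi>_def circ_def ek_def space_torus angle_cis)
  have [measurable]: "\<Psi> \<in> borel \<rightarrow>\<^sub>M borel"
    unfolding \<Psi>_def borel_prod[symmetric] by measurable
  \<comment> \<open>The indicator is essential for Borel measurability: \<open>repr f\<close> is
    known to be measurable on the cell only.\<close>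
  define g where "g z = indicator C (\<Psi> z) *\<^sub>R repr f (\<Psi> z)" for z
  have "(\<lambda>p. indicator C p *\<^sub>R repr f p) \<in> borel_measurable lborel"
    using repr_measurable[of f] unfolding torus_def C_def
    by (subst (asm) borel_measurable_restrict_space_iff) auto
  then have [measurable]: "(\<lambda>p. indicator C p *\<^sub>R repr f p) \<in> borel_measurable borel"
    using measurable_cong_sets[OF sets_lborel refl] by blast
  have gm: "g \<in> borel_measurable borel"
    unfolding g_def by (rule measurable_compose[of \<Psi> borel borel "\<lambda>p. indicator C p *\<^sub>R repr f p"]) fact+
  have gc: "g (circ p) = repr f p" if "p \<in> space torus" for p
    using that inv[OF that] by (simp add: g_def space_torus C_def)
  \<comment> \<open>Approximation by simple functions with distance to 0 at most twice that of
    \<open>g\<close>; this is the origin of the majorant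
    \<open>2 * \<bar>repr f p\<bar>\<close>.\<close>
  obtain F where F: "\<And>i. simple_function borel (F i)" "\<And>z. (\<lambda>i. F i z) \<longlonglongrightarrow> g z"
    "\<And>i z. \<bar>F i z\<bar> \<le> 2 * \<bar>g z\<bar>"
    using borel_measurable_implies_sequence_metric[OF gm, of 0] by (auto simp: dist_real_def)
  have Fm: "F i \<in> borel_measurable borel" for i using F(1) by (rule borel_measurable_simple_function)
  have "(\<lambda>i. to_L2 (\<lambda>p. F i (circ p))) \<longlonglongrightarrow> to_L2 (repr f)"
  proof (rule to_L2_limit(2)[where w = "\<lambda>p. 2 * \<bar>repr f p\<bar>"])
    show "square_integrable (\<lambda>p. 2 * \<bar>repr f p\<bar>)"
      using square_integrable_repr[of f] by (intro square_integrable_scale) (auto simp: square_integrable_def)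
    show "\<bar>F n (circ p)\<bar> \<le> 2 * \<bar>repr f p\<bar>" if "p \<in> space torus" for n p
      using F(3)[of n "circ p"] gc[OF that] by simp
    show "(\<lambda>n. F n (circ p)) \<longlonglongrightarrow> repr f p" if "p \<in> space torus" for p
      using F(2)[of "circ p"] gc[OF that] by simp
  qed (auto intro: measurable_compose[OF measurable_circ] Fm)
  moreover have "to_L2 (\<lambda>p. F i (circ p)) \<in> trig_closure" for i
  proof -
    have fin: "finite (range (F i))" using F(1)[of i] by (simp add: simple_function_def)
    have m: "F i -` {y} \<in> sets borel" for y using measurable_sets[OF Fm[of i], of "{y}"] by simp
    have "square_integrable (\<lambda>p. \<Sum>y\<in>Y. y * indicator (F i -` {y}) (circ p)) \<and>
        to_L2 (\<lambda>p. \<Sum>y\<in>Y. y * indicator (F i -` {y}) (circ p)) \<in> trig_closure" if "finite Y" for Y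
      using that
    proof induction
      case empty
      then show ?case using trig_closure_indicator_open[of "{}"] square_integrable_zero by simp
    next
      case (insert y Y)
      have 1: "square_integrable (\<lambda>p. y * indicator (F i -` {y}) (circ p))"
        by (intro square_integrable_scale square_integrable_indicator_circ m)
      have 2: "to_L2 (\<lambda>p. y * indicator (F i -` {y}) (circ p)) \<in> trig_closure"
        by (simp add: to_L2_scale square_integrable_indicator_circ m trig_closure_scaleR trig_closure_indicator)
      show ?case
        unfolding sum.insert[OF insert.hyps] to_L2_add[OF 1 conjunct1[OF insert.IH]]
        by (intro conjI square_integrable_add[OF 1 conjunct1[OF insert.IH]]
            trig_closure_add[OF 2 conjunct2[OF insert.IH]])
    qed
    from conjunct2[OF this[OF fin]]
    have "to_L2 (\<lambda>p. \<Sum>y\<in>range (F i). y * indicator (F i -` {y}) (circ p)) \<in> trig_closure" .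
    moreover have "(\<Sum>y\<in>range (F i). y * indicator (F i -` {y}) z) = F i z" for z
    proof -
      have "(\<Sum>y\<in>range (F i). y * indicator (F i -` {y}) z) = (\<Sum>y\<in>range (F i). if y = F i z then y else 0)"
        by (intro sum.cong) (auto simp: indicator_def)
      then show ?thesis using fin by simp
    qed
    ultimately show ?thesis by simp
  qed
  ultimately show ?thesis using trig_closure_limit to_L2_repr by metis
qed

text \<open>Bessel gives one inequality. For the other, approximate \<open>f\<close> by a
  trigonometric polynomial \<open>G\<close>, whose norm is exactly the l2 norm of its coefficients
  on \<open>K\<close>, and compare the coefficients of \<open>G\<close> and \<open>f\<close> on
  \<open>K\<close> by the triangle inequality; Bessel for \<open>G - f\<close> bounds the
  discrepancy.\<close>

lemma Parseval: "((\<lambda>k. (cmod (fc f k))\<^sup>2) has_sum (norm f)\<^sup>2) UNIV"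
proof -
  define Q where "Q = (\<Sum>\<^sub>\<infinity>k. (cmod (fc f k))\<^sup>2)"
  have s: "(\<lambda>k. (cmod (fc f k))\<^sup>2) summable_on UNIV"
    by (rule nonneg_bounded_partial_sums_imp_summable_on[where C = "(norm f)\<^sup>2"])
       (auto intro!: eventually_finite_subsets_at_top_weakI Bessel)
  have Q1: "Q \<le> (norm f)\<^sup>2" unfolding Q_def by (rule infsum_le_finite_sums[OF s]) (rule Bessel)
  have Q0: "0 \<le> Q" unfolding Q_def by (rule infsum_nonneg) simp
  have "norm f \<le> sqrt Q + e" if e: "e > 0" for e
  proof -
    obtain g where g: "trig (\<lambda>p. complex_of_real (g p))" "dist (to_L2 g) f < e/2"
      using trig_closure_UNIV[of f] e unfolding trig_closure_def closure_approachable
      by (metis (no_types, lifting) half_gt_zero imageE mem_Collect_eq)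
    then obtain K c where K: "finite K" "\<And>p. complex_of_real (g p) = (\<Sum>k\<in>K. c k * ek k p)"
      unfolding trig_def by blast
    have sg: "square_integrable g" by (rule square_integrable_trig) fact
    define G where "G = to_L2 g"
    have c: "fc G k = c k" if "k \<in> K" for k
      unfolding G_def fc_to_L2[OF sg] K(2) integral_trig_sum[OF K(1)] using that by simp
    \<comment> \<open>For the trigonometric polynomial itself the identity is a finite computation:
      pair \<open>G\<close> with its own expansion.\<close>
    have "complex_of_real ((norm G)\<^sup>2) = (LINT p|torus. complex_of_real (repr G p) * cnj (complex_of_real (repr G p)))"
      unfolding norm_repr integral_complex_of_real[symmetric] by (simp add: power2_eq_square)
    also have "\<dots> = (LINT p|torus. complex_of_real (repr G p) * cnj (\<Sum>k\<in>K. c k * ek k p))"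
    proof (rule integral_cong_AE)
      show "AE p in torus. complex_of_real (repr G p) * cnj (complex_of_real (repr G p)) =
          complex_of_real (repr G p) * cnj (\<Sum>k\<in>K. c k * ek k p)"
        using repr_to_L2[OF sg] unfolding G_def by eventually_elim (simp flip: K(2))
      have [measurable]: "g \<in> borel_measurable torus" using sg by (simp add: square_integrable_def)
      show "(\<lambda>p. complex_of_real (repr G p) * cnj (\<Sum>k\<in>K. c k * ek k p)) \<in> borel_measurable torus"
        unfolding K(2)[symmetric] complex_cnj_complex_of_real by measurable
    qed auto
    also have "\<dots> = (\<Sum>k\<in>K. cnj (c k) * fc G k)" by (rule integral_mult_trig_sum[OF K(1)])
    also have "\<dots> = complex_of_real (\<Sum>k\<in>K. (cmod (fc G k))\<^sup>2)"
      unfolding of_real_sum by (intro sum.cong refl) (simp add: c complex_norm_square mult.commute del: of_real_power)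
    finally have "(norm G)\<^sup>2 = (\<Sum>k\<in>K. (cmod (fc G k))\<^sup>2)" using of_real_eq_iff by blast
    then have nG: "norm G = L2_set (\<lambda>k. cmod (fc G k)) K"
      unfolding L2_set_def by (metis norm_ge_zero real_sqrt_unique)
    have "norm f \<le> norm (f - G) + norm G" by (metis norm_triangle_sub add.commute)
    also have "norm (f - G) < e/2" using g(2) by (simp add: G_def dist_norm norm_minus_commute)
    also have "norm G \<le> L2_set (\<lambda>k. cmod (fc f k) + cmod (fc (G - f) k)) K"
      unfolding nG
    proof (rule L2_set_mono)
      show "cmod (fc G k) \<le> cmod (fc f k) + cmod (fc (G - f) k)" for k
        using norm_triangle_ineq[of "fc f k" "fc (G - f) k"] by (simp add: fc_diff)
    qed simp
    also have "\<dots> \<le> L2_set (\<lambda>k. cmod (fc f k)) K + L2_set (\<lambda>k. cmod (fc (G - f) k)) K"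
      by (rule L2_set_triangle_ineq)
    also have "L2_set (\<lambda>k. cmod (fc f k)) K \<le> sqrt Q"
      unfolding L2_set_def Q_def by (intro real_sqrt_le_mono finite_sum_le_infsum s K(1)) auto
    also have "L2_set (\<lambda>k. cmod (fc (G - f) k)) K \<le> norm (G - f)"
      unfolding L2_set_def using Bessel[OF K(1)] by (simp add: real_le_lsqrt sum_nonneg)
    also have "norm (G - f) < e/2" using g(2) by (simp add: G_def dist_norm)
    finally show ?thesis by simp
  qed
  then have "norm f \<le> sqrt Q" by (rule field_le_epsilon)
  then have "(norm f)\<^sup>2 \<le> Q" using power_mono[of "norm f" "sqrt Q" 2] Q0 by simp
  then have "Q = (norm f)\<^sup>2" using Q1 by simp
  then show ?thesis using has_sum_infsum[OF s] unfolding Q_def by simp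
qed

text \<open>Equal coefficients force a difference of norm 0 by Parseval. From here on, identities
  between classes are checked one coefficient at a time.\<close>

lemma fc_inject:
  assumes "\<And>k. fc f k = fc g k" shows "f = g"
proof -
  have "(\<lambda>k. (cmod (fc (f - g) k))\<^sup>2) = (\<lambda>_. 0)" using assms by (simp add: fc_diff)
  then have "((\<lambda>_::int \<times> int. 0) has_sum (norm (f - g))\<^sup>2) UNIV" using Parseval[of "f - g"] by simp
  then have "(norm (f - g))\<^sup>2 = 0"
    by (rule has_sum_unique) (rule has_sum_0, simp)
  then show ?thesis by simp
qed

text \<open>Polarization of \<open>Parseval\<close>, applied to \<open>f + g\<close> and
  \<open>f - g\<close>.\<close>

lemma Parseval_inner: "((\<lambda>k. Re (fc f k * cnj (fc g k))) has_sum (f \<bullet> g)) UNIV"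
proof -
  have "((\<lambda>k. 1/4 * (cmod (fc (f + g) k))\<^sup>2 + (- 1/4) * (cmod (fc (f - g) k))\<^sup>2) has_sum
      1/4 * (norm (f + g))\<^sup>2 + (- 1/4) * (norm (f - g))\<^sup>2) UNIV"
    by (intro has_sum_add has_sum_cmult_right Parseval)
  moreover have "1/4 * (norm (f + g))\<^sup>2 + (- 1/4) * (norm (f - g))\<^sup>2 = f \<bullet> g"
    by (simp add: power2_norm_eq_inner inner_simps inner_commute field_simps)
  moreover have "1/4 * (cmod (fc (f + g) k))\<^sup>2 + (- 1/4) * (cmod (fc (f - g) k))\<^sup>2 = Re (fc f k * cnj (fc g k))" for k
    unfolding cmod_power2 by (simp add: fc_add fc_diff power2_eq_square algebra_simps)
  ultimately show ?thesis by (simp only:)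
qed

section \<open>Weak derivatives on the Fourier side\<close>

text \<open>The Fourier multiplier of the derivative of order \<open>m\<close> in x and
  \<open>n\<close> in y.\<close>

definition dsym :: "nat \<Rightarrow> nat \<Rightarrow> int \<times> int \<Rightarrow> complex" where
  "dsym m n k = (2 * pi * \<i> * of_int (fst k)) ^ m * (2 * pi * \<i> * of_int (snd k)) ^ n"

lemma cnj_dsym: "cnj (dsym m n k) = (-1) ^ (m + n) * dsym m n k"
proof -
  define z where "z j = 2 * pi * \<i> * complex_of_int j" for j
  have "cnj (z j) ^ l = (- 1) ^ l * z j ^ l" for j l
  proof -
    have "cnj (z j) = - z j" by (simp add: z_def)
    then show ?thesis by (simp only: power_minus[of "z j"])
  qed
  then show ?thesis
    unfolding dsym_def z_def[symmetric] complex_cnj_mult complex_cnj_power power_add by simp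
qed

lemma dsym_uminus: "dsym m n (- k) = cnj (dsym m n k)"
  by (simp add: dsym_def)

lemma has_derivative_Re_ek:
  "((\<lambda>p. Re (c * ek k p)) has_derivative
     (\<lambda>h. Re (2 * pi * \<i> * (of_int (fst k) * fst h + of_int (snd k) * snd h) * c * ek k p))) (at p)"
  unfolding ek_def
  by (auto intro!: derivative_eq_intros simp: algebra_simps)

lemma partial_x_Re_ek:
  "partial_x (\<lambda>p. Re (c * ek k p)) = (\<lambda>p. Re ((2 * pi * \<i> * of_int (fst k) * c) * ek k p))"
  unfolding partial_x_def frechet_derivative_at[OF has_derivative_Re_ek, symmetric] by (rule ext) simp

lemma partial_y_Re_ek:
  "partial_y (\<lambda>p. Re (c * ek k p)) = (\<lambda>p. Re ((2 * pi * \<i> * of_int (snd k) * c) * ek k p))"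
  unfolding partial_y_def frechet_derivative_at[OF has_derivative_Re_ek, symmetric] by (rule ext) simp

lemma continuous_on_Re_ek: "continuous_on A (\<lambda>p. Re (c * ek k p))"
  by (intro continuous_intros)

text \<open>Test functions are real, so exponentials enter through \<open>Re (c * ek k p)\<close>.
  The free constant \<open>c\<close> absorbs the factors created by differentiation, which closes
  the induction, and later selects real and imaginary parts.\<close>

lemma test_function_Re_ek: "(\<lambda>p. Re (c * ek k p)) \<in> test_functions"
proof -
  have "smooth_upto j (\<lambda>p. Re (c * ek k p))" for j
  proof (induction j arbitrary: c)
    case 0
    then show ?case by (simp only: smooth_upto.simps continuous_on_Re_ek)
  next
    case (Suc j)
    have "(\<lambda>p. Re (c * ek k p)) differentiable (at p)" for p
      using has_derivative_Re_ek unfolding differentiable_def by blast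
    with Suc show ?case by (simp only: smooth_upto.simps partial_x_Re_ek partial_y_Re_ek) blast
  qed
  then show ?thesis by (simp add: test_functions_def ek_periodic)
qed

lemma partials_Re_ek:
  "(partial_x ^^ m) ((partial_y ^^ n) (\<lambda>p. Re (c * ek k p))) = (\<lambda>p. Re ((dsym m n k * c) * ek k p))"
proof -
  have y: "(partial_y ^^ n) (\<lambda>p. Re (c * ek k p)) = (\<lambda>p. Re (((2 * pi * \<i> * of_int (snd k)) ^ n * c) * ek k p))" for c
  proof (induction n)
    case (Suc n)
    have "(partial_y ^^ Suc n) (\<lambda>p. Re (c * ek k p)) = partial_y ((partial_y ^^ n) (\<lambda>p. Re (c * ek k p)))" by simp
    then show ?case unfolding Suc partial_y_Re_ek by (simp add: mult.assoc)
  qed simp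
  have x: "(partial_x ^^ m) (\<lambda>p. Re (c * ek k p)) = (\<lambda>p. Re (((2 * pi * \<i> * of_int (fst k)) ^ m * c) * ek k p))" for c
  proof (induction m)
    case (Suc m)
    have "(partial_x ^^ Suc m) (\<lambda>p. Re (c * ek k p)) = partial_x ((partial_x ^^ m) (\<lambda>p. Re (c * ek k p)))" by simp
    then show ?case unfolding Suc partial_x_Re_ek by (simp add: mult.assoc)
  qed simp
  show ?thesis unfolding y x dsym_def by (simp only: mult.assoc)
qed

lemma integral_Re_ek: "(LINT p|torus. repr f p * Re (c * ek k p)) = Re (c * cnj (fc f k))"
proof -
  have i: "integrable torus (\<lambda>p. c * (complex_of_real (repr f p) * ek k p))"
    by (intro integrable_mult_right integrable_ek integrable_repr)
  have "(LINT p|torus. repr f p * Re (c * ek k p)) = (LINT p|torus. Re (c * (complex_of_real (repr f p) * ek k p)))"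
    by (intro Bochner_Integration.integral_cong refl) (simp add: algebra_simps)
  also have "\<dots> = Re (LINT p|torus. c * (complex_of_real (repr f p) * ek k p))"
    by (rule Bochner_Integration.integral_Re[OF i])
  also have "(LINT p|torus. c * (complex_of_real (repr f p) * ek k p)) = c * fc f (- k)"
    by (simp add: fc_def)
  finally show ?thesis by (simp add: fc_cnj)
qed

lemma test_function_differentiable: "\<phi> \<in> test_functions \<Longrightarrow> \<phi> differentiable (at p)"
proof -
  assume "\<phi> \<in> test_functions"
  then have "smooth_upto (Suc 0) \<phi>" unfolding test_functions_def by blast
  then show "\<phi> differentiable (at p)" by (cases p) simp
qed

lemma test_function_continuous: "\<phi> \<in> test_functions \<Longrightarrow> continuous_on UNIV \<phi>"
  unfolding test_functions_def by (auto dest: spec[of _ 0])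

lemma frechet_derivative_periodic:
  assumes "\<And>p. \<phi> (p + a) = \<phi> p" "\<And>p. \<phi> differentiable (at p)"
  shows "frechet_derivative \<phi> (at (p + a)) = frechet_derivative \<phi> (at p)"
proof -
  have "(\<phi> has_derivative frechet_derivative \<phi> (at (p + a))) (at (p + a))"
    using assms(2) frechet_derivative_works by blast
  from has_derivative_compose[OF has_derivative_add_const[OF has_derivative_ident] this]
  have "(\<phi> has_derivative frechet_derivative \<phi> (at (p + a))) (at p)"
    by (simp add: assms(1))
  then show ?thesis by (rule frechet_derivative_at)
qed

lemma test_function_partial:
  assumes "\<phi> \<in> test_functions"
  shows "partial_x \<phi> \<in> test_functions" "partial_y \<phi> \<in> test_functions"
proof -
  have s: "smooth_upto j (partial_x \<phi>)" "smooth_upto j (partial_y \<phi>)" for j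
    using assms unfolding test_functions_def by (auto dest: spec[of _ "Suc j"])
  have p: "\<phi> (p + (1, 0)) = \<phi> p" "\<phi> (p + (0, 1)) = \<phi> p" for p
    using assms unfolding test_functions_def by (cases p; simp)+
  have "frechet_derivative \<phi> (at (p + (1, 0))) = frechet_derivative \<phi> (at p)"
    "frechet_derivative \<phi> (at (p + (0, 1))) = frechet_derivative \<phi> (at p)" for p
    by (intro frechet_derivative_periodic p test_function_differentiable assms)+
  from this[of "(x, y)" for x y]
  show "partial_x \<phi> \<in> test_functions" "partial_y \<phi> \<in> test_functions"
    unfolding test_functions_def using s by (auto simp: partial_x_def partial_y_def)
qed

lemma partial_has_vector_derivative:
  assumes "\<phi> differentiable (at (x, y))"
  shows "((\<lambda>x. \<phi> (x, y)) has_vector_derivative partial_x \<phi> (x, y)) (at x)"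
    "((\<lambda>y. \<phi> (x, y)) has_vector_derivative partial_y \<phi> (x, y)) (at y)"
proof -
  have d: "(\<phi> has_derivative frechet_derivative \<phi> (at (x, y))) (at (x, y))"
    using assms frechet_derivative_works by blast
  then interpret bounded_linear "frechet_derivative \<phi> (at (x, y))"
    by (rule has_derivative_bounded_linear)
  have "((\<lambda>x. \<phi> (x, y)) has_derivative (\<lambda>h. frechet_derivative \<phi> (at (x, y)) (h, 0))) (at x)"
    by (rule has_derivative_compose[where f = "\<lambda>x. (x, y)" and g = \<phi>, OF _ d]) (auto intro!: derivative_eq_intros)
  moreover have "frechet_derivative \<phi> (at (x, y)) (h, 0) = h *\<^sub>R partial_x \<phi> (x, y)" for h
    using scale[of h "(1, 0)"] by (simp add: partial_x_def)
  ultimately show "((\<lambda>x. \<phi> (x, y)) has_vector_derivative partial_x \<phi> (x, y)) (at x)"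
    by (simp add: has_vector_derivative_def)
  have "((\<lambda>y. \<phi> (x, y)) has_derivative (\<lambda>h. frechet_derivative \<phi> (at (x, y)) (0, h))) (at y)"
    by (rule has_derivative_compose[where f = "\<lambda>y. (x, y)" and g = \<phi>, OF _ d]) (auto intro!: derivative_eq_intros)
  moreover have "frechet_derivative \<phi> (at (x, y)) (0, h) = h *\<^sub>R partial_y \<phi> (x, y)" for h
    using scale[of h "(0, 1)"] by (simp add: partial_y_def)
  ultimately show "((\<lambda>y. \<phi> (x, y)) has_vector_derivative partial_y \<phi> (x, y)) (at y)"
    by (simp add: has_vector_derivative_def)
qed

text \<open>Integration by parts: the derivative of the periodic product of \<open>\<phi>\<close>
  and \<open>ek (- k)\<close> integrates to 0, and the product rule splits it into the two
  coefficients being compared.\<close>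

lemma fc_partial:
  assumes \<phi>: "\<phi> \<in> test_functions"
  shows "fc (to_L2 (partial_x \<phi>)) k = 2 * pi * \<i> * of_int (fst k) * fc (to_L2 \<phi>) k"
    "fc (to_L2 (partial_y \<phi>)) k = 2 * pi * \<i> * of_int (snd k) * fc (to_L2 \<phi>) k"
proof -
  note c = test_function_continuous[OF \<phi>] test_function_partial[OF \<phi>, THEN test_function_continuous]
  note sq = c[THEN square_integrable_continuous]
  have i: "integrable torus (\<lambda>p. complex_of_real (g p) * ek (- k) p)" if "square_integrable g" for g
    using that by (intro integrable_ek integrable_of_square_integrable)
  let ?\<Phi> = "\<lambda>p. complex_of_real (\<phi> p) * ek (- k) p"
  let ?x = "\<lambda>p. complex_of_real (partial_x \<phi> p) * ek (- k) p - 2 * pi * \<i> * of_int (fst k) * (complex_of_real (\<phi> p) * ek (- k) p)"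
  let ?y = "\<lambda>p. complex_of_real (partial_y \<phi> p) * ek (- k) p - 2 * pi * \<i> * of_int (snd k) * (complex_of_real (\<phi> p) * ek (- k) p)"
  have per: "\<phi> (1, y) = \<phi> (0, y)" "\<phi> (x, 1) = \<phi> (x, 0)" for x y
    using \<phi> unfolding test_functions_def by (metis (mono_tags, lifting) add_0 mem_Collect_eq)+
  have "(LINT p|torus. ?x p) = 0"
  proof (rule torus_integral_deriv_fst[where \<Phi> = ?\<Phi>])
    fix x y
    have "((\<lambda>x. complex_of_real (\<phi> (x, y))) has_vector_derivative complex_of_real (partial_x \<phi> (x, y))) (at x)"
      using partial_has_vector_derivative(1)[OF test_function_differentiable[OF \<phi>]]
      unfolding has_real_derivative_iff_has_vector_derivative[symmetric] by (rule has_vector_derivative_of_real)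
    from has_vector_derivative_mult[OF this ek_deriv(1)[of "- k" y x]]
    show "((\<lambda>x. ?\<Phi> (x, y)) has_vector_derivative ?x (x, y)) (at x)"
      by (simp add: algebra_simps)
  qed (use per ek_periodic(1)[of "- k" 0] in \<open>auto intro!: continuous_intros c\<close>)
  then show "fc (to_L2 (partial_x \<phi>)) k = 2 * pi * \<i> * of_int (fst k) * fc (to_L2 \<phi>) k"
    unfolding fc_to_L2[OF sq(1)] fc_to_L2[OF sq(2)]
    using i[OF sq(1)] i[OF sq(2)] by (subst (asm) Bochner_Integration.integral_diff) auto
  have "(LINT p|torus. ?y p) = 0"
  proof (rule torus_integral_deriv_snd[where \<Phi> = ?\<Phi>])
    fix x y
    have "((\<lambda>y. complex_of_real (\<phi> (x, y))) has_vector_derivative complex_of_real (partial_y \<phi> (x, y))) (at y)"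
      using partial_has_vector_derivative(2)[OF test_function_differentiable[OF \<phi>]]
      unfolding has_real_derivative_iff_has_vector_derivative[symmetric] by (rule has_vector_derivative_of_real)
    from has_vector_derivative_mult[OF this ek_deriv(2)[of "- k" x y]]
    show "((\<lambda>y. ?\<Phi> (x, y)) has_vector_derivative ?y (x, y)) (at y)"
      by (simp add: algebra_simps)
  qed (use per ek_periodic(2)[of "- k" _ 0] in \<open>auto intro!: continuous_intros c\<close>)
  then show "fc (to_L2 (partial_y \<phi>)) k = 2 * pi * \<i> * of_int (snd k) * fc (to_L2 \<phi>) k"
    unfolding fc_to_L2[OF sq(1)] fc_to_L2[OF sq(3)]
    using i[OF sq(1)] i[OF sq(3)] by (subst (asm) Bochner_Integration.integral_diff) auto
qed

lemma fc_partials: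
  assumes \<phi>: "\<phi> \<in> test_functions"
  shows "(partial_x ^^ m) ((partial_y ^^ n) \<phi>) \<in> test_functions \<and>
    fc (to_L2 ((partial_x ^^ m) ((partial_y ^^ n) \<phi>))) k = dsym m n k * fc (to_L2 \<phi>) k"
proof -
  have y: "(partial_y ^^ n) \<phi> \<in> test_functions \<and>
    fc (to_L2 ((partial_y ^^ n) \<phi>)) k = dsym 0 n k * fc (to_L2 \<phi>) k"
    by (induction n) (auto simp: \<phi> dsym_def test_function_partial fc_partial)
  show ?thesis
    by (induction m) (use y in \<open>auto simp: dsym_def test_function_partial fc_partial\<close>)
qed

text \<open>The bridge between the distributional definitions and the coefficients. One direction
  tests with exponentials; the other writes both integrals as inner products, expands them by
  \<open>Parseval_inner\<close>, and moves the symbol from the test function to \<open>f\<close>,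
  which produces the sign.\<close>

lemma is_weak_deriv_iff: "is_weak_deriv m n f g \<longleftrightarrow> (\<forall>k. fc g k = dsym m n k * fc f k)"
proof
  assume w: "is_weak_deriv m n f g"
  show "\<forall>k. fc g k = dsym m n k * fc f k"
  proof
    fix k
    have *: "Re ((dsym m n k * c) * cnj (fc f k)) = (-1) ^ (m + n) * Re (c * cnj (fc g k))" for c
      using w test_function_Re_ek[of c k] unfolding is_weak_deriv_def
      by (auto simp only: partials_Re_ek integral_Re_ek dest!: bspec)
    have **: "Re (((-1) ^ (m + n) * c) * z) = (-1) ^ (m + n) * Re (c * z)" for c z
      by (cases "even (m + n)") auto
    \<comment> \<open>The choices 1 and \<open>- \<i>\<close> of \<open>c\<close> give the real and
      the imaginary part.\<close>
    have "dsym m n k * cnj (fc f k) = (-1) ^ (m + n) * cnj (fc g k)"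
      using *[of 1] *[of "- \<i>"] **[of 1 "cnj (fc g k)"] **[of "- \<i>" "cnj (fc g k)"]
      by (simp add: complex_eq_iff algebra_simps)
    then have "cnj (dsym m n k * cnj (fc f k)) = cnj ((-1) ^ (m + n) * cnj (fc g k))" by simp
    then show "fc g k = dsym m n k * fc f k" by (simp add: cnj_dsym del: power_add)
  qed
next
  assume *: "\<forall>k. fc g k = dsym m n k * fc f k"
  show "is_weak_deriv m n f g"
    unfolding is_weak_deriv_def
  proof
    fix \<phi> assume \<phi>: "\<phi> \<in> test_functions"
    let ?d = "(partial_x ^^ m) ((partial_y ^^ n) \<phi>)"
    have int: "(LINT p|torus. repr h p * \<psi> p) = h \<bullet> to_L2 \<psi>" if "\<psi> \<in> test_functions" for h \<psi>
      using inner_to_L2[OF square_integrable_repr[of h] square_integrable_continuous[OF test_function_continuous[OF that]]]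
      by (simp add: to_L2_repr)
    have 1: "((\<lambda>k. Re (fc f k * cnj (fc (to_L2 ?d) k))) has_sum (f \<bullet> to_L2 ?d)) UNIV"
      by (rule Parseval_inner)
    have "((\<lambda>k. (-1) ^ (m + n) * Re (fc g k * cnj (fc (to_L2 \<phi>) k))) has_sum ((-1) ^ (m + n) * (g \<bullet> to_L2 \<phi>))) UNIV"
      by (intro has_sum_cmult_right Parseval_inner)
    moreover have "Re (fc f k * cnj (fc (to_L2 ?d) k)) = (-1) ^ (m + n) * Re (fc g k * cnj (fc (to_L2 \<phi>) k))" for k
      using fc_partials[OF \<phi>, of m n k] by (cases "even (m + n)") (auto simp: * cnj_dsym algebra_simps simp del: power_add)
    ultimately have "((\<lambda>k. Re (fc f k * cnj (fc (to_L2 ?d) k))) has_sum ((-1) ^ (m + n) * (g \<bullet> to_L2 \<phi>))) UNIV"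
      by (simp only:)
    with 1 have "f \<bullet> to_L2 ?d = (-1) ^ (m + n) * (g \<bullet> to_L2 \<phi>)"
      by (rule has_sum_unique)
    then show "(LINT p|torus. repr f p * ?d p) = (-1) ^ (m + n) * (LINT p|torus. repr g p * \<phi> p)"
      using fc_partials[OF \<phi>, of m n] \<phi> by (simp add: int)
  qed
qed

lemma weak_deriv_eqI:
  assumes "\<And>k. fc g k = dsym m n k * fc f k"
  shows "weak_deriv m n f = g"
  unfolding weak_deriv_def is_weak_deriv_iff by (rule the_equality) (auto simp: assms intro: fc_inject)

lemma sobolevD:
  assumes "f \<in> sobolev s" "m + n \<le> s"
  shows "fc (weak_deriv m n f) k = dsym m n k * fc f k"
proof -
  obtain g where "\<And>k. fc g k = dsym m n k * fc f k"
    using assms unfolding sobolev_def is_weak_deriv_iff by blast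
  then show ?thesis using weak_deriv_eqI by metis
qed

lemma sobolevI:
  assumes "\<And>m n. m + n \<le> s \<Longrightarrow> \<exists>g. \<forall>k. fc g k = dsym m n k * fc f k"
  shows "f \<in> sobolev s"
  using assms by (auto simp: sobolev_def is_weak_deriv_iff)

lemma sobolev_mono: "r \<le> s \<Longrightarrow> sobolev s \<subseteq> sobolev r"
  by (auto simp: sobolev_def)

lemma weak_deriv_diff:
  assumes "f \<in> sobolev s" "g \<in> sobolev s" "m + n \<le> s"
  shows "weak_deriv m n (f - g) = weak_deriv m n f - weak_deriv m n g"
  by (rule weak_deriv_eqI) (simp add: fc_diff sobolevD[OF assms(1,3)] sobolevD[OF assms(2,3)] algebra_simps)

lemma sobolev_diff:
  assumes "f \<in> sobolev s" "g \<in> sobolev s" shows "f - g \<in> sobolev s"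
proof (rule sobolevI)
  fix m n assume mn: "m + n \<le> s"
  show "\<exists>h. \<forall>k. fc h k = dsym m n k * fc (f - g) k"
    by (rule exI[of _ "weak_deriv m n f - weak_deriv m n g"])
       (simp add: fc_diff sobolevD[OF assms(1) mn] sobolevD[OF assms(2) mn] algebra_simps)
qed

section \<open>Square-summable and summable families over the frequencies\<close>

definition l2b :: "('a \<Rightarrow> real) \<Rightarrow> real \<Rightarrow> bool" where
  "l2b x X \<longleftrightarrow> 0 \<le> X \<and> (\<forall>F. finite F \<longrightarrow> (\<Sum>k\<in>F. (x k)\<^sup>2) \<le> X\<^sup>2)"

text \<open>Like \<open>l2b\<close>, stated through finite sums: no summability premise has to be
  carried along, and the bounds apply directly to the truncated double sums of the commutator
  estimates.\<close>

definition l1b :: "('a \<Rightarrow> real) \<Rightarrow> real \<Rightarrow> bool" where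
  "l1b z Z \<longleftrightarrow> (\<forall>F. finite F \<longrightarrow> (\<Sum>k\<in>F. \<bar>z k\<bar>) \<le> Z)"

lemma l1b_nonneg: "l1b z Z \<Longrightarrow> 0 \<le> Z"
  unfolding l1b_def by (auto dest: spec[of _ "{}"])

lemma l2b_nonneg: "l2b z Z \<Longrightarrow> 0 \<le> Z"
  unfolding l2b_def by blast

lemma l2b_mono:
  assumes "l2b x X" "\<And>k. \<bar>y k\<bar> \<le> c * \<bar>x k\<bar>" "0 \<le> c" shows "l2b y (c * X)"
  unfolding l2b_def
proof (intro conjI allI impI)
  show "0 \<le> c * X" using assms unfolding l2b_def by simp
  fix F :: "'a set" assume F: "finite F"
  have "(\<Sum>k\<in>F. (y k)\<^sup>2) \<le> (\<Sum>k\<in>F. c\<^sup>2 * (x k)\<^sup>2)"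
  proof (rule sum_mono)
    show "(y k)\<^sup>2 \<le> c\<^sup>2 * (x k)\<^sup>2" for k
      using power_mono[OF assms(2)[of k], of 2] by (simp add: power_mult_distrib)
  qed
  also have "\<dots> \<le> c\<^sup>2 * X\<^sup>2"
    using assms(1) F unfolding l2b_def by (simp add: mult_left_mono flip: sum_distrib_left)
  finally show "(\<Sum>k\<in>F. (y k)\<^sup>2) \<le> (c * X)\<^sup>2" by (simp add: power_mult_distrib)
qed

lemma l1b_mono:
  assumes "l1b x X" "\<And>k. \<bar>y k\<bar> \<le> c * \<bar>x k\<bar>" "0 \<le> c" shows "l1b y (c * X)"
  unfolding l1b_def
proof (intro allI impI)
  fix F :: "'a set" assume F: "finite F"
  have "(\<Sum>k\<in>F. \<bar>y k\<bar>) \<le> c * (\<Sum>k\<in>F. \<bar>x k\<bar>)"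
    using assms(2) by (simp add: sum_distrib_left sum_mono)
  also have "\<dots> \<le> c * X" using assms F unfolding l1b_def by (simp add: mult_left_mono)
  finally show "(\<Sum>k\<in>F. \<bar>y k\<bar>) \<le> c * X" .
qed

lemma l2b_le: "l2b x X \<Longrightarrow> X \<le> Y \<Longrightarrow> l2b x Y"
  unfolding l2b_def by (auto intro: order.trans power_mono)

lemma l2b_L2_set: "l2b x X \<Longrightarrow> finite F \<Longrightarrow> L2_set x F \<le> X"
  unfolding l2b_def L2_set_def by (simp add: real_le_lsqrt sum_nonneg)

lemma l2b_add:
  assumes "l2b x X" "l2b y Y" shows "l2b (\<lambda>k. x k + y k) (X + Y)"
  unfolding l2b_def
proof (intro conjI allI impI)
  show "0 \<le> X + Y" using assms unfolding l2b_def by simp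
  fix F :: "'a set" assume F: "finite F"
  have "L2_set (\<lambda>k. x k + y k) F \<le> X + Y"
    using L2_set_triangle_ineq[of x y F] l2b_L2_set[OF assms(1) F] l2b_L2_set[OF assms(2) F] by linarith
  then have "(L2_set (\<lambda>k. x k + y k) F)\<^sup>2 \<le> (X + Y)\<^sup>2" by (intro power_mono) auto
  then show "(\<Sum>k\<in>F. (x k + y k)\<^sup>2) \<le> (X + Y)\<^sup>2" by (simp add: L2_set_def sum_nonneg)
qed

lemma l1b_summable: "l1b z Z \<Longrightarrow> (\<lambda>k. \<bar>z k\<bar>) summable_on UNIV"
  unfolding l1b_def
  by (rule nonneg_bounded_partial_sums_imp_summable_on[where C = Z])
     (auto intro!: eventually_finite_subsets_at_top_weakI)

lemma l1b_mult:
  assumes "l2b x X" "l2b y Y" shows "l1b (\<lambda>k. x k * y k) (X * Y)"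
  unfolding l1b_def
proof (intro allI impI)
  fix F :: "'a set" assume F: "finite F"
  have "(\<Sum>k\<in>F. \<bar>x k * y k\<bar>) \<le> L2_set x F * L2_set y F"
    using L2_set_mult_ineq[of x y F] by (simp add: abs_mult)
  also have "\<dots> \<le> X * Y" using l2b_L2_set[OF assms(1) F] l2b_L2_set[OF assms(2) F] l2b_nonneg[OF assms(1)]
    by (intro mult_mono) auto
  finally show "(\<Sum>k\<in>F. \<bar>x k * y k\<bar>) \<le> X * Y" .
qed

definition lam :: "int \<times> int \<Rightarrow> real" where
  "lam k = 1 + \<bar>of_int (fst k)\<bar> + \<bar>of_int (snd k)\<bar>"

lemma lam_ge_1: "1 \<le> lam k"
  by (simp add: lam_def)

lemma lam_pos [simp]: "0 < lam k" "0 \<le> lam k"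
  using lam_ge_1[of k] by linarith+

lemma lam_nonzero [simp]: "lam k \<noteq> 0"
  using lam_ge_1[of k] by auto

lemma lam_diff: "\<bar>lam k - lam j\<bar> \<le> lam (k - j)" "lam k \<le> lam j + lam (k - j)" "lam (- k) = lam k"
proof -
  show "\<bar>lam k - lam j\<bar> \<le> lam (k - j)" unfolding lam_def by (simp, smt (verit))
  then show "lam k \<le> lam j + lam (k - j)" by linarith
qed (simp add: lam_def)

text \<open>Telescoping: \<open>1 / (n + 2)\<^sup>2\<close> is at most
  \<open>1 / (n + 1) - 1 / (n + 2)\<close>. The induction keeps the remainder
  \<open>2 / (1 + n)\<close>, doubled because both signs of the integer occur.\<close>

lemma sum_inverse_square_int:
  assumes "finite A" shows "(\<Sum>a\<in>A. 1 / (1 + \<bar>real_of_int a\<bar>)\<^sup>2) \<le> 4"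
proof -
  let ?g = "\<lambda>a. 1 / (1 + \<bar>real_of_int a\<bar>)\<^sup>2"
  have *: "(\<Sum>a\<in>{- int n..int n}. ?g a) \<le> 4 - 2 / (1 + real n)" for n
  proof (induction n)
    case (Suc n)
    have "{- int (Suc n)..int (Suc n)} = insert (- int (Suc n)) (insert (int (Suc n)) {- int n..int n})" by auto
    then have "(\<Sum>a\<in>{- int (Suc n)..int (Suc n)}. ?g a) = 2 / (2 + real n)\<^sup>2 + (\<Sum>a\<in>{- int n..int n}. ?g a)"
      by (simp add: algebra_simps)
    also have "\<dots> \<le> 2 / (2 + real n)\<^sup>2 + 4 - 2 / (1 + real n)" using Suc by simp
    also have "2 / (2 + real n)\<^sup>2 \<le> 2 / ((1 + real n) * (2 + real n))"
      unfolding power2_eq_square by (intro divide_left_mono mult_right_mono) auto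
    also have "2 / ((1 + real n) * (2 + real n)) = 2 / (1 + real n) - 2 / (2 + real n)"
      by (simp add: field_simps)
    finally show ?case by simp
  qed simp
  define n where "n = nat (Max (insert 0 (abs ` A)))"
  have "A \<subseteq> {- int n..int n}"
  proof
    fix a assume "a \<in> A"
    then have "\<bar>a\<bar> \<le> Max (insert 0 (abs ` A))" using assms by (intro Max_ge) auto
    moreover have "0 \<le> Max (insert 0 (abs ` A))" using assms by (intro Max_ge) auto
    ultimately have "\<bar>a\<bar> \<le> int n" by (simp add: n_def)
    then show "a \<in> {- int n..int n}" by auto
  qed
  then have "(\<Sum>a\<in>A. ?g a) \<le> (\<Sum>a\<in>{- int n..int n}. ?g a)" by (intro sum_mono2) auto
  also have "\<dots> \<le> 4" using *[of n] by (smt (verit) divide_nonneg_nonneg of_nat_0_le_iff)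
  finally show ?thesis .
qed

text \<open>The square of \<open>lam k\<close> dominates the product of
  \<open>1 + \<bar>k\<^sub>1\<bar>\<close> and \<open>1 + \<bar>k\<^sub>2\<bar>\<close>, so the
  lattice sum is at most a product of two one-dimensional sums, each at most 4. The dimension of the
  torus enters here.\<close>

lemma l2b_inverse_lam: "l2b (\<lambda>k. 1 / (lam k)\<^sup>2) 4"
  unfolding l2b_def
proof (intro conjI allI impI)
  fix F :: "(int \<times> int) set" assume F: "finite F"
  let ?g = "\<lambda>a. 1 / (1 + \<bar>real_of_int a\<bar>)\<^sup>2"
  have "(1 / (lam k)\<^sup>2)\<^sup>2 \<le> ?g (fst k) * ?g (snd k)" for k
  proof -
    have "(1 + \<bar>real_of_int (fst k)\<bar>) * (1 + \<bar>real_of_int (snd k)\<bar>) \<le> lam k * lam k"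
      unfolding lam_def by (intro mult_mono) auto
    from power_mono[OF this, of 2]
    have "(1 + \<bar>real_of_int (fst k)\<bar>)\<^sup>2 * (1 + \<bar>real_of_int (snd k)\<bar>)\<^sup>2 \<le> ((lam k)\<^sup>2)\<^sup>2"
      by (simp add: power_mult_distrib power2_eq_square[of "lam k"])
    then have "1 / ((lam k)\<^sup>2)\<^sup>2 \<le> 1 / ((1 + \<bar>real_of_int (fst k)\<bar>)\<^sup>2 * (1 + \<bar>real_of_int (snd k)\<bar>)\<^sup>2)"
      by (intro divide_left_mono) (auto intro!: mult_pos_pos zero_less_power simp: add_pos_nonneg)
    then show ?thesis by (simp add: power_divide)
  qed
  then have "(\<Sum>k\<in>F. (1 / (lam k)\<^sup>2)\<^sup>2) \<le> (\<Sum>k\<in>F. ?g (fst k) * ?g (snd k))"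
    by (intro sum_mono)
  also have "\<dots> \<le> (\<Sum>k\<in>fst ` F \<times> snd ` F. ?g (fst k) * ?g (snd k))"
    using F by (intro sum_mono2 finite_cartesian_product) (auto simp: image_iff rev_bexI)
  also have "\<dots> = (\<Sum>a\<in>fst ` F. ?g a) * (\<Sum>b\<in>snd ` F. ?g b)"
    by (simp add: sum_product sum.cartesian_product split_beta)
  also have "\<dots> \<le> 4 * 4"
    using F by (intro mult_mono sum_inverse_square_int sum_nonneg) auto
  finally show "(\<Sum>k\<in>F. (1 / (lam k)\<^sup>2)\<^sup>2) \<le> 4\<^sup>2" by simp
qed simp

text \<open>Cauchy-Schwarz against \<open>1 / (lam k)\<^sup>2\<close>. This is the Sobolev embedding
  used throughout: two weights buy absolute summability at the price of a factor 4.\<close>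

lemma l1b_of_l2b:
  assumes "l2b (\<lambda>k. (lam k)\<^sup>2 * x k) X" shows "l1b x (4 * X)"
proof -
  have "l1b (\<lambda>k. (lam k)\<^sup>2 * x k * (1 / (lam k)\<^sup>2)) (X * 4)"
    by (rule l1b_mult[OF assms l2b_inverse_lam])
  then show ?thesis by (simp add: mult.commute)
qed

section \<open>Absolutely convergent Fourier series\<close>

definition series :: "(int \<times> int \<Rightarrow> complex) \<Rightarrow> real \<times> real \<Rightarrow> complex" where
  "series c p = (\<Sum>\<^sub>\<infinity>k. c k * ek k p)"

abbreviation l1 :: "(int \<times> int \<Rightarrow> complex) \<Rightarrow> bool" where
  "l1 c \<equiv> (\<lambda>k. cmod (c k)) summable_on UNIV"

lemma series_uniform_limit:
  assumes "l1 c"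
  shows "uniform_limit UNIV (\<lambda>X p. \<Sum>k\<in>X. c k * ek k p) (series c) (finite_subsets_at_top UNIV)"
  unfolding series_def
  by (rule Weierstrass_m_test_general[where M = "\<lambda>k. cmod (c k)"]) (auto simp: norm_mult assms)

lemma continuous_on_series:
  assumes "l1 c" shows "continuous_on UNIV (series c)"
  by (rule uniform_limit_theorem[OF _ series_uniform_limit[OF assms]])
     (auto intro!: always_eventually continuous_intros)

lemma norm_series_le:
  assumes "l1 c" shows "cmod (series c p) \<le> (\<Sum>\<^sub>\<infinity>k. cmod (c k))"
  unfolding series_def using norm_infsum_bound[of "\<lambda>k. c k * ek k p" UNIV] assms
  by (simp add: norm_mult)

lemma cnj_series:
  assumes "\<And>k. c (- k) = cnj (c k)"
  shows "cnj (series c p) = series c p"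
proof -
  have "cnj (series c p) = (\<Sum>\<^sub>\<infinity>k. c (- k) * ek (- k) p)"
    unfolding series_def by (simp add: infsum_cnj[symmetric] assms cnj_ek del: infsum_cnj)
  also have "\<dots> = (\<Sum>\<^sub>\<infinity>k. c k * ek k p)"
    by (rule infsum_reindex_bij_betw[of uminus UNIV UNIV "\<lambda>k. c k * ek k p"])
       (auto intro!: bij_betwI[of _ _ _ uminus])
  finally show ?thesis by (simp add: series_def)
qed

text \<open>The partial sums converge uniformly, so the integral against an integrable
  \<open>h\<close> may be taken term by term. With \<open>h = 1\<close> this yields the coefficients
  of a series, with \<open>h\<close> a representative it yields the convolution formula.\<close>

lemma has_sum_integral_series:
  assumes h: "integrable torus h" and c: "l1 c"
  shows "((\<lambda>l. c l * (LINT p|torus. complex_of_real (h p) * ek (l - k) p)) has_sum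
     (LINT p|torus. complex_of_real (h p) * (series c p * ek (- k) p))) UNIV"
proof -
  obtain B where B: "\<And>p. cmod (series c p) \<le> B" using norm_series_le[OF c] by blast
  define S where "S X p = (\<Sum>l\<in>X. c l * ek l p)" for X p
  have Sc: "continuous_on UNIV (S X)" for X unfolding S_def by (intro continuous_intros)
  have SB: "cmod (S X p) \<le> (\<Sum>l\<in>X. cmod (c l))" for X p
    unfolding S_def by (rule order.trans[OF norm_sum]) (simp add: norm_mult)
  have iS: "integrable torus (\<lambda>p. complex_of_real (h p) * (S X p * ek (- k) p))" for X
    by (rule integrable_mult_bounded[OF h, of _ "\<Sum>l\<in>X. cmod (c l)"])
       (auto intro!: continuous_measurable_torus continuous_intros Sc SB simp: norm_mult)
  have iser: "integrable torus (\<lambda>p. complex_of_real (h p) * (series c p * ek (- k) p))"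
    by (rule integrable_mult_bounded[OF h, of _ B])
       (auto intro!: continuous_measurable_torus continuous_intros continuous_on_series c B simp: norm_mult)
  have eq: "(LINT p|torus. complex_of_real (h p) * (S X p * ek (- k) p)) =
      (\<Sum>l\<in>X. c l * (LINT p|torus. complex_of_real (h p) * ek (l - k) p))" for X
  proof -
    have "(LINT p|torus. complex_of_real (h p) * (S X p * ek (- k) p)) =
        (LINT p|torus. (\<Sum>l\<in>X. c l * (complex_of_real (h p) * ek (l - k) p)))"
      unfolding S_def diff_conv_add_uminus ek_add by (simp add: sum_distrib_left sum_distrib_right algebra_simps)
    also have "\<dots> = (\<Sum>l\<in>X. LINT p|torus. c l * (complex_of_real (h p) * ek (l - k) p))"
      by (intro Bochner_Integration.integral_sum integrable_mult_right integrable_ek h)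
    finally show ?thesis by simp
  qed
  have "((\<lambda>X. LINT p|torus. complex_of_real (h p) * (S X p * ek (- k) p)) \<longlongrightarrow>
      (LINT p|torus. complex_of_real (h p) * (series c p * ek (- k) p))) (finite_subsets_at_top UNIV)"
  proof (rule tendstoI)
    fix e :: real assume e: "e > 0"
    define I where "I = (LINT p|torus. \<bar>h p\<bar>)"
    have I: "0 \<le> I" unfolding I_def by (rule Bochner_Integration.integral_nonneg) simp
    \<comment> \<open>The summand 1 in the denominator covers the case \<open>I = 0\<close>.\<close>
    define d where "d = e / (I + 1)"
    have d: "d > 0" using e I by (simp add: d_def)
    have "\<forall>\<^sub>F X in finite_subsets_at_top UNIV. \<forall>p\<in>UNIV. dist (S X p) (series c p) < d"
      using uniform_limitD[OF series_uniform_limit[OF c] d] by (simp add: S_def)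
    then show "\<forall>\<^sub>F X in finite_subsets_at_top UNIV.
        dist (LINT p|torus. complex_of_real (h p) * (S X p * ek (- k) p))
          (LINT p|torus. complex_of_real (h p) * (series c p * ek (- k) p)) < e"
    proof eventually_elim
      case (elim X)
      have "dist (LINT p|torus. complex_of_real (h p) * (S X p * ek (- k) p))
          (LINT p|torus. complex_of_real (h p) * (series c p * ek (- k) p)) =
          cmod (LINT p|torus. complex_of_real (h p) * ((S X p - series c p) * ek (- k) p))"
        unfolding dist_norm Bochner_Integration.integral_diff[OF iS iser, symmetric]
        by (simp add: algebra_simps)
      also have "\<dots> \<le> (LINT p|torus. d * \<bar>h p\<bar>)"
      proof (rule Bochner_Integration.integral_norm_bound_integral)
        show "integrable torus (\<lambda>p. complex_of_real (h p) * ((S X p - series c p) * ek (- k) p))"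
          using Bochner_Integration.integrable_diff[OF iS iser] by (simp add: algebra_simps)
        show "integrable torus (\<lambda>p. d * \<bar>h p\<bar>)" using h by auto
        fix p
        have "cmod (S X p - series c p) \<le> d" using elim by (metis UNIV_I dist_norm less_imp_le)
        then have "\<bar>h p\<bar> * cmod (S X p - series c p) \<le> \<bar>h p\<bar> * d" by (intro mult_left_mono) auto
        then show "norm (complex_of_real (h p) * ((S X p - series c p) * ek (- k) p)) \<le> d * \<bar>h p\<bar>"
          by (simp add: norm_mult mult.commute)
      qed
      also have "\<dots> = d * I" by (simp add: I_def)
      also have "\<dots> < e" using e I by (simp add: d_def field_simps)
      finally show ?case .
    qed
  qed
  then show ?thesis unfolding has_sum_def eq .
qed

text \<open>Orthogonality leaves a single term of the integrated series. The symmetry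
  \<open>r\<close> makes the sum real, so that taking \<open>Re\<close> loses nothing and a real
  class results.\<close>

lemma fc_series:
  assumes c: "l1 c" and r: "\<And>k. c (- k) = cnj (c k)"
  shows "square_integrable (\<lambda>p. Re (series c p))" "fc (to_L2 (\<lambda>p. Re (series c p))) k = c k"
    "complex_of_real (Re (series c p)) = series c p"
proof -
  have re: "complex_of_real (Re (series c p)) = series c p" for p
    using cnj_series[of c, OF r] by (simp add: complex_eq_iff)
  show "complex_of_real (Re (series c p)) = series c p" by (rule re)
  show s: "square_integrable (\<lambda>p. Re (series c p))"
    by (intro square_integrable_continuous continuous_intros continuous_on_series c)
  have "((\<lambda>l. c l * (LINT p|torus. complex_of_real 1 * ek (l - k) p)) has_sum
     (LINT p|torus. complex_of_real 1 * (series c p * ek (- k) p))) UNIV"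
    by (rule has_sum_integral_series[OF _ c]) simp
  moreover have "(LINT p|torus. complex_of_real 1 * (series c p * ek (- k) p)) = fc (to_L2 (\<lambda>p. Re (series c p))) k"
    by (simp add: fc_to_L2[OF s] re)
  moreover have "c l * (LINT p|torus. complex_of_real 1 * ek (l - k) p) = (if l = k then c k else 0)" for l
    by (simp add: integral_ek)
  ultimately have "((\<lambda>l. if l = k then c k else 0) has_sum fc (to_L2 (\<lambda>p. Re (series c p))) k) UNIV"
    by (simp only:)
  moreover have "((\<lambda>l. if l = k then c k else 0) has_sum c k) UNIV"
    using has_sum_finite_neutralI[of "{k}" UNIV "\<lambda>l. if l = k then c k else 0" "c k"] by simp
  ultimately show "fc (to_L2 (\<lambda>p. Re (series c p))) k = c k" by (rule has_sum_unique)
qed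

text \<open>Takes the place of the Riesz-Fischer theorem: absolute summability yields a continuous
  representative directly, without completeness of L2.\<close>

lemma l1_synthesis:
  assumes "l1 c" "\<And>k. c (- k) = cnj (c k)"
  obtains g where "\<And>k. fc g k = c k"
  using fc_series(2)[OF assms] by blast

lemma repr_series:
  assumes "l1 (fc g)" shows "AE p in torus. complex_of_real (repr g p) = series (fc g) p"
proof -
  note s = fc_series[OF assms fc_cnj]
  have "to_L2 (\<lambda>p. Re (series (fc g) p)) = g" by (rule fc_inject) (rule s(2))
  with repr_to_L2[OF s(1)] have "AE p in torus. repr g p = Re (series (fc g) p)" by simp
  then show ?thesis by eventually_elim (simp add: s(3))
qed

lemma repr_bound:
  assumes "l1 (fc g)" shows "AE p in torus. \<bar>repr g p\<bar> \<le> (\<Sum>\<^sub>\<infinity>k. cmod (fc g k))"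
  using repr_series[OF assms]
proof eventually_elim
  case (elim p)
  then show ?case using norm_series_le[OF assms, of p] by (metis norm_of_real)
qed

text \<open>An absolutely convergent series bounds \<open>g\<close>, so the product is square
  integrable and \<open>mult_L2\<close> has its intended meaning; integrating the series of
  \<open>g\<close> term by term against \<open>f\<close> gives the convolution.\<close>

lemma mult_l1:
  assumes "l1 (fc g)"
  shows "square_integrable (\<lambda>p. repr f p * repr g p)"
    "((\<lambda>l. fc g l * fc f (k - l)) has_sum fc (mult_L2 f g) k) UNIV"
proof -
  let ?B = "\<Sum>\<^sub>\<infinity>k. cmod (fc g k)"
  show s: "square_integrable (\<lambda>p. repr f p * repr g p)"
    unfolding square_integrable_def
  proof
    show "integrable torus (\<lambda>p. (repr f p * repr g p)\<^sup>2)"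
    proof (rule Bochner_Integration.integrable_bound)
      show "integrable torus (\<lambda>p. ?B\<^sup>2 * (repr f p)\<^sup>2)"
        using square_integrable_repr by (simp add: square_integrable_def)
      show "AE p in torus. norm ((repr f p * repr g p)\<^sup>2) \<le> norm (?B\<^sup>2 * (repr f p)\<^sup>2)"
        using repr_bound[OF assms]
      proof eventually_elim
        case (elim p)
        from power_mono[OF this, of 2] have "(repr g p)\<^sup>2 \<le> ?B\<^sup>2" by simp
        then show ?case by (simp add: power_mult_distrib mult.commute mult_left_mono)
      qed
    qed simp
  qed simp
  have "fc (mult_L2 f g) k = (LINT p|torus. complex_of_real (repr f p * repr g p) * ek (- k) p)"
    unfolding mult_L2_def by (rule fc_to_L2[OF s])
  also have "\<dots> = (LINT p|torus. complex_of_real (repr f p) * (series (fc g) p * ek (- k) p))"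
  proof (rule integral_cong_AE)
    show "AE p in torus. complex_of_real (repr f p * repr g p) * ek (- k) p =
        complex_of_real (repr f p) * (series (fc g) p * ek (- k) p)"
      using repr_series[OF assms] by eventually_elim simp
    show "(\<lambda>p. complex_of_real (repr f p) * (series (fc g) p * ek (- k) p)) \<in> borel_measurable torus"
      using continuous_measurable_torus[OF continuous_on_series[OF assms]] by measurable
  qed simp
  finally show "((\<lambda>l. fc g l * fc f (k - l)) has_sum fc (mult_L2 f g) k) UNIV"
    using has_sum_integral_series[OF integrable_repr[of f] assms, of k]
    by (simp add: fc_def[of f])
qed

text \<open>Leibniz' rule on coefficients: symbols of first-order derivatives are additive
  (\<open>D\<close>), so the symbol at \<open>k\<close> distributes over the factors at
  \<open>l\<close> and \<open>k - l\<close>. The witness \<open>?g\<close> shows that the derivative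
  of the product exists as a class, which the definite description in \<open>weak_deriv\<close>
  requires.\<close>

lemma weak_deriv_mult_l1:
  assumes D: "\<And>k l. dsym m n k = dsym m n l + dsym m n (k - l)" and f: "f \<in> sobolev 1" and mn: "m + n \<le> 1"
    and u: "l1 (fc u)" "l1 (\<lambda>k. dsym m n k * fc u k)"
  shows "fc (weak_deriv m n (mult_L2 f u)) k = dsym m n k * fc (mult_L2 f u) k"
proof -
  obtain u' where u': "\<And>k. fc u' k = dsym m n k * fc u k"
    using l1_synthesis[OF u(2)] by (auto simp: dsym_uminus fc_cnj)
  have l1u': "l1 (fc u')" using u(2) by (simp add: u')
  let ?g = "mult_L2 f u' + mult_L2 (weak_deriv m n f) u"
  have "fc ?g k = dsym m n k * fc (mult_L2 f u) k" for k
  proof -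
    have "((\<lambda>l. fc u' l * fc f (k - l) + fc u l * fc (weak_deriv m n f) (k - l)) has_sum fc ?g k) UNIV"
      unfolding fc_add by (intro has_sum_add mult_l1 u l1u')
    moreover have "fc u' l * fc f (k - l) + fc u l * fc (weak_deriv m n f) (k - l) =
        dsym m n k * (fc u l * fc f (k - l))" for l
      by (simp add: u' sobolevD[OF f mn] D[of k l] algebra_simps)
    ultimately have "((\<lambda>l. dsym m n k * (fc u l * fc f (k - l))) has_sum fc ?g k) UNIV" by (simp only:)
    moreover have "((\<lambda>l. dsym m n k * (fc u l * fc f (k - l))) has_sum dsym m n k * fc (mult_L2 f u) k) UNIV"
      by (intro has_sum_cmult_right mult_l1 u)
    ultimately show ?thesis by (rule has_sum_unique)
  qed
  then show ?thesis using weak_deriv_eqI by metis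
qed

lemma norm_dsym_le: "cmod (dsym m n k) \<le> (2 * pi) ^ (m + n) * lam k ^ (m + n)"
proof -
  have "cmod (dsym m n k) = (2 * pi) ^ (m + n) * (\<bar>of_int (fst k)\<bar> ^ m * \<bar>of_int (snd k)\<bar> ^ n)"
    by (simp add: dsym_def norm_mult norm_power power_add power_mult_distrib)
  also have "\<bar>of_int (fst k)\<bar> ^ m * \<bar>of_int (snd k)\<bar> ^ n \<le> lam k ^ m * lam k ^ n"
    by (intro mult_mono power_mono) (auto simp: lam_def)
  finally show ?thesis by (simp add: power_add mult_left_mono)
qed

lemma fc_divergence:
  assumes g: "g \<in> sobolev 1" and u: "l1b (\<lambda>k. lam k * cmod (fc u1 k)) U1" "l1b (\<lambda>k. lam k * cmod (fc u2 k)) U2"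
  shows "((\<lambda>j. 2 * pi * \<i> * (of_int (fst k) * fc u1 (k - j) + of_int (snd k) * fc u2 (k - j)) * fc g j) has_sum
    fc (divergence (mult_vec g (u1, u2))) k) UNIV"
proof -
  have l: "l1 (fc u)" "l1 (\<lambda>k. dsym m n k * fc u k)"
    if "m + n = 1" "l1b (\<lambda>k. lam k * cmod (fc u k)) U" for u U m n
  proof -
    have "l1b (\<lambda>k. cmod (fc u k)) (1 * U)"
      by (rule l1b_mono[OF that(2)]) (auto simp: mult_le_cancel_right1 lam_ge_1)
    from l1b_summable[OF this] show "l1 (fc u)" by simp
    have "l1b (\<lambda>k. cmod (dsym m n k * fc u k)) (2 * pi * U)"
    proof (rule l1b_mono[OF that(2)])
      show "\<bar>cmod (dsym m n k * fc u k)\<bar> \<le> 2 * pi * \<bar>lam k * cmod (fc u k)\<bar>" for k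
        using mult_right_mono[OF norm_dsym_le[of m n k], of "cmod (fc u k)"] that(1)
        by (simp add: norm_mult mult.assoc)
    qed simp
    from l1b_summable[OF this] show "l1 (\<lambda>k. dsym m n k * fc u k)" by simp
  qed
  have D: "dsym 1 0 k = dsym 1 0 l + dsym 1 0 (k - l)" "dsym 0 1 k = dsym 0 1 l + dsym 0 1 (k - l)" for k l
    by (simp_all add: dsym_def algebra_simps)
  have "fc (divergence (mult_vec g (u1, u2))) k =
      dsym 1 0 k * fc (mult_L2 g u1) k + dsym 0 1 k * fc (mult_L2 g u2) k"
  proof -
    have "fc (weak_deriv 1 0 (mult_L2 g u1)) k = dsym 1 0 k * fc (mult_L2 g u1) k"
      by (rule weak_deriv_mult_l1[OF D(1) g _ l(1)[OF _ u(1), of 1 0] l(2)[OF _ u(1)]]) auto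
    moreover have "fc (weak_deriv 0 1 (mult_L2 g u2)) k = dsym 0 1 k * fc (mult_L2 g u2) k"
      by (rule weak_deriv_mult_l1[OF D(2) g _ l(1)[OF _ u(2), of 0 1] l(2)[OF _ u(2)]]) auto
    ultimately show ?thesis by (simp add: divergence_def mult_vec_def fc_add)
  qed
  then have "((\<lambda>l. dsym 1 0 k * (fc u1 l * fc g (k - l)) + dsym 0 1 k * (fc u2 l * fc g (k - l))) has_sum
      fc (divergence (mult_vec g (u1, u2))) k) UNIV"
    using l(1)[OF _ u(1), of 1 0] l(1)[OF _ u(2), of 1 0]
    by (auto intro!: has_sum_add has_sum_cmult_right mult_l1)
  \<comment> \<open>Reindexing by \<open>l = k - j\<close>: the sum then runs over the frequency of
    the transported function \<open>g\<close>.\<close>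
  then have "((\<lambda>j. dsym 1 0 k * (fc u1 (k - j) * fc g (k - (k - j))) + dsym 0 1 k * (fc u2 (k - j) * fc g (k - (k - j)))) has_sum
      fc (divergence (mult_vec g (u1, u2))) k) UNIV"
    by (subst has_sum_reindex_bij_betw[of "\<lambda>j. k - j" UNIV UNIV]) (auto intro!: bij_betwI[of _ _ _ "\<lambda>j. k - j"])
  then show ?thesis by (simp add: dsym_def algebra_simps)
qed

section \<open>Sobolev norms as weighted l2 norms of coefficients\<close>

lemma finite_order_set: "finite {(m, n). m + n \<le> (s::nat)}"
  by (rule finite_subset[of _ "{..s} \<times> {..s}"]) auto

lemma sobolev_norm_L2_set: "sobolev_norm s f = L2_set (\<lambda>(m, n). norm (weak_deriv m n f)) {(m, n). m + n \<le> s}"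
  unfolding sobolev_norm_def L2_set_def by (simp add: split_beta)

lemma sobolev_norm_nonneg: "0 \<le> sobolev_norm s f"
  unfolding sobolev_norm_L2_set by (rule L2_set_nonneg)

lemma weak_deriv_le_sobolev_norm:
  assumes "m + n \<le> s" shows "norm (weak_deriv m n f) \<le> sobolev_norm s f"
  unfolding sobolev_norm_L2_set
  using member_le_L2_set[OF finite_order_set[of s], of "(m, n)" "\<lambda>(m, n). norm (weak_deriv m n f)"] assms by simp

lemma weak_deriv_0: "weak_deriv 0 0 f = f"
  by (rule weak_deriv_eqI) (simp add: dsym_def)

lemma norm_le_sobolev_norm: "norm f \<le> sobolev_norm s f"
  using weak_deriv_le_sobolev_norm[of 0 0 s f] by (simp add: weak_deriv_0)

lemma sobolev_norm_minus_commute: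
  assumes "f \<in> sobolev s" "g \<in> sobolev s"
  shows "sobolev_norm s (g - f) = sobolev_norm s (f - g)"
  unfolding sobolev_norm_L2_set
  by (intro L2_set_cong refl) (auto simp: weak_deriv_diff[OF assms] weak_deriv_diff[OF assms(2,1)] norm_minus_commute)

lemma sobolev_norm_triangle:
  assumes "f \<in> sobolev s" "g \<in> sobolev s"
  shows "\<bar>sobolev_norm s f - sobolev_norm s g\<bar> \<le> sobolev_norm s (f - g)"
proof -
  have *: "sobolev_norm s f \<le> sobolev_norm s g + sobolev_norm s (f - g)"
    if "f \<in> sobolev s" "g \<in> sobolev s" for f g
  proof -
    have "sobolev_norm s f \<le> L2_set (\<lambda>q. (case q of (m, n) \<Rightarrow> norm (weak_deriv m n g)) +
        (case q of (m, n) \<Rightarrow> norm (weak_deriv m n (f - g)))) {(m, n). m + n \<le> s}"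
      unfolding sobolev_norm_L2_set
    proof (rule L2_set_mono)
      fix q :: "nat \<times> nat" assume "q \<in> {(m, n). m + n \<le> s}"
      then obtain m n where q: "q = (m, n)" "m + n \<le> s" by auto
      show "(case q of (m, n) \<Rightarrow> norm (weak_deriv m n f)) \<le> (case q of (m, n) \<Rightarrow> norm (weak_deriv m n g)) +
          (case q of (m, n) \<Rightarrow> norm (weak_deriv m n (f - g)))"
        using norm_triangle_ineq[of "weak_deriv m n g" "weak_deriv m n f - weak_deriv m n g"]
        by (simp add: q weak_deriv_diff[OF that q(2)])
    qed (auto intro: norm_ge_zero)
    also have "\<dots> \<le> sobolev_norm s g + sobolev_norm s (f - g)"
      unfolding sobolev_norm_L2_set by (rule L2_set_triangle_ineq)
    finally show ?thesis .
  qed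
  show ?thesis
    using *[OF assms] *[OF assms(2,1)] sobolev_norm_minus_commute[OF assms] by linarith
qed

lemma l2b_fc: "l2b (\<lambda>k. cmod (fc f k)) (norm f)"
  unfolding l2b_def using Bessel by auto

lemma lam_power_le: "lam k ^ s \<le> 3 ^ s * (1 + \<bar>of_int (fst k)\<bar> ^ s + \<bar>of_int (snd k)\<bar> ^ s)"
proof -
  define a b where "a = \<bar>real_of_int (fst k)\<bar>" and "b = \<bar>real_of_int (snd k)\<bar>"
  have ab: "0 \<le> a" "0 \<le> b" by (simp_all add: a_def b_def)
  define m where "m = max 1 (max a b)"
  have "lam k \<le> 3 * m" by (simp add: lam_def m_def a_def b_def)
  then have "lam k ^ s \<le> (3 * m) ^ s" by (intro power_mono) auto
  also have "\<dots> = 3 ^ s * m ^ s" by (rule power_mult_distrib)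
  also have "m ^ s \<le> 1 + a ^ s + b ^ s"
    using ab zero_le_power[OF ab(1), of s] zero_le_power[OF ab(2), of s] unfolding m_def max_def by auto
  finally show ?thesis by (simp add: a_def b_def mult_left_mono)
qed

text \<open>The weight \<open>lam k ^ s\<close> is at most \<open>3 ^ s\<close> times the sum of the
  symbols of the identity and of the two pure derivatives of order \<open>s\<close>; each of these
  three has norm at most \<open>sobolev_norm s f\<close>. The numbers 27 and 81 further on are
  \<open>3 * 3 ^ s\<close> for \<open>s = 2\<close> and \<open>s = 3\<close>.\<close>

lemma l2b_sobolev:
  assumes "f \<in> sobolev s"
  shows "l2b (\<lambda>k. lam k ^ s * cmod (fc f k)) (3 * 3 ^ s * sobolev_norm s f)"
proof -
  let ?N = "sobolev_norm s f"
  have d: "l2b (\<lambda>k. cmod (fc (weak_deriv m n f) k)) ?N" if "m + n \<le> s" for m n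
    by (rule l2b_le[OF l2b_fc weak_deriv_le_sobolev_norm[OF that]])
  have "l2b (\<lambda>k. cmod (fc (weak_deriv 0 0 f) k) + cmod (fc (weak_deriv s 0 f) k) + cmod (fc (weak_deriv 0 s f) k)) (?N + ?N + ?N)"
    by (intro l2b_add d) auto
  then have "l2b (\<lambda>k. lam k ^ s * cmod (fc f k)) (3 ^ s * (?N + ?N + ?N))"
  proof (rule l2b_mono)
    fix k
    have *: "\<bar>of_int j\<bar> ^ s \<le> (2 * pi * \<bar>of_int j\<bar>) ^ s" for j
    proof (intro power_mono)
      have "1 \<le> 2 * pi" using pi_gt3 by linarith
      then show "\<bar>real_of_int j\<bar> \<le> 2 * pi * \<bar>of_int j\<bar>" by (metis abs_ge_zero mult_right_mono mult_1)
    qed simp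
    have "cmod (fc (weak_deriv 0 0 f) k) + cmod (fc (weak_deriv s 0 f) k) + cmod (fc (weak_deriv 0 s f) k)
        = (1 + (2 * pi * \<bar>of_int (fst k)\<bar>) ^ s + (2 * pi * \<bar>of_int (snd k)\<bar>) ^ s) * cmod (fc f k)"
      using sobolevD[OF assms, of s 0 k] sobolevD[OF assms, of 0 s k]
      by (simp add: weak_deriv_0 dsym_def norm_mult norm_power algebra_simps)
    moreover have "lam k ^ s \<le> 3 ^ s * (1 + (2 * pi * \<bar>of_int (fst k)\<bar>) ^ s + (2 * pi * \<bar>of_int (snd k)\<bar>) ^ s)"
      by (rule order.trans[OF lam_power_le]) (intro mult_left_mono add_mono *; simp)
    ultimately show "\<bar>lam k ^ s * cmod (fc f k)\<bar> \<le>
        3 ^ s * \<bar>cmod (fc (weak_deriv 0 0 f) k) + cmod (fc (weak_deriv s 0 f) k) + cmod (fc (weak_deriv 0 s f) k)\<bar>"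
      by (simp add: abs_mult mult_right_mono flip: mult.assoc)
  qed simp
  then show ?thesis by (simp add: algebra_simps)
qed

lemma norm_le_l2b:
  assumes "l2b (\<lambda>k. cmod (fc f k)) X" shows "norm f \<le> X"
proof -
  have "(norm f)\<^sup>2 \<le> X\<^sup>2"
    using has_sum_le_finite_sums[OF Parseval[of f]] assms unfolding l2b_def by blast
  then show ?thesis using l2b_nonneg[OF assms] power2_le_imp_le by blast
qed

definition Csob :: "nat \<Rightarrow> real" where
  "Csob s = sqrt (card {(m, n). m + n \<le> s}) * (2 * pi) ^ s"

text \<open>Converse of \<open>l2b_sobolev\<close>: each derivative of order at most
  \<open>s\<close> costs at most \<open>(2 * pi) ^ s\<close> weights, and \<open>Csob\<close> also
  counts the derivatives. The estimates can thus be done with \<open>lam\<close> and translated back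
  at the end.\<close>

lemma sobolev_norm_le:
  assumes f: "f \<in> sobolev s" and X: "l2b (\<lambda>k. lam k ^ s * cmod (fc f k)) X"
  shows "sobolev_norm s f \<le> Csob s * X"
proof -
  let ?A = "{(m, n). m + n \<le> s}"
  have w: "norm (weak_deriv m n f) \<le> (2 * pi) ^ s * X" if mn: "m + n \<le> s" for m n
  proof (rule norm_le_l2b, rule l2b_mono[OF X])
    fix k
    have pi: "1 \<le> 2 * pi" using pi_gt3 by linarith
    have "cmod (dsym m n k) \<le> (2 * pi) ^ (m + n) * lam k ^ (m + n)" by (rule norm_dsym_le)
    also have "\<dots> \<le> (2 * pi) ^ s * lam k ^ s"
      by (intro mult_mono power_increasing mn lam_ge_1 pi) auto
    finally have "cmod (dsym m n k) \<le> (2 * pi) ^ s * lam k ^ s" .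
    then show "\<bar>cmod (fc (weak_deriv m n f) k)\<bar> \<le> (2 * pi) ^ s * \<bar>lam k ^ s * cmod (fc f k)\<bar>"
      by (simp add: sobolevD[OF f mn] norm_mult abs_mult mult_right_mono flip: mult.assoc)
  qed simp
  have "sobolev_norm s f \<le> L2_set (\<lambda>_. (2 * pi) ^ s * X) ?A"
    unfolding sobolev_norm_L2_set by (rule L2_set_mono) (use w in auto)
  also have "\<dots> = sqrt (card ?A) * ((2 * pi) ^ s * X)"
    using l2b_nonneg[OF X] by (simp add: L2_set_def real_sqrt_mult)
  finally show ?thesis by (simp add: Csob_def)
qed

text \<open>The constant is 4 from \<open>l1b_of_l2b\<close> times 27 from
  \<open>l2b_sobolev\<close>.\<close>

lemma l1_sobolev: assumes "f \<in> sobolev 2" shows "l1b (\<lambda>k. cmod (fc f k)) (108 * sobolev_norm 2 f)"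
  using l1b_of_l2b[OF l2b_sobolev[OF assms]] by simp

section \<open>The velocity field\<close>

text \<open>The symbol of minus the Laplacian on the torus of side 1.\<close>

definition K2 :: "int \<times> int \<Rightarrow> real" where
  "K2 k = (2 * pi * of_int (fst k))\<^sup>2 + (2 * pi * of_int (snd k))\<^sup>2"

lemma K2_nonneg: "0 \<le> K2 k" by (simp add: K2_def)

lemma K2_uminus: "K2 (- k) = K2 k" by (simp add: K2_def)

lemma lam_le_K2: "(lam k)\<^sup>2 \<le> 3 * (1 + K2 k)"
proof -
  define a b where "a = \<bar>real_of_int (fst k)\<bar>" and "b = \<bar>real_of_int (snd k)\<bar>"
  have "0 \<le> (1 - a)\<^sup>2 + (1 - b)\<^sup>2 + (a - b)\<^sup>2" by simp
  then have "(lam k)\<^sup>2 \<le> 3 * (1 + a\<^sup>2 + b\<^sup>2)"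
    unfolding lam_def a_def[symmetric] b_def[symmetric] by (simp add: power2_eq_square algebra_simps)
  moreover have "a\<^sup>2 \<le> (2 * pi * of_int (fst k))\<^sup>2" "b\<^sup>2 \<le> (2 * pi * of_int (snd k))\<^sup>2"
  proof -
    have "1 \<le> (2 * pi)\<^sup>2" using power_mono[of 1 "2 * pi" 2] pi_gt3 by simp
    then have "1 * x\<^sup>2 \<le> (2 * pi)\<^sup>2 * x\<^sup>2" for x :: real by (intro mult_right_mono) auto
    then show "a\<^sup>2 \<le> (2 * pi * of_int (fst k))\<^sup>2" "b\<^sup>2 \<le> (2 * pi * of_int (snd k))\<^sup>2"
      by (simp_all add: a_def b_def power_mult_distrib)
  qed
  ultimately show ?thesis by (simp add: K2_def)
qed

lemma norm_dsym_le_K2: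
  assumes "m + n \<le> 2" shows "cmod (dsym m n k) \<le> 1 + K2 k"
proof -
  define a b where "a = 2 * pi * \<bar>real_of_int (fst k)\<bar>" and "b = 2 * pi * \<bar>real_of_int (snd k)\<bar>"
  have ab: "0 \<le> a" "0 \<le> b" by (simp_all add: a_def b_def)
  have K: "K2 k = a\<^sup>2 + b\<^sup>2" by (simp add: K2_def a_def b_def power_mult_distrib)
  have D: "cmod (dsym m n k) = a ^ m * b ^ n"
    by (simp add: dsym_def norm_mult norm_power a_def b_def)
  have "0 \<le> (1 - a)\<^sup>2" "0 \<le> (1 - b)\<^sup>2" "0 \<le> (a - b)\<^sup>2" by simp_all
  then have e: "2 * a \<le> 1 + a\<^sup>2" "2 * b \<le> 1 + b\<^sup>2" "2 * (a * b) \<le> a\<^sup>2 + b\<^sup>2"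
    by (simp_all add: power2_eq_square algebra_simps)
  have nn: "0 \<le> a\<^sup>2" "0 \<le> b\<^sup>2" "0 \<le> a * b" using ab by simp_all
  have "a \<le> 1 + (a\<^sup>2 + b\<^sup>2)" "b \<le> 1 + (a\<^sup>2 + b\<^sup>2)" "a * b \<le> 1 + (a\<^sup>2 + b\<^sup>2)"
    using e nn ab by linarith+
  moreover have "m = 0 \<and> n = 0 \<or> m = 1 \<and> n = 0 \<or> m = 2 \<and> n = 0 \<or> m = 0 \<and> n = 1 \<or> m = 0 \<and> n = 2 \<or> m = 1 \<and> n = 1"
    using assms by linarith
  ultimately show ?thesis unfolding D K by auto
qed

text \<open>The ellipticity bound on \<open>q\<close> makes division by \<open>q\<close> gain two
  derivatives, so all symbols of order at most 2 applied to the quotient stay absolutely summable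
  and \<open>l1_synthesis\<close> supplies the derivatives. Evenness of \<open>q\<close> keeps the
  coefficients those of a real class.\<close>

lemma multiplier_inverse:
  assumes th: "l1 (fc \<theta>)" and q: "\<And>k. q (- k) = q k" "\<And>k. 1 + K2 k \<le> C * \<bar>q k\<bar>" "0 \<le> C"
  obtains \<psi> where "\<psi> \<in> sobolev 2" "\<And>k. fc \<psi> k = fc \<theta> k / complex_of_real (q k)"
proof -
  let ?c = "\<lambda>k. fc \<theta> k / complex_of_real (q k)"
  have ne: "q k \<noteq> 0" for k using q(2)[of k] K2_nonneg[of k] by auto
  have l: "l1 (\<lambda>k. dsym m n k * ?c k)" if "m + n \<le> 2" for m n
  proof (rule summable_on_comparison_test)
    show "(\<lambda>k. C * cmod (fc \<theta> k)) summable_on UNIV" using th by (rule summable_on_cmult_right)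
    fix k
    have "cmod (dsym m n k) \<le> C * \<bar>q k\<bar>" using norm_dsym_le_K2[OF that, of k] q(2)[of k] by linarith
    then have "cmod (dsym m n k) * cmod (fc \<theta> k) \<le> C * \<bar>q k\<bar> * cmod (fc \<theta> k)" by (rule mult_right_mono) simp
    then show "cmod (dsym m n k * ?c k) \<le> C * cmod (fc \<theta> k)"
      using ne[of k] by (simp add: norm_mult norm_divide field_simps)
  qed simp
  have ex: "\<exists>g. \<forall>k. fc g k = dsym m n k * ?c k" if mn: "m + n \<le> 2" for m n
  proof -
    obtain g where "\<And>k. fc g k = dsym m n k * ?c k"
      by (rule l1_synthesis[OF l[OF mn]]) (auto simp: dsym_uminus fc_cnj q(1))
    then show ?thesis by blast
  qed
  obtain \<psi> where \<psi>: "\<And>k. fc \<psi> k = ?c k" using ex[of 0 0] by (auto simp: dsym_def)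
  have "\<psi> \<in> sobolev 2" by (rule sobolevI) (use ex \<psi> in simp)
  then show ?thesis using \<psi> that by blast
qed

lemma fc_laplacian:
  assumes "\<psi> \<in> sobolev 2" shows "fc (laplacian \<psi>) k = - complex_of_real (K2 k) * fc \<psi> k"
  unfolding laplacian_def fc_add
  by (simp add: sobolevD[OF assms] dsym_def K2_def power_mult_distrib algebra_simps)

text \<open>The choice inside \<open>inv_into\<close> is harmless: any preimage has coefficients
  determined by division by the nonzero \<open>q\<close>. The last conclusion returns the
  summability premise, so the lemma can be applied to the second operator in \<open>velocity\<close>
  as well.\<close>

lemma inv_into_helmholtz:
  assumes th: "l1 (fc \<theta>)" and q: "\<And>k. q (- k) = q k" "\<And>k. 1 + K2 k \<le> C * \<bar>q k\<bar>" "0 \<le> C"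
    and L: "\<And>\<psi> k. \<psi> \<in> sobolev 2 \<Longrightarrow> fc (L \<psi>) k = complex_of_real (q k) * fc \<psi> k"
  shows "inv_into (sobolev 2) L \<theta> \<in> sobolev 2"
    "fc (inv_into (sobolev 2) L \<theta>) k = fc \<theta> k / complex_of_real (q k)"
    "l1 (fc (inv_into (sobolev 2) L \<theta>))"
proof -
  have ne: "q k \<noteq> 0" for k using q(2)[of k] K2_nonneg[of k] by auto
  obtain \<psi> where \<psi>: "\<psi> \<in> sobolev 2" "\<And>k. fc \<psi> k = fc \<theta> k / complex_of_real (q k)"
    using multiplier_inverse[OF th q] by blast
  have "L \<psi> = \<theta>" by (rule fc_inject) (simp add: L \<psi> ne)
  then have im: "\<theta> \<in> L ` sobolev 2" using \<psi>(1) by blast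
  show s: "inv_into (sobolev 2) L \<theta> \<in> sobolev 2" by (rule inv_into_into[OF im])
  have "complex_of_real (q k) * fc (inv_into (sobolev 2) L \<theta>) k = fc \<theta> k" for k
    using L[OF s, of k] f_inv_into_f[OF im] by simp
  then show e: "fc (inv_into (sobolev 2) L \<theta>) k = fc \<theta> k / complex_of_real (q k)" for k
    using ne[of k] by (simp add: field_simps)
  show "l1 (fc (inv_into (sobolev 2) L \<theta>))"
  proof (rule summable_on_comparison_test)
    show "(\<lambda>k. C * cmod (fc \<theta> k)) summable_on UNIV" using th by (rule summable_on_cmult_right)
    fix k
    have "1 \<le> C * \<bar>q k\<bar>" using q(2)[of k] K2_nonneg[of k] by linarith
    then have "1 * cmod (fc \<theta> k) \<le> C * \<bar>q k\<bar> * cmod (fc \<theta> k)" by (rule mult_right_mono) simp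
    then show "cmod (fc (inv_into (sobolev 2) L \<theta>) k) \<le> C * cmod (fc \<theta> k)"
      using ne[of k] by (simp add: e norm_divide field_simps)
  qed simp
qed

lemma fc_velocity:
  assumes a: "\<alpha> > 0" and th: "\<omega> - f \<in> sobolev 2"
  defines "\<psi> \<equiv> \<lambda>k. - fc (\<omega> - f) k / complex_of_real ((1 + K2 k) * (1 + \<alpha> * K2 k))"
  shows "fc (fst (velocity \<alpha> f \<omega>)) k = - (2 * pi * \<i> * of_int (snd k)) * \<psi> k"
    "fc (snd (velocity \<alpha> f \<omega>)) k = 2 * pi * \<i> * of_int (fst k) * \<psi> k"
proof -
  have l: "l1 (fc (\<omega> - f))" using l1b_summable[OF l1_sobolev[OF th]] by simp
  define \<psi>1 where "\<psi>1 = inv_into (sobolev 2) (\<lambda>\<psi>. laplacian \<psi> - \<psi>) (\<omega> - f)"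
  define \<psi>2 where "\<psi>2 = inv_into (sobolev 2) (\<lambda>\<psi>. \<psi> - \<alpha> *\<^sub>R laplacian \<psi>) \<psi>1"
  have L1: "fc (laplacian \<psi> - \<psi>) k = complex_of_real (- (1 + K2 k)) * fc \<psi> k" if "\<psi> \<in> sobolev 2" for \<psi> k
    by (simp add: fc_diff fc_laplacian[OF that] algebra_simps)
  have L2: "fc (\<psi> - \<alpha> *\<^sub>R laplacian \<psi>) k = complex_of_real (1 + \<alpha> * K2 k) * fc \<psi> k" if "\<psi> \<in> sobolev 2" for \<psi> k
    by (simp add: fc_diff fc_scaleR fc_laplacian[OF that] scaleR_conv_of_real algebra_simps)
  have "1 + K2 k \<le> 1 * \<bar>- (1 + K2 k)\<bar>" for k using K2_nonneg[of k] by simp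
  note 1 = inv_into_helmholtz[of "\<omega> - f" "\<lambda>k. - (1 + K2 k)" 1, OF l _ this _ L1, folded \<psi>1_def]
  \<comment> \<open>Expanding the product gives \<open>1 + K2 k\<close> plus the nonnegative terms
    \<open>\<alpha> * K2 k\<close> and \<open>1/\<alpha>\<close>.\<close>
  have "1 + K2 k \<le> (1 + 1/\<alpha>) * \<bar>1 + \<alpha> * K2 k\<bar>" for k
    using a K2_nonneg[of k] by (simp add: field_simps)
  note 2 = inv_into_helmholtz[of \<psi>1 "\<lambda>k. 1 + \<alpha> * K2 k" "1 + 1/\<alpha>", OF 1(3) _ this _ L2, folded \<psi>2_def]
  have s: "\<psi>2 \<in> sobolev 2" by (rule 2) (use a in \<open>auto simp: K2_uminus\<close>)
  have e: "fc \<psi>2 k = \<psi> k" for k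
  proof -
    have "fc \<psi>2 k = fc \<psi>1 k / complex_of_real (1 + \<alpha> * K2 k)"
      by (rule 2) (use a in \<open>auto simp: K2_uminus\<close>)
    moreover have "fc \<psi>1 k = fc (\<omega> - f) k / complex_of_real (- (1 + K2 k))"
      by (rule 1) (auto simp: K2_uminus)
    moreover have "z / complex_of_real (- x) / complex_of_real y = - z / complex_of_real (x * y)" for z x y
      by simp
    ultimately show ?thesis by (simp only: \<psi>_def)
  qed
  have v: "velocity \<alpha> f \<omega> = grad_perp \<psi>2" by (simp add: velocity_def \<psi>1_def \<psi>2_def)
  show "fc (fst (velocity \<alpha> f \<omega>)) k = - (2 * pi * \<i> * of_int (snd k)) * \<psi> k"
    using sobolevD[OF s, of 0 1 k] by (simp add: v grad_perp_def fc_minus e dsym_def)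
  show "fc (snd (velocity \<alpha> f \<omega>)) k = 2 * pi * \<i> * of_int (fst k) * \<psi> k"
    using sobolevD[OF s, of 1 0 k] by (simp add: v grad_perp_def e dsym_def)
qed

text \<open>A factor \<open>2 * pi\<close> comes from the derivative in \<open>grad_perp\<close>, 9
  from using \<open>lam_le_K2\<close> twice, and \<open>1 + 1 / \<alpha>\<close> from comparing
  \<open>1 + K2 k\<close> with \<open>1 + \<alpha> * K2 k\<close>.\<close>

definition Cvel :: "real \<Rightarrow> real" where
  "Cvel \<alpha> = 18 * pi * (1 + 1 / \<alpha>)"

lemma velocity_bound:
  assumes a: "\<alpha> > 0" and th: "\<omega> - f \<in> sobolev 2"
  shows "lam k ^ 3 * cmod (fc (fst (velocity \<alpha> f \<omega>)) k) \<le> Cvel \<alpha> * cmod (fc (\<omega> - f) k)"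
    "lam k ^ 3 * cmod (fc (snd (velocity \<alpha> f \<omega>)) k) \<le> Cvel \<alpha> * cmod (fc (\<omega> - f) k)"
proof -
  define Q where "Q = (1 + K2 k) * (1 + \<alpha> * K2 k)"
  have Q: "Q > 0" unfolding Q_def using a K2_nonneg[of k] by (intro mult_pos_pos) (auto simp: add_pos_nonneg)
  have "lam k ^ 4 = (lam k)\<^sup>2 * (lam k)\<^sup>2" by (simp add: power_add[symmetric])
  also have "\<dots> \<le> 3 * (1 + K2 k) * (3 * (1 + K2 k))"
    using lam_le_K2[of k] K2_nonneg[of k] by (intro mult_mono) auto
  also have "\<dots> \<le> 3 * (1 + K2 k) * (3 * ((1 + 1/\<alpha>) * (1 + \<alpha> * K2 k)))"
    using a K2_nonneg[of k] by (intro mult_left_mono) (auto simp: field_simps)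
  also have "\<dots> = 9 * (1 + 1/\<alpha>) * Q"
  proof -
    have "3 * x * (3 * (c * y)) = 9 * c * (x * y)" for x y c :: real by simp
    then show ?thesis unfolding Q_def .
  qed
  finally have l4: "lam k ^ 4 \<le> 9 * (1 + 1/\<alpha>) * Q" .
  have *: "lam k ^ 3 * (2 * pi * x * (cmod (fc (\<omega> - f) k) / Q)) \<le> Cvel \<alpha> * cmod (fc (\<omega> - f) k)"
    if "0 \<le> x" "x \<le> lam k" for x
  proof -
    have "lam k ^ 3 * x \<le> lam k ^ 3 * lam k" using that by (intro mult_left_mono) auto
    also have "\<dots> = lam k ^ 4" by (simp add: power_add[symmetric] flip: power_Suc2)
    finally have "lam k ^ 3 * x \<le> 9 * (1 + 1/\<alpha>) * Q" using l4 by simp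
    then have "2 * pi * (lam k ^ 3 * x) * (cmod (fc (\<omega> - f) k) / Q) \<le> 2 * pi * (9 * (1 + 1/\<alpha>) * Q) * (cmod (fc (\<omega> - f) k) / Q)"
      using Q by (intro mult_right_mono mult_left_mono) auto
    also have "\<dots> = Cvel \<alpha> * cmod (fc (\<omega> - f) k)" using Q by (simp add: Cvel_def)
    finally show ?thesis by (simp add: mult_ac)
  qed
  have n: "cmod (complex_of_real Q) = Q" using Q by simp
  show "lam k ^ 3 * cmod (fc (fst (velocity \<alpha> f \<omega>)) k) \<le> Cvel \<alpha> * cmod (fc (\<omega> - f) k)"
    using *[of "\<bar>of_int (snd k)\<bar>"] fc_velocity(1)[OF a th, of k] n
    by (simp add: norm_mult norm_divide lam_def Q_def[symmetric] flip: of_real_mult)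
  show "lam k ^ 3 * cmod (fc (snd (velocity \<alpha> f \<omega>)) k) \<le> Cvel \<alpha> * cmod (fc (\<omega> - f) k)"
    using *[of "\<bar>of_int (fst k)\<bar>"] fc_velocity(2)[OF a th, of k] n
    by (simp add: norm_mult norm_divide lam_def Q_def[symmetric] flip: of_real_mult)
qed

lemma velocity_div_free:
  assumes a: "\<alpha> > 0" and th: "\<omega> - f \<in> sobolev 2"
  shows "of_int (fst k) * fc (fst (velocity \<alpha> f \<omega>)) k + of_int (snd k) * fc (snd (velocity \<alpha> f \<omega>)) k = 0"
  using fc_velocity[OF a th, of k] by simp

section \<open>Convolution and commutator estimates\<close>

lemma l1b_inj:
  assumes "l1b z Z" "inj h" shows "l1b (\<lambda>k. z (h k)) Z"
  unfolding l1b_def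
proof (intro allI impI)
  fix F :: "'b set" assume "finite F"
  moreover have "(\<Sum>k\<in>F. \<bar>z (h k)\<bar>) = (\<Sum>l\<in>h ` F. \<bar>z l\<bar>)"
    using inj_on_subset[OF assms(2)] by (subst sum.reindex) auto
  ultimately show "(\<Sum>k\<in>F. \<bar>z (h k)\<bar>) \<le> Z" using assms(1) unfolding l1b_def by simp
qed

lemma l2b_inj:
  assumes "l2b z Z" "inj h" shows "l2b (\<lambda>k. z (h k)) Z"
  unfolding l2b_def
proof (intro conjI allI impI)
  fix F :: "'b set" assume "finite F"
  moreover have "(\<Sum>k\<in>F. (z (h k))\<^sup>2) = (\<Sum>l\<in>h ` F. (z l)\<^sup>2)"
    using inj_on_subset[OF assms(2)] by (subst sum.reindex) auto
  ultimately show "(\<Sum>k\<in>F. (z (h k))\<^sup>2) \<le> Z\<^sup>2" using assms(1) unfolding l2b_def by simp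
qed (use assms(1) in \<open>simp add: l2b_def\<close>)

lemma inj_shift: "inj (\<lambda>j. k - j)" "inj (\<lambda>j. j - k)" for k :: "'a :: ab_group_add"
  by (rule injI, simp)+

text \<open>Schur's argument: write \<open>z\<close> as the product of two square roots, give one to
  \<open>x\<close> and one to \<open>y\<close>, and apply Cauchy-Schwarz over the pairs
  \<open>(k, j)\<close>. Summing \<open>z (k - j)\<close> over either index costs
  \<open>Z\<close>.\<close>

lemma trilinear_l2_l2_l1:
  fixes x y z :: "int \<times> int \<Rightarrow> real"
  assumes x: "l2b x X" and y: "l2b y Y" and z: "l1b z Z" and fin: "finite K" "finite J"
    and nn: "\<And>k. 0 \<le> z k"
  shows "(\<Sum>k\<in>K. \<Sum>j\<in>J. x k * y j * z (k - j)) \<le> X * Y * Z"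
proof -
  have Z: "0 \<le> Z" by (rule l1b_nonneg[OF z])
  let ?f = "\<lambda>(k, j). x k * sqrt (z (k - j))" and ?g = "\<lambda>(k, j). y j * sqrt (z (k - j))"
  have "(\<Sum>k\<in>K. \<Sum>j\<in>J. x k * y j * z (k - j)) = (\<Sum>p\<in>K \<times> J. ?f p * ?g p)"
  proof -
    have "a * b * c = (a * sqrt c) * (b * sqrt c)" if "0 \<le> c" for a b c :: real
    proof -
      have "(a * sqrt c) * (b * sqrt c) = a * b * (sqrt c * sqrt c)" by (simp only: mult_ac)
      then show ?thesis using that by simp
    qed
    then have "x (fst p) * y (snd p) * z (fst p - snd p) = ?f p * ?g p" for p
      using nn[of "fst p - snd p"] by (simp add: split_beta)
    then show ?thesis unfolding sum.cartesian_product split_beta' by (intro sum.cong refl)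
  qed
  also have "\<dots> \<le> (\<Sum>p\<in>K \<times> J. \<bar>?f p\<bar> * \<bar>?g p\<bar>)"
    unfolding abs_mult[symmetric] by (intro sum_mono abs_ge_self)
  also have "\<dots> \<le> L2_set ?f (K \<times> J) * L2_set ?g (K \<times> J)" by (rule L2_set_mult_ineq)
  also have "L2_set ?f (K \<times> J) \<le> X * sqrt Z"
  proof -
    have "(\<Sum>p\<in>K \<times> J. (?f p)\<^sup>2) = (\<Sum>k\<in>K. (x k)\<^sup>2 * (\<Sum>j\<in>J. \<bar>z (k - j)\<bar>))"
    proof -
      have "(?f p)\<^sup>2 = (x (fst p))\<^sup>2 * \<bar>z (fst p - snd p)\<bar>" for p
        by (simp add: split_beta power_mult_distrib nn)
      then show ?thesis unfolding sum_distrib_left sum.cartesian_product split_beta' by (simp only:)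
    qed
    also have "\<dots> \<le> (\<Sum>k\<in>K. (x k)\<^sup>2 * Z)"
      using l1b_inj[OF z inj_shift(1)] fin(2) unfolding l1b_def by (intro sum_mono mult_left_mono) auto
    also have "\<dots> \<le> X\<^sup>2 * Z"
      using x fin(1) Z unfolding l2b_def by (simp add: mult_right_mono flip: sum_distrib_right)
    finally have "sqrt (\<Sum>p\<in>K \<times> J. (?f p)\<^sup>2) \<le> sqrt (X\<^sup>2 * Z)" by (rule real_sqrt_le_mono)
    then show ?thesis using l2b_nonneg[OF x] by (simp add: L2_set_def real_sqrt_mult)
  qed
  also have "L2_set ?g (K \<times> J) \<le> Y * sqrt Z"
  proof -
    have "(\<Sum>p\<in>K \<times> J. (?g p)\<^sup>2) = (\<Sum>j\<in>J. (y j)\<^sup>2 * (\<Sum>k\<in>K. \<bar>z (k - j)\<bar>))"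
    proof -
      have "(?g p)\<^sup>2 = (y (snd p))\<^sup>2 * \<bar>z (fst p - snd p)\<bar>" for p
        by (simp add: split_beta power_mult_distrib nn)
      then show ?thesis
        unfolding sum_distrib_left
        by (subst sum.swap) (simp only: sum.cartesian_product split_beta')
    qed
    also have "\<dots> \<le> (\<Sum>j\<in>J. (y j)\<^sup>2 * Z)"
      using l1b_inj[OF z inj_shift(2)] fin(1) unfolding l1b_def by (intro sum_mono mult_left_mono) auto
    also have "\<dots> \<le> Y\<^sup>2 * Z"
      using y fin(2) Z unfolding l2b_def by (simp add: mult_right_mono flip: sum_distrib_right)
    finally have "sqrt (\<Sum>p\<in>K \<times> J. (?g p)\<^sup>2) \<le> sqrt (Y\<^sup>2 * Z)" by (rule real_sqrt_le_mono)
    then show ?thesis using l2b_nonneg[OF y] by (simp add: L2_set_def real_sqrt_mult)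
  qed
  finally have "(\<Sum>k\<in>K. \<Sum>j\<in>J. x k * y j * z (k - j)) \<le> (X * sqrt Z) * (Y * sqrt Z)"
    using l2b_nonneg[OF x] Z by (simp add: mult_left_mono mult_right_mono)
  then show ?thesis using Z by (simp add: mult_ac)
qed

text \<open>For fixed \<open>j\<close> Cauchy-Schwarz in \<open>k\<close> bounds the inner sum by
  \<open>X * Z\<close>, shifts being harmless; the summable \<open>y\<close> then pays for the sum
  over \<open>j\<close>.\<close>

lemma trilinear_l2_l1_l2:
  fixes x y z :: "int \<times> int \<Rightarrow> real"
  assumes x: "l2b x X" and y: "l1b y Y" and z: "l2b z Z" and fin: "finite K" "finite J"
  shows "(\<Sum>k\<in>K. \<Sum>j\<in>J. x k * y j * z (k - j)) \<le> X * Y * Z"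
proof -
  have XZ: "0 \<le> X * Z" using l2b_nonneg[OF x] l2b_nonneg[OF z] by simp
  have "(\<Sum>k\<in>K. \<Sum>j\<in>J. x k * y j * z (k - j)) = (\<Sum>j\<in>J. y j * (\<Sum>k\<in>K. x k * z (k - j)))"
    unfolding sum.swap[of _ J K] sum_distrib_left by (intro sum.cong refl) (simp only: mult_ac)
  also have "\<dots> \<le> (\<Sum>j\<in>J. \<bar>y j\<bar> * (X * Z))"
  proof (rule sum_mono)
    fix j
    have "\<bar>\<Sum>k\<in>K. x k * z (k - j)\<bar> \<le> X * Z"
    proof (rule order.trans[OF sum_abs])
      show "(\<Sum>k\<in>K. \<bar>x k * z (k - j)\<bar>) \<le> X * Z"
        using l1b_mult[OF x l2b_inj[OF z inj_shift(2)]] fin(1) unfolding l1b_def by blast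
    qed
    then have "\<bar>y j\<bar> * \<bar>\<Sum>k\<in>K. x k * z (k - j)\<bar> \<le> \<bar>y j\<bar> * (X * Z)" by (rule mult_left_mono) simp
    then show "y j * (\<Sum>k\<in>K. x k * z (k - j)) \<le> \<bar>y j\<bar> * (X * Z)"
      unfolding abs_mult[symmetric] by (rule order.trans[OF abs_ge_self])
  qed
  also have "\<dots> \<le> X * Y * Z"
  proof -
    have "(\<Sum>j\<in>J. \<bar>y j\<bar>) \<le> Y" using y fin(2) unfolding l1b_def by blast
    from mult_right_mono[OF this XZ] show ?thesis
      unfolding sum_distrib_right[symmetric] by (simp add: mult_ac)
  qed
  finally show ?thesis .
qed

lemma trilinear_l2_l1_l2':
  fixes x y z :: "int \<times> int \<Rightarrow> real"
  assumes "l2b x X" "l1b y Y" and z: "l2b z Z" and "finite K" "finite J"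
  shows "(\<Sum>k\<in>K. \<Sum>j\<in>J. x j * y k * z (k - j)) \<le> X * Y * Z"
  using trilinear_l2_l1_l2[OF assms(1,2) l2b_inj[OF z, of uminus] assms(5,4)]
  unfolding sum.swap[of _ K J] by simp

text \<open>Passes a bound from finite inner sums to the infinite ones. Asking for it only when
  \<open>K \<subseteq> J\<close> leaves room for the symmetrization on the square of
  \<open>K\<close> in the next lemma.\<close>

lemma has_sum_finite_bound:
  fixes A :: "'a \<Rightarrow> 'a \<Rightarrow> real"
  assumes K: "finite K" and s: "\<And>k. k \<in> K \<Longrightarrow> (A k has_sum s k) UNIV"
    and b: "\<And>J. finite J \<Longrightarrow> K \<subseteq> J \<Longrightarrow> \<bar>\<Sum>k\<in>K. \<Sum>j\<in>J. c k * A k j\<bar> \<le> B"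
  shows "\<bar>\<Sum>k\<in>K. c k * s k\<bar> \<le> B"
proof (rule tendsto_upperbound)
  show "((\<lambda>J. \<bar>\<Sum>k\<in>K. c k * (\<Sum>j\<in>J. A k j)\<bar>) \<longlongrightarrow> \<bar>\<Sum>k\<in>K. c k * s k\<bar>) (finite_subsets_at_top UNIV)"
    using s unfolding has_sum_def by (intro tendsto_intros) auto
  show "\<forall>\<^sub>F J in finite_subsets_at_top UNIV. \<bar>\<Sum>k\<in>K. c k * (\<Sum>j\<in>J. A k j)\<bar> \<le> B"
    unfolding eventually_finite_subsets_at_top
    using K b by (intro exI[of _ K]) (auto simp: sum_distrib_left)
qed simp

text \<open>
  For an antisymmetric kernel only the differences of the weights enter the weighted double sum;
  this is where the transport term loses no derivative.
\<close>

lemma antisymmetric_sum_bound: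
  fixes A :: "'a \<Rightarrow> 'a \<Rightarrow> real"
  assumes K: "finite K" and anti: "\<And>j k. A j k = - A k j"
    and supp: "\<And>k. k \<notin> K \<Longrightarrow> \<mu> k = 0"
    and s: "\<And>k. k \<in> K \<Longrightarrow> (A k has_sum s k) UNIV"
    and b: "\<And>J. finite J \<Longrightarrow> (\<Sum>k\<in>K. \<Sum>j\<in>J. \<bar>\<mu> k - \<mu> j\<bar> * \<bar>A k j\<bar>) \<le> B"
  shows "\<bar>\<Sum>k\<in>K. \<mu> k * s k\<bar> \<le> B"
proof (rule has_sum_finite_bound[OF K s])
  fix J assume J: "finite J" "K \<subseteq> J"
  define S where "S L = (\<Sum>k\<in>K. \<Sum>j\<in>L. \<bar>\<mu> k - \<mu> j\<bar> * \<bar>A k j\<bar>)" for L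
  have split: "(\<Sum>j\<in>J. h j) = (\<Sum>j\<in>K. h j) + (\<Sum>j\<in>J - K. h j)" for h :: "'a \<Rightarrow> real"
    using sum.subset_diff[OF J(2) J(1), of h] by simp
  have bnd: "\<bar>\<Sum>k\<in>K. \<Sum>j\<in>L. (\<mu> k - \<mu> j) * A k j\<bar> \<le> S L" for L
    unfolding S_def by (intro order.trans[OF sum_abs] sum_mono order.trans[OF sum_abs]) (simp add: abs_mult)
  \<comment> \<open>On the square of \<open>K\<close>, exchanging the indices turns the weighted sum
    into half the sum with weight differences.\<close>
  have "(\<Sum>k\<in>K. \<Sum>j\<in>K. \<mu> j * A k j) = (\<Sum>k\<in>K. \<Sum>j\<in>K. \<mu> k * A j k)" by (rule sum.swap)
  also have "\<dots> = - (\<Sum>k\<in>K. \<Sum>j\<in>K. \<mu> k * A k j)"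
    unfolding sum_negf[symmetric] by (intro sum.cong refl) (subst anti, simp)
  finally have "(\<Sum>k\<in>K. \<Sum>j\<in>K. (\<mu> k - \<mu> j) * A k j) = 2 * (\<Sum>k\<in>K. \<Sum>j\<in>K. \<mu> k * A k j)"
    by (simp add: left_diff_distrib sum_subtractf)
  then have 1: "\<bar>\<Sum>k\<in>K. \<Sum>j\<in>K. \<mu> k * A k j\<bar> \<le> S K" using bnd[of K] by linarith
  \<comment> \<open>Outside \<open>K\<close> the weight of \<open>j\<close> is 0, so these terms
    already carry a weight difference.\<close>
  have "(\<Sum>k\<in>K. \<Sum>j\<in>J - K. \<mu> k * A k j) = (\<Sum>k\<in>K. \<Sum>j\<in>J - K. (\<mu> k - \<mu> j) * A k j)"
    by (intro sum.cong refl) (auto simp: supp)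
  then have 2: "\<bar>\<Sum>k\<in>K. \<Sum>j\<in>J - K. \<mu> k * A k j\<bar> \<le> S (J - K)" using bnd[of "J - K"] by simp
  have "(\<Sum>k\<in>K. \<Sum>j\<in>J. \<mu> k * A k j) = (\<Sum>k\<in>K. \<Sum>j\<in>K. \<mu> k * A k j) + (\<Sum>k\<in>K. \<Sum>j\<in>J - K. \<mu> k * A k j)"
    unfolding split by (rule sum.distrib)
  then have "\<bar>\<Sum>k\<in>K. \<Sum>j\<in>J. \<mu> k * A k j\<bar> \<le> S K + S (J - K)" using 1 2 by linarith
  also have "\<dots> = S J" unfolding S_def split by (rule sum.distrib[symmetric])
  also have "\<dots> \<le> B" unfolding S_def by (rule b[OF J(1)])
  finally show "\<bar>\<Sum>k\<in>K. \<Sum>j\<in>J. \<mu> k * A k j\<bar> \<le> B" .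
qed auto

section \<open>Differences of the tapered weights\<close>

definition cutoff :: "real \<Rightarrow> int \<times> int \<Rightarrow> real" where
  "cutoff N k = max 0 (1 - lam k / N)"

lemma cutoff_bounds: "N > 0 \<Longrightarrow> 0 \<le> cutoff N k" "N > 0 \<Longrightarrow> cutoff N k \<le> 1"
  by (auto simp: cutoff_def)

lemma cutoff_support: "N > 0 \<Longrightarrow> k \<notin> {k. lam k < N} \<Longrightarrow> cutoff N k = 0"
  by (auto simp: cutoff_def field_simps)

lemma finite_lam_less: "finite {k. lam k < N}"
proof (rule finite_subset)
  show "{k. lam k < N} \<subseteq> {- \<lceil>N\<rceil>..\<lceil>N\<rceil>} \<times> {- \<lceil>N\<rceil>..\<lceil>N\<rceil>}"
    by (auto simp: lam_def) (linarith+)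
qed simp

lemma power_diff_le:
  fixes a b :: real assumes "0 \<le> a" "a \<le> b"
  shows "b ^ Suc n - a ^ Suc n \<le> Suc n * b ^ n * (b - a)"
proof (induction n)
  case (Suc n)
  have "b ^ Suc (Suc n) - a ^ Suc (Suc n) = b * (b ^ Suc n - a ^ Suc n) + a ^ Suc n * (b - a)"
    by (simp add: algebra_simps)
  also have "\<dots> \<le> b * (Suc n * b ^ n * (b - a)) + b ^ Suc n * (b - a)"
    using assms Suc by (intro add_mono mult_left_mono mult_right_mono power_mono) auto
  also have "\<dots> = Suc (Suc n) * b ^ Suc n * (b - a)" by (simp add: algebra_simps)
  finally show ?case .
qed simp

text \<open>Uniformity in \<open>N\<close> is the point. The change of the power contributes
  \<open>n + 1\<close> as in the mean value theorem; the change of the cutoff contributes one more,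
  because it is at most \<open>(b - a) / b\<close> and this cancels one factor
  \<open>b\<close>.\<close>

lemma cutoff_weight_diff:
  fixes a b :: real assumes ab: "1 \<le> a" "a \<le> b" and N: "N > 0"
  shows "\<bar>b ^ Suc n * max 0 (1 - b / N) - a ^ Suc n * max 0 (1 - a / N)\<bar> \<le> (real n + 2) * b ^ n * (b - a)"
proof -
  let ?p = "\<lambda>x. max 0 (1 - x / N)"
  have b: "b > 0" using ab by simp
  have p1: "0 \<le> ?p x" "x \<ge> 0 \<Longrightarrow> ?p x \<le> 1" for x using N by auto
  \<comment> \<open>For \<open>b \<le> N\<close> the slope \<open>1/N\<close> is at most
    \<open>1/b\<close>; for larger \<open>b\<close> the cutoff at \<open>b\<close> is 0 and its
    value at \<open>a\<close> is compared with \<open>1 - a / b\<close>.\<close>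
  have d: "\<bar>?p b - ?p a\<bar> \<le> (b - a) / b"
  proof (cases "b \<le> N")
    case True
    have "\<bar>?p b - ?p a\<bar> = (b - a) / N" using True ab N by (auto simp: max_def field_simps)
    also have "\<dots> \<le> (b - a) / b" using True ab b by (intro divide_left_mono) auto
    finally show ?thesis .
  next
    case False
    then have "?p b = 0" using N by (auto simp: field_simps)
    moreover have "?p a \<le> (b - a) / b"
    proof -
      have "a / b \<le> a / N" using False ab N by (intro divide_left_mono) auto
      then have "1 - a / N \<le> (b - a) / b" using b by (simp add: diff_divide_distrib)
      moreover have "0 \<le> (b - a) / b" using ab b by simp
      ultimately show ?thesis by simp
    qed
    ultimately show ?thesis using p1(1)[of a] by simp
  qed
  have "b ^ Suc n * ?p b - a ^ Suc n * ?p a = b ^ Suc n * (?p b - ?p a) + (b ^ Suc n - a ^ Suc n) * ?p a"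
    by (simp add: algebra_simps)
  then have "\<bar>b ^ Suc n * ?p b - a ^ Suc n * ?p a\<bar> \<le> \<bar>b ^ Suc n * (?p b - ?p a)\<bar> + \<bar>(b ^ Suc n - a ^ Suc n) * ?p a\<bar>"
    by (simp only: abs_triangle_ineq)
  also have "\<bar>b ^ Suc n * (?p b - ?p a)\<bar> \<le> b ^ Suc n * ((b - a) / b)"
    using mult_left_mono[OF d, of "b ^ Suc n"] b
    by (simp only: abs_mult abs_of_pos[OF zero_less_power[OF b]] zero_le_power less_imp_le)
  also have "b ^ Suc n * ((b - a) / b) = b ^ n * (b - a)" using b by simp
  also have "\<bar>(b ^ Suc n - a ^ Suc n) * ?p a\<bar> \<le> Suc n * b ^ n * (b - a) * 1"
  proof -
    have "a ^ Suc n \<le> b ^ Suc n" using ab by (intro power_mono) auto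
    then have "\<bar>(b ^ Suc n - a ^ Suc n) * ?p a\<bar> = (b ^ Suc n - a ^ Suc n) * ?p a" using p1(1)[of a] by (simp add: abs_mult)
    also have "\<dots> \<le> Suc n * b ^ n * (b - a) * 1"
      using ab power_diff_le[of a b n] p1[of a] b by (intro mult_mono) auto
    finally show ?thesis .
  qed
  finally show ?thesis by (simp add: algebra_simps)
qed

text \<open>Here \<open>a\<close> and \<open>b\<close> stand for the smaller and larger of two
  weights and \<open>l\<close> for the weight of their difference. The factor \<open>a\<close> is
  the derivative in the transport term. The right side is arranged for the trilinear bounds: either
  both copies of the transported function carry \<open>s\<close> weights and the velocity one, or
  the copy at the lower frequency keeps \<open>s - 2\<close> weights, hence is summable, and the
  velocity takes all three.\<close>

lemma weight_diff_real:
  fixes a b l :: real assumes ab: "1 \<le> a" "a \<le> b" "b - a \<le> l" and N: "N > 0" and s: "s = 2 \<or> s = 3"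
  shows "\<bar>b ^ (2 * s) * max 0 (1 - b / N) - a ^ (2 * s) * max 0 (1 - a / N)\<bar> * a
    \<le> 14 * (b ^ s * a ^ s * l + b ^ s * a ^ (s - 2) * l ^ 3)"
proof -
  define d where "d = b - a"
  have d: "0 \<le> d" "d \<le> l" using ab by (simp_all add: d_def)
  have b: "b = a + d" by (simp add: d_def)
  have l3: "d ^ 3 \<le> l ^ 3" using d by (intro power_mono) auto
  from s show ?thesis
  proof
    assume [simp]: "s = 2"
    have "\<bar>b ^ (2 * s) * max 0 (1 - b / N) - a ^ (2 * s) * max 0 (1 - a / N)\<bar> * a \<le> (real 3 + 2) * b ^ 3 * (b - a) * a"
      using cutoff_weight_diff[OF ab(1,2) N, of 3] ab by (intro mult_right_mono) (auto simp: eval_nat_numeral)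
    also have "\<dots> = 5 * (b ^ 2 * (a ^ 2 * d + a * d ^ 2))"
      unfolding b by (simp add: algebra_simps power2_eq_square power3_eq_cube)
    also have "\<dots> \<le> 5 * (b ^ 2 * (2 * (a ^ 2 * d) + d ^ 3))"
    proof -
      \<comment> \<open>The mixed term has neither admissible form; it is absorbed by one of them
        according to whether \<open>d \<le> a\<close>.\<close>
      have "a * d ^ 2 \<le> a ^ 2 * d + d ^ 3"
    proof (cases "d \<le> a")
      case True
      then have "a * d * d \<le> a * d * a" using d ab by (intro mult_left_mono) auto
      then show ?thesis using d by (simp add: power2_eq_square power3_eq_cube mult_ac add_increasing2)
    next
      case False
      then have "a * (d * d) \<le> d * (d * d)" using d ab by (intro mult_right_mono) auto
      moreover have "0 \<le> a * (a * d)" using d ab by simp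
      ultimately show ?thesis by (simp add: power2_eq_square power3_eq_cube mult_ac)
    qed
      then show ?thesis by (intro mult_left_mono) (auto simp: mult_ac)
    qed
    also have "\<dots> \<le> 5 * (b ^ 2 * (2 * (a ^ 2 * l) + l ^ 3))"
      using d l3 by (intro mult_left_mono add_mono) auto
    also have "\<dots> \<le> 14 * (b ^ 2 * (a ^ 2 * l) + b ^ 2 * l ^ 3)"
      using d ab by (simp add: algebra_simps)
    finally show ?thesis by (simp add: mult_ac)
  next
    assume [simp]: "s = 3"
    have "\<bar>b ^ (2 * s) * max 0 (1 - b / N) - a ^ (2 * s) * max 0 (1 - a / N)\<bar> * a \<le> (real 5 + 2) * b ^ 5 * (b - a) * a"
      using cutoff_weight_diff[OF ab(1,2) N, of 5] ab by (intro mult_right_mono) (auto simp: eval_nat_numeral)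
    also have "\<dots> = 7 * (b ^ 3 * (b ^ 2 * (d * a)))"
      by (simp add: d_def eval_nat_numeral)
    \<comment> \<open>Only two of the factors \<open>b\<close> are split; three must remain for the
      copy at the higher frequency. The 2 here times the 7 above gives 14.\<close>
    also have "b ^ 2 \<le> 2 * a ^ 2 + 2 * d ^ 2"
      unfolding b using sum_squares_bound[of a d] by (simp add: power2_sum)
    finally have "\<bar>b ^ (2 * s) * max 0 (1 - b / N) - a ^ (2 * s) * max 0 (1 - a / N)\<bar> * a \<le>
        7 * (b ^ 3 * ((2 * a ^ 2 + 2 * d ^ 2) * (d * a)))" using d ab by (simp add: mult_left_mono mult_right_mono)
    also have "\<dots> = 14 * (b ^ 3 * (a ^ 3 * d + a * d ^ 3))"
      by (simp add: algebra_simps power2_eq_square power3_eq_cube)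
    also have "\<dots> \<le> 14 * (b ^ 3 * (a ^ 3 * l + a * l ^ 3))"
      using d l3 ab by (intro mult_left_mono add_mono) auto
    finally show ?thesis by (simp add: algebra_simps)
  qed
qed

text \<open>Both mixed terms occur on the right since either frequency may be the larger one. The
  factor \<open>min (lam k) (lam j)\<close> is what \<open>norm_adv_term_le_min\<close>
  supplies.\<close>

lemma weight_diff:
  assumes N: "N > 0" and s: "s = 2 \<or> s = 3"
  shows "\<bar>lam k ^ (2 * s) * cutoff N k - lam j ^ (2 * s) * cutoff N j\<bar> * min (lam k) (lam j) \<le>
    14 * (lam k ^ s * lam j ^ s * lam (k - j) + lam k ^ s * lam j ^ (s - 2) * lam (k - j) ^ 3
      + lam j ^ s * lam k ^ (s - 2) * lam (k - j) ^ 3)"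
proof -
  define X where "X k j = lam k ^ s * lam j ^ s * lam (k - j)" for k j
  define Y where "Y k j = lam k ^ s * lam j ^ (s - 2) * lam (k - j) ^ 3" for k j
  have Y0: "0 \<le> Y k j" for k j by (simp add: Y_def)
  have sym: "lam (j - k) = lam (k - j)" for j k using lam_diff(3)[of "k - j"] by simp
  have *: "\<bar>lam k ^ (2 * s) * cutoff N k - lam j ^ (2 * s) * cutoff N j\<bar> * min (lam k) (lam j) \<le> 14 * (X k j + Y k j)"
    if "lam j \<le> lam k" for j k
    using weight_diff_real[OF lam_ge_1 that _ N s, of "lam (k - j)"] lam_diff(1)[of k j] that
    unfolding cutoff_def X_def Y_def by (simp only: min_absorb2 abs_le_iff)
  have "\<bar>lam k ^ (2 * s) * cutoff N k - lam j ^ (2 * s) * cutoff N j\<bar> * min (lam k) (lam j) \<le> 14 * (X k j + Y k j + Y j k)"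
  proof (cases "lam j \<le> lam k")
    case True
    have "A \<le> 14 * (x + y + z)" if "A \<le> 14 * (x + y)" "0 \<le> z" for A x y z :: real
      using that by simp
    from this[OF *[OF True] Y0] show ?thesis .
  next
    case False
    have "X j k = X k j" by (simp add: X_def sym mult_ac)
    then show ?thesis using *[of k j] Y0[of k j] False by (simp add: abs_minus_commute min.commute)
  qed
  then show ?thesis by (simp only: X_def Y_def sym)
qed

lemma cutoff_diff:
  assumes N: "N > 0" shows "\<bar>cutoff N k - cutoff N j\<bar> \<le> lam (k - j) / N"
proof -
  have "\<bar>cutoff N k - cutoff N j\<bar> \<le> \<bar>lam k / N - lam j / N\<bar>" unfolding cutoff_def by linarith
  also have "\<dots> = \<bar>lam k - lam j\<bar> / N" using N by (simp flip: diff_divide_distrib)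
  also have "\<dots> \<le> lam (k - j) / N" using lam_diff(1)[of k j] N by (intro divide_right_mono) auto
  finally show ?thesis .
qed

section \<open>The advection term on coefficients\<close>

definition adv_term ::
  "(int \<times> int \<Rightarrow> complex) \<Rightarrow> (int \<times> int \<Rightarrow> complex) \<Rightarrow> (int \<times> int \<Rightarrow> complex) \<Rightarrow> int \<times> int \<Rightarrow> int \<times> int \<Rightarrow> complex" where
  "adv_term u1 u2 g k j = 2 * pi * \<i> * (of_int (fst k) * u1 (k - j) + of_int (snd k) * u2 (k - j)) * g j"

definition div_free :: "(int \<times> int \<Rightarrow> complex) \<Rightarrow> (int \<times> int \<Rightarrow> complex) \<Rightarrow> bool" where
  "div_free u1 u2 \<longleftrightarrow> (\<forall>l. of_int (fst l) * u1 l + of_int (snd l) * u2 l = 0)"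

text \<open>Incompressibility says that the velocity coefficient at \<open>k - j\<close> is
  orthogonal to \<open>k - j\<close>, so the wave vectors \<open>k\<close> and \<open>j\<close> act
  alike: the divergence of the product equals the derivative along the velocity.\<close>

lemma div_free_shift:
  assumes "div_free u1 u2"
  shows "of_int (fst k) * u1 (k - j) + of_int (snd k) * u2 (k - j) =
    of_int (fst j) * u1 (k - j) + of_int (snd j) * u2 (k - j)"
proof -
  have "of_int (fst (k - j)) * u1 (k - j) + of_int (snd (k - j)) * u2 (k - j) = 0"
    using assms unfolding div_free_def by blast
  then show ?thesis by (simp add: algebra_simps)
qed

lemma norm_adv_term_le:
  "cmod (adv_term u1 u2 g k j) \<le> 2 * pi * lam k * (cmod (u1 (k - j)) + cmod (u2 (k - j))) * cmod (g j)"
proof -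
  have "cmod (of_int (fst k) * u1 (k - j) + of_int (snd k) * u2 (k - j)) \<le>
      \<bar>of_int (fst k)\<bar> * cmod (u1 (k - j)) + \<bar>of_int (snd k)\<bar> * cmod (u2 (k - j))"
    by (rule order.trans[OF norm_triangle_ineq]) (simp add: norm_mult)
  also have "\<dots> \<le> lam k * cmod (u1 (k - j)) + lam k * cmod (u2 (k - j))"
    by (intro add_mono mult_right_mono) (auto simp: lam_def)
  finally have "cmod (of_int (fst k) * u1 (k - j) + of_int (snd k) * u2 (k - j)) \<le> lam k * (cmod (u1 (k - j)) + cmod (u2 (k - j)))"
    by (simp add: distrib_left)
  from mult_right_mono[OF mult_left_mono[OF this, of "2 * pi"], of "cmod (g j)"]
  show ?thesis by (simp add: adv_term_def norm_mult mult.assoc)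
qed

text \<open>Since either wave vector may be used by \<open>div_free_shift\<close>, the derivative
  costs only the smaller frequency.\<close>

lemma norm_adv_term_le_min:
  assumes "div_free u1 u2"
  shows "cmod (adv_term u1 u2 g k j) \<le> 2 * pi * min (lam k) (lam j) * (cmod (u1 (k - j)) + cmod (u2 (k - j))) * cmod (g j)"
proof (cases "lam k \<le> lam j")
  case True
  then show ?thesis using norm_adv_term_le[of u1 u2 g k j] by (simp add: min_absorb1)
next
  case False
  have "cmod (of_int (fst j) * u1 (k - j) + of_int (snd j) * u2 (k - j)) \<le>
      \<bar>of_int (fst j)\<bar> * cmod (u1 (k - j)) + \<bar>of_int (snd j)\<bar> * cmod (u2 (k - j))"
    by (rule order.trans[OF norm_triangle_ineq]) (simp add: norm_mult)
  also have "\<dots> \<le> lam j * cmod (u1 (k - j)) + lam j * cmod (u2 (k - j))"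
    by (intro add_mono mult_right_mono) (auto simp: lam_def)
  finally have "cmod (of_int (fst j) * u1 (k - j) + of_int (snd j) * u2 (k - j)) \<le> lam j * (cmod (u1 (k - j)) + cmod (u2 (k - j)))"
    by (simp add: distrib_left)
  from mult_right_mono[OF mult_left_mono[OF this, of "2 * pi"], of "cmod (g j)"]
  show ?thesis using False
    by (simp add: adv_term_def div_free_shift[OF assms] norm_mult mult.assoc min_absorb2)
qed

text \<open>The termwise form of the skew symmetry of incompressible transport: replacing the wave
  vector \<open>j\<close> by \<open>k\<close> and using that the velocity is real, an exchange of
  the indices gives minus the complex conjugate.\<close>

lemma adv_term_antisymmetric:
  assumes df: "div_free u1 u2" and r: "\<And>l. u1 (- l) = cnj (u1 l)" "\<And>l. u2 (- l) = cnj (u2 l)"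
  shows "Re (cnj (g j) * adv_term u1 u2 g j k) = - Re (cnj (g k) * adv_term u1 u2 g k j)"
proof -
  have s: "u1 (j - k) = cnj (u1 (k - j))" "u2 (j - k) = cnj (u2 (k - j))"
    using r(1)[of "k - j"] r(2)[of "k - j"] by simp_all
  have "adv_term u1 u2 g j k = 2 * pi * \<i> * (of_int (fst k) * u1 (j - k) + of_int (snd k) * u2 (j - k)) * g k"
    unfolding adv_term_def div_free_shift[OF df, of j k] ..
  then have "cnj (g j) * adv_term u1 u2 g j k = - cnj (cnj (g k) * adv_term u1 u2 g k j)"
    by (simp add: adv_term_def s algebra_simps)
  then have "Re (cnj (g j) * adv_term u1 u2 g j k) = Re (- cnj (cnj (g k) * adv_term u1 u2 g k j))" by (rule arg_cong)
  then show ?thesis by (simp only: uminus_complex.sel cnj.sel)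
qed

lemma has_sum_Re_cnj_mult:
  assumes "(t has_sum a) A" shows "((\<lambda>j. Re (cnj z * t j)) has_sum Re (cnj z * a)) A"
  using has_sum_bounded_linear[OF bounded_linear_Re has_sum_cmult_right[OF assms, of "cnj z"]]
  by (simp only: o_def)

abbreviation speed :: "(int \<times> int \<Rightarrow> complex) \<Rightarrow> (int \<times> int \<Rightarrow> complex) \<Rightarrow> int \<times> int \<Rightarrow> real" where
  "speed u1 u2 l \<equiv> cmod (u1 l) + cmod (u2 l)"

lemma transport_kernel_le:
  assumes "div_free u1 u2"
  shows "\<bar>Re (cnj (w k) * adv_term u1 u2 g k j)\<bar> \<le>
    min (lam k) (lam j) * (2 * pi * (cmod (w k) * cmod (g j) * speed u1 u2 (k - j)))"
proof -
  have "\<bar>Re (cnj (w k) * adv_term u1 u2 g k j)\<bar> \<le> cmod (w k) * cmod (adv_term u1 u2 g k j)"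
    using abs_Re_le_cmod[of "cnj (w k) * adv_term u1 u2 g k j"] by (simp add: norm_mult)
  also have "\<dots> \<le> cmod (w k) * (2 * pi * min (lam k) (lam j) * speed u1 u2 (k - j) * cmod (g j))"
    by (intro mult_left_mono norm_adv_term_le_min[OF assms]) auto
  finally show ?thesis by (simp only: mult_ac)
qed

context
  fixes u1 u2 :: "int \<times> int \<Rightarrow> complex" and M :: real
  assumes df: "div_free u1 u2" and M: "l2b (\<lambda>l. lam l ^ 3 * (cmod (u1 l) + cmod (u2 l))) M"
begin

text \<open>Two of the three weights in \<open>M\<close> pay for summability; the one left over
  expresses that the velocity is Lipschitz.\<close>

lemma l1b_lam_U: "l1b (\<lambda>l. lam l * speed u1 u2 l) (4 * M)"
  by (rule l1b_of_l2b) (use M in \<open>simp add: power2_eq_square power3_eq_cube mult.assoc\<close>)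

lemma l2b_lam2_U: "l2b (\<lambda>l. (lam l)\<^sup>2 * speed u1 u2 l) M"
proof -
  have "l2b (\<lambda>l. (lam l)\<^sup>2 * speed u1 u2 l) (1 * M)"
  proof (rule l2b_mono[OF M])
    fix l
    have "(lam l)\<^sup>2 * speed u1 u2 l \<le> lam l ^ 3 * speed u1 u2 l"
      by (intro mult_right_mono power_increasing lam_ge_1) auto
    then show "\<bar>(lam l)\<^sup>2 * speed u1 u2 l\<bar> \<le> 1 * \<bar>lam l ^ 3 * speed u1 u2 l\<bar>" by (simp add: abs_mult)
  qed simp
  then show ?thesis by simp
qed

lemma l1b_U: "l1b (speed u1 u2) (4 * M)"
  by (rule l1b_of_l2b[OF l2b_lam2_U])

text \<open>The commutator estimate. Antisymmetry brings in the weight differences,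
  \<open>weight_diff\<close> splits them into three trilinear sums, and each of these is at most
  \<open>4 * M * G\<^sup>2\<close>. The constant is 14 times \<open>2 * pi\<close> times 12. Its
  independence of \<open>N\<close> permits the limit later.\<close>

lemma transport_estimate:
  assumes r: "\<And>l. u1 (- l) = cnj (u1 l)" "\<And>l. u2 (- l) = cnj (u2 l)"
    and s: "s = 2 \<or> s = 3" and N: "N > 0"
    and G: "l2b (\<lambda>k. lam k ^ s * cmod (g k)) G"
    and a: "\<And>k. (adv_term u1 u2 g k has_sum a k) UNIV"
  shows "\<bar>\<Sum>k | lam k < N. lam k ^ (2 * s) * cutoff N k * Re (cnj (g k) * a k)\<bar> \<le> 336 * pi * M * G\<^sup>2"
proof (rule antisymmetric_sum_bound[where A = "\<lambda>k j. Re (cnj (g k) * adv_term u1 u2 g k j)"])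
  show "finite {k. lam k < N}" by (rule finite_lam_less)
  show "Re (cnj (g j) * adv_term u1 u2 g j k) = - Re (cnj (g k) * adv_term u1 u2 g k j)" for j k
    by (rule adv_term_antisymmetric[OF df r])
  show "lam k ^ (2 * s) * cutoff N k = 0" if "k \<notin> {k. lam k < N}" for k
    using cutoff_support[OF N that] by simp
  show "((\<lambda>j. Re (cnj (g k) * adv_term u1 u2 g k j)) has_sum Re (cnj (g k) * a k)) UNIV" for k
    by (rule has_sum_Re_cnj_mult[OF a])
  fix J :: "(int \<times> int) set" assume J: "finite J"
  let ?K = "{k. lam k < N}"
  \<comment> \<open>Two of the \<open>s\<close> weights of \<open>g\<close> are spent on
    summability, which leaves \<open>s - 2\<close>.\<close>
  have s2: "(lam k)\<^sup>2 * (lam k ^ (s - 2) * c) = lam k ^ s * c" for k c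
    using s by (auto simp: power2_eq_square power3_eq_cube)
  have G1: "l1b (\<lambda>k. lam k ^ (s - 2) * cmod (g k)) (4 * G)"
    by (rule l1b_of_l2b) (simp only: s2 G)
  let ?x = "\<lambda>k. lam k ^ s * cmod (g k)" and ?y = "\<lambda>k. lam k ^ (s - 2) * cmod (g k)"
    and ?U3 = "\<lambda>l. lam l ^ 3 * speed u1 u2 l" and ?U1 = "\<lambda>l. lam l * speed u1 u2 l"
  have pt: "\<bar>lam k ^ (2 * s) * cutoff N k - lam j ^ (2 * s) * cutoff N j\<bar> * \<bar>Re (cnj (g k) * adv_term u1 u2 g k j)\<bar>
      \<le> 28 * pi * (?x k * ?x j * ?U1 (k - j) + ?x k * ?y j * ?U3 (k - j) + ?x j * ?y k * ?U3 (k - j))" for k j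
  proof -
    define D where "D = \<bar>lam k ^ (2 * s) * cutoff N k - lam j ^ (2 * s) * cutoff N j\<bar>"
    have "D * \<bar>Re (cnj (g k) * adv_term u1 u2 g k j)\<bar> \<le>
        D * (min (lam k) (lam j) * (2 * pi * (cmod (g k) * cmod (g j) * speed u1 u2 (k - j))))"
      by (intro mult_left_mono transport_kernel_le df) (simp add: D_def)
    also have "\<dots> = (D * min (lam k) (lam j)) * (2 * pi * (cmod (g k) * cmod (g j) * speed u1 u2 (k - j)))"
      by (rule mult.assoc[symmetric])
    also have "\<dots> \<le> 14 * (lam k ^ s * lam j ^ s * lam (k - j) + lam k ^ s * lam j ^ (s - 2) * lam (k - j) ^ 3
      + lam j ^ s * lam k ^ (s - 2) * lam (k - j) ^ 3) * (2 * pi * (cmod (g k) * cmod (g j) * speed u1 u2 (k - j)))"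
      unfolding D_def by (rule mult_right_mono[OF weight_diff[OF N s]]) simp
    also have "\<dots> = 28 * pi * (?x k * ?x j * ?U1 (k - j) + ?x k * ?y j * ?U3 (k - j) + ?x j * ?y k * ?U3 (k - j))"
      by (simp add: algebra_simps)
    finally show ?thesis by (simp only: D_def)
  qed
  have "(\<Sum>k\<in>?K. \<Sum>j\<in>J. \<bar>lam k ^ (2 * s) * cutoff N k - lam j ^ (2 * s) * cutoff N j\<bar> * \<bar>Re (cnj (g k) * adv_term u1 u2 g k j)\<bar>)
     \<le> (\<Sum>k\<in>?K. \<Sum>j\<in>J. 28 * pi * (?x k * ?x j * ?U1 (k - j) + ?x k * ?y j * ?U3 (k - j) + ?x j * ?y k * ?U3 (k - j)))"
    by (intro sum_mono pt)
  also have "\<dots> = 28 * pi * ((\<Sum>k\<in>?K. \<Sum>j\<in>J. ?x k * ?x j * ?U1 (k - j)) +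
      (\<Sum>k\<in>?K. \<Sum>j\<in>J. ?x k * ?y j * ?U3 (k - j)) + (\<Sum>k\<in>?K. \<Sum>j\<in>J. ?x j * ?y k * ?U3 (k - j)))"
    by (simp only: sum_distrib_left[symmetric] sum.distrib)
  also have "\<dots> \<le> 28 * pi * (G * G * (4 * M) + G * (4 * G) * M + G * (4 * G) * M)"
    by (intro mult_left_mono add_mono trilinear_l2_l2_l1[OF G G l1b_lam_U] trilinear_l2_l1_l2[OF G G1 M] trilinear_l2_l1_l2'[OF G G1 M]
        finite_lam_less J) auto
  also have "\<dots> = 336 * pi * M * G\<^sup>2" by (simp add: power2_eq_square)
  finally show "(\<Sum>k\<in>?K. \<Sum>j\<in>J. \<bar>lam k ^ (2 * s) * cutoff N k - lam j ^ (2 * s) * cutoff N j\<bar> * \<bar>Re (cnj (g k) * adv_term u1 u2 g k j)\<bar>)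
     \<le> 336 * pi * M * G\<^sup>2" .
qed

text \<open>Without the cutoff the transport term would cancel exactly. Tapering leaves an error of
  order \<open>1/N\<close>, since cutoffs differ by at most \<open>lam (k - j) / N\<close>; it costs
  one derivative of \<open>g\<close> and disappears in \<open>cutoff_limit\<close>.\<close>

lemma transport_estimate_L2:
  assumes r: "\<And>l. u1 (- l) = cnj (u1 l)" "\<And>l. u2 (- l) = cnj (u2 l)" and N: "N > 0"
    and G0: "l2b (\<lambda>k. cmod (g k)) G0" and G1: "l2b (\<lambda>k. lam k * cmod (g k)) G1"
    and a: "\<And>k. (adv_term u1 u2 g k has_sum a k) UNIV"
  shows "\<bar>\<Sum>k | lam k < N. cutoff N k * Re (cnj (g k) * a k)\<bar> \<le> 8 * pi * M * G0 * G1 / N"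
proof (rule antisymmetric_sum_bound[where A = "\<lambda>k j. Re (cnj (g k) * adv_term u1 u2 g k j)"])
  show "finite {k. lam k < N}" by (rule finite_lam_less)
  show "Re (cnj (g j) * adv_term u1 u2 g j k) = - Re (cnj (g k) * adv_term u1 u2 g k j)" for j k
    by (rule adv_term_antisymmetric[OF df r])
  show "cutoff N k = 0" if "k \<notin> {k. lam k < N}" for k
    using cutoff_support[OF N that] by simp
  show "((\<lambda>j. Re (cnj (g k) * adv_term u1 u2 g k j)) has_sum Re (cnj (g k) * a k)) UNIV" for k
    by (rule has_sum_Re_cnj_mult[OF a])
  fix J :: "(int \<times> int) set" assume J: "finite J"
  let ?K = "{k. lam k < N}"
  let ?x = "\<lambda>k. cmod (g k)" and ?y = "\<lambda>k. lam k * cmod (g k)" and ?U1 = "\<lambda>l. lam l * speed u1 u2 l"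
  have pt: "\<bar>cutoff N k - cutoff N j\<bar> * \<bar>Re (cnj (g k) * adv_term u1 u2 g k j)\<bar>
      \<le> 2 * pi / N * (?x k * ?y j * ?U1 (k - j))" for k j
  proof -
    have "\<bar>Re (cnj (g k) * adv_term u1 u2 g k j)\<bar> \<le>
        lam j * (2 * pi * (cmod (g k) * cmod (g j) * speed u1 u2 (k - j)))"
      by (rule order.trans[OF transport_kernel_le[OF df]]) (intro mult_right_mono, auto)
    then have "\<bar>cutoff N k - cutoff N j\<bar> * \<bar>Re (cnj (g k) * adv_term u1 u2 g k j)\<bar> \<le>
        lam (k - j) / N * (lam j * (2 * pi * (cmod (g k) * cmod (g j) * speed u1 u2 (k - j))))"
      using N by (intro mult_mono cutoff_diff) auto
    then show ?thesis by (simp add: mult_ac)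
  qed
  have "(\<Sum>k\<in>?K. \<Sum>j\<in>J. \<bar>cutoff N k - cutoff N j\<bar> * \<bar>Re (cnj (g k) * adv_term u1 u2 g k j)\<bar>)
     \<le> (\<Sum>k\<in>?K. \<Sum>j\<in>J. 2 * pi / N * (?x k * ?y j * ?U1 (k - j)))"
    by (intro sum_mono pt)
  also have "\<dots> = 2 * pi / N * (\<Sum>k\<in>?K. \<Sum>j\<in>J. ?x k * ?y j * ?U1 (k - j))"
    by (simp only: sum_distrib_left[symmetric])
  also have "\<dots> \<le> 2 * pi / N * (G0 * G1 * (4 * M))"
    using N by (intro mult_left_mono trilinear_l2_l2_l1[OF G0 G1 l1b_lam_U] finite_lam_less J) auto
  also have "\<dots> = 8 * pi * M * G0 * G1 / N" by simp
  finally show "(\<Sum>k\<in>?K. \<Sum>j\<in>J. \<bar>cutoff N k - cutoff N j\<bar> * \<bar>Re (cnj (g k) * adv_term u1 u2 g k j)\<bar>)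
     \<le> 8 * pi * M * G0 * G1 / N" .
qed

text \<open>No commutator is involved: the derivative falls on \<open>b\<close>, which is controlled
  with one weight more than \<open>w\<close>. The constant is \<open>4 * pi\<close> times the 4 + 4
  from the two trilinear sums.\<close>

lemma source_estimate:
  assumes N: "N > 0" and W: "l2b (\<lambda>k. (lam k)\<^sup>2 * cmod (w k)) W" and B: "l2b (\<lambda>k. lam k ^ 3 * cmod (b k)) B"
    and a: "\<And>k. (adv_term u1 u2 b k has_sum a k) UNIV"
  shows "\<bar>\<Sum>k | lam k < N. lam k ^ 4 * cutoff N k * Re (cnj (w k) * a k)\<bar> \<le> 32 * pi * W * B * M"
proof (rule has_sum_finite_bound[where A = "\<lambda>k j. Re (cnj (w k) * adv_term u1 u2 b k j)"])
  show "finite {k. lam k < N}" by (rule finite_lam_less)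
  show "((\<lambda>j. Re (cnj (w k) * adv_term u1 u2 b k j)) has_sum Re (cnj (w k) * a k)) UNIV" for k
    by (rule has_sum_Re_cnj_mult[OF a])
  fix J :: "(int \<times> int) set" assume J: "finite J"
  let ?K = "{k. lam k < N}"
  let ?x = "\<lambda>k. (lam k)\<^sup>2 * cmod (w k)" and ?y = "\<lambda>k. lam k * cmod (b k)" and ?z = "\<lambda>k. lam k ^ 3 * cmod (b k)"
    and ?U2 = "\<lambda>l. (lam l)\<^sup>2 * speed u1 u2 l"
  have B1: "l1b ?y (4 * B)"
    by (rule l1b_of_l2b) (use B in \<open>simp add: power2_eq_square power3_eq_cube mult.assoc\<close>)
  have pt: "\<bar>lam k ^ 4 * cutoff N k * Re (cnj (w k) * adv_term u1 u2 b k j)\<bar>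
      \<le> 4 * pi * (?x k * ?z j * speed u1 u2 (k - j) + ?x k * ?y j * ?U2 (k - j))" for k j
  proof -
    have 1: "\<bar>Re (cnj (w k) * adv_term u1 u2 b k j)\<bar> \<le>
        lam j * (2 * pi * (cmod (w k) * cmod (b j) * speed u1 u2 (k - j)))"
      by (rule order.trans[OF transport_kernel_le[OF df]]) (intro mult_right_mono, auto)
    \<comment> \<open>Of the four weights two stay with \<open>w\<close>; the other two are handed
      either to \<open>b\<close> or to the velocity.\<close>
    have "(lam k)\<^sup>2 \<le> (lam j + lam (k - j))\<^sup>2" by (intro power_mono lam_diff) auto
    also have "\<dots> \<le> 2 * ((lam j)\<^sup>2 + (lam (k - j))\<^sup>2)"
      using sum_squares_bound[of "lam j" "lam (k - j)"] by (simp add: power2_sum)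
    finally have "(lam k)\<^sup>2 * (lam k)\<^sup>2 \<le> (lam k)\<^sup>2 * (2 * ((lam j)\<^sup>2 + (lam (k - j))\<^sup>2))" by (rule mult_left_mono) simp
    moreover have "lam k ^ 4 * cutoff N k \<le> (lam k)\<^sup>2 * (lam k)\<^sup>2"
    proof -
      have "lam k ^ 4 * cutoff N k \<le> lam k ^ 4 * 1"
        using cutoff_bounds[OF N, of k] by (intro mult_left_mono) auto
      then show ?thesis by (simp add: power_add[symmetric])
    qed
    ultimately have 2: "lam k ^ 4 * cutoff N k \<le> (lam k)\<^sup>2 * (2 * ((lam j)\<^sup>2 + (lam (k - j))\<^sup>2))"
      by (rule order.trans[rotated])
    have "\<bar>lam k ^ 4 * cutoff N k * Re (cnj (w k) * adv_term u1 u2 b k j)\<bar> =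
        lam k ^ 4 * cutoff N k * \<bar>Re (cnj (w k) * adv_term u1 u2 b k j)\<bar>"
      using cutoff_bounds(1)[OF N, of k] by (simp only: abs_mult abs_of_nonneg zero_le_power lam_pos)
    also have "\<dots> \<le> (lam k)\<^sup>2 * (2 * ((lam j)\<^sup>2 + (lam (k - j))\<^sup>2)) *
        (lam j * (2 * pi * (cmod (w k) * cmod (b j) * speed u1 u2 (k - j))))"
      using cutoff_bounds(1)[OF N, of k] by (intro mult_mono 1 2) auto
    also have "\<dots> = 4 * pi * (?x k * ?z j * speed u1 u2 (k - j) + ?x k * ?y j * ?U2 (k - j))"
      by (simp add: algebra_simps power2_eq_square power3_eq_cube)
    finally show ?thesis .
  qed
  have "\<bar>\<Sum>k\<in>?K. \<Sum>j\<in>J. lam k ^ 4 * cutoff N k * Re (cnj (w k) * adv_term u1 u2 b k j)\<bar>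
      \<le> (\<Sum>k\<in>?K. \<Sum>j\<in>J. 4 * pi * (?x k * ?z j * speed u1 u2 (k - j) + ?x k * ?y j * ?U2 (k - j)))"
    by (intro order.trans[OF sum_abs] sum_mono order.trans[OF sum_abs] pt)
  also have "\<dots> = 4 * pi * ((\<Sum>k\<in>?K. \<Sum>j\<in>J. ?x k * ?z j * speed u1 u2 (k - j)) + (\<Sum>k\<in>?K. \<Sum>j\<in>J. ?x k * ?y j * ?U2 (k - j)))"
    by (simp only: sum_distrib_left[symmetric] sum.distrib)
  also have "\<dots> \<le> 4 * pi * (W * B * (4 * M) + W * (4 * B) * M)"
    by (intro mult_left_mono add_mono trilinear_l2_l2_l1[OF W B l1b_U] trilinear_l2_l1_l2[OF W B1 l2b_lam2_U]
        finite_lam_less J) auto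
  also have "\<dots> = 32 * pi * W * B * M" by simp
  finally show "\<bar>\<Sum>k\<in>?K. \<Sum>j\<in>J. lam k ^ 4 * cutoff N k * Re (cnj (w k) * adv_term u1 u2 b k j)\<bar> \<le> 32 * pi * W * B * M" .
qed

end

section \<open>Perturbation of the advection term and removal of the cutoff\<close>

lemma has_sum_norm_bound:
  fixes f :: "'a \<Rightarrow> complex"
  assumes "(f has_sum s) UNIV" "\<And>J. finite J \<Longrightarrow> (\<Sum>j\<in>J. cmod (f j)) \<le> B"
  shows "cmod s \<le> B"
proof (rule tendsto_upperbound)
  show "((\<lambda>J. cmod (\<Sum>j\<in>J. f j)) \<longlongrightarrow> cmod s) (finite_subsets_at_top UNIV)"
    using assms(1) unfolding has_sum_def by (rule tendsto_norm)
  show "\<forall>\<^sub>F J in finite_subsets_at_top UNIV. cmod (\<Sum>j\<in>J. f j) \<le> B"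
    using assms(2) by (intro eventually_finite_subsets_at_top_weakI order.trans[OF norm_sum]) auto
qed simp

lemma sum_adv_term_le:
  assumes U: "l2b (speed u1 u2) U" and G: "l2b (\<lambda>j. cmod (g j)) G" and J: "finite J"
  shows "(\<Sum>j\<in>J. cmod (adv_term u1 u2 g k j)) \<le> 2 * pi * lam k * (U * G)"
proof -
  have "l1b (\<lambda>j. speed u1 u2 (k - j) * cmod (g j)) (U * G)"
    by (rule l1b_mult[OF l2b_inj[OF U inj_shift(1)] G])
  then have "(\<Sum>j\<in>J. \<bar>speed u1 u2 (k - j) * cmod (g j)\<bar>) \<le> U * G" using J unfolding l1b_def by blast
  then have 1: "(\<Sum>j\<in>J. speed u1 u2 (k - j) * cmod (g j)) \<le> U * G" by (simp add: abs_mult)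
  have "(\<Sum>j\<in>J. cmod (adv_term u1 u2 g k j)) \<le> (\<Sum>j\<in>J. 2 * pi * lam k * (speed u1 u2 (k - j) * cmod (g j)))"
    using norm_adv_term_le[of u1 u2 g k] by (intro sum_mono) (simp add: mult.assoc)
  also have "\<dots> \<le> 2 * pi * lam k * (U * G)"
    unfolding sum_distrib_left[symmetric] by (intro mult_left_mono 1) simp
  finally show ?thesis .
qed

text \<open>Bilinear splitting: the change of the velocity acts on the new \<open>g\<close>, and the
  old velocity acts on the change of \<open>g\<close>. The factor \<open>lam k\<close> is harmless
  because it serves continuity in time of one fixed coefficient.\<close>

lemma adv_diff_bound:
  assumes a: "(adv_term u1 u2 g k has_sum a) UNIV" and a': "(adv_term u1' u2' g' k has_sum a') UNIV"
    and D: "l2b (\<lambda>l. cmod (u1 l - u1' l) + cmod (u2 l - u2' l)) D" and G: "l2b (\<lambda>j. cmod (g j)) G"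
    and U: "l2b (\<lambda>l. cmod (u1' l) + cmod (u2' l)) U" and E: "l2b (\<lambda>j. cmod (g j - g' j)) E"
  shows "cmod (a - a') \<le> 2 * pi * lam k * (D * G + U * E)"
proof -
  have "((\<lambda>j. adv_term u1 u2 g k j + - adv_term u1' u2' g' k j) has_sum (a + - a')) UNIV"
    using a' by (intro has_sum_add a) (simp add: has_sum_uminus)
  then have d: "((\<lambda>j. adv_term (\<lambda>l. u1 l - u1' l) (\<lambda>l. u2 l - u2' l) g k j + adv_term u1' u2' (\<lambda>j. g j - g' j) k j) has_sum (a - a')) UNIV"
    by (simp add: adv_term_def algebra_simps)
  show ?thesis
  proof (rule has_sum_norm_bound[OF d])
    fix J :: "(int \<times> int) set" assume J: "finite J"
    have "(\<Sum>j\<in>J. cmod (adv_term (\<lambda>l. u1 l - u1' l) (\<lambda>l. u2 l - u2' l) g k j + adv_term u1' u2' (\<lambda>j. g j - g' j) k j)) \<le>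
        (\<Sum>j\<in>J. cmod (adv_term (\<lambda>l. u1 l - u1' l) (\<lambda>l. u2 l - u2' l) g k j)) + (\<Sum>j\<in>J. cmod (adv_term u1' u2' (\<lambda>j. g j - g' j) k j))"
      unfolding sum.distrib[symmetric] by (intro sum_mono norm_triangle_ineq)
    also have "\<dots> \<le> 2 * pi * lam k * (D * G) + 2 * pi * lam k * (U * E)"
      by (intro add_mono sum_adv_term_le D G U E J)
    finally show "(\<Sum>j\<in>J. cmod (adv_term (\<lambda>l. u1 l - u1' l) (\<lambda>l. u2 l - u2' l) g k j + adv_term u1' u2' (\<lambda>j. g j - g' j) k j))
      \<le> 2 * pi * lam k * (D * G + U * E)" by (simp only: distrib_left)
  qed
qed

text \<open>On a fixed finite \<open>F\<close> the cutoff tends to 1. The summand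
  \<open>c / real (Suc n)\<close> makes room for the transport error of the L2 balance.\<close>

lemma cutoff_limit:
  assumes w: "\<And>k. 0 \<le> w k" and c: "\<And>n. (\<Sum>k | lam k < real (Suc n). w k * cutoff (real (Suc n)) k) \<le> R + c / real (Suc n)"
    and F: "finite F"
  shows "(\<Sum>k\<in>F. w k) \<le> R"
proof (rule LIMSEQ_le)
  have *: "(\<lambda>n. x / real (Suc n)) \<longlonglongrightarrow> 0" for x
    using tendsto_mult[OF tendsto_const[of x] LIMSEQ_inverse_real_of_nat] by (simp add: divide_inverse)
  have "(\<lambda>n. cutoff (real (Suc n)) k) \<longlonglongrightarrow> max 0 (1 - 0)" for k
    unfolding cutoff_def by (intro tendsto_intros *)
  then have "(\<lambda>n. \<Sum>k\<in>F. w k * cutoff (real (Suc n)) k) \<longlonglongrightarrow> (\<Sum>k\<in>F. w k * max 0 (1 - 0))"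
    by (intro tendsto_sum tendsto_mult tendsto_const)
  then show "(\<lambda>n. \<Sum>k\<in>F. w k * cutoff (real (Suc n)) k) \<longlonglongrightarrow> (\<Sum>k\<in>F. w k)"
    by (simp only: diff_zero max.absorb2 zero_le_one mult_1_right)
  show "(\<lambda>n. R + c / real (Suc n)) \<longlonglongrightarrow> R"
    using tendsto_add[OF tendsto_const[of R] *[of c]] by simp
  show "\<exists>N. \<forall>n\<ge>N. (\<Sum>k\<in>F. w k * cutoff (real (Suc n)) k) \<le> R + c / real (Suc n)"
  proof (intro exI allI impI)
    fix n :: nat
    let ?N = "real (Suc n)"
    have "(\<Sum>k\<in>F. w k * cutoff ?N k) \<le> (\<Sum>k\<in>F \<union> {k. lam k < ?N}. w k * cutoff ?N k)"
      using F w by (intro sum_mono2) (auto simp: finite_lam_less cutoff_bounds)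
    also have "\<dots> = (\<Sum>k | lam k < ?N. w k * cutoff ?N k)"
      using F by (intro sum.mono_neutral_right) (auto simp: finite_lam_less cutoff_support)
    also have "\<dots> \<le> R + c / ?N" by (rule c)
    finally show "(\<Sum>k\<in>F. w k * cutoff ?N k) \<le> R + c / ?N" .
  qed
qed

section \<open>Energy inequalities in time\<close>

lemma derivative_bound_integral:
  fixes E E' \<beta> :: "real \<Rightarrow> real"
  assumes d: "\<And>t. t \<in> {0..T} \<Longrightarrow> (E has_real_derivative E' t) (at t within {0..T})"
    and le: "\<And>t. t \<in> {0..T} \<Longrightarrow> E' t \<le> \<beta> t" and c: "continuous_on {0..T} \<beta>" and t: "t \<in> {0..T}"
  shows "E t \<le> E 0 + integral {0..t} \<beta>"
proof -
  have sub: "{0..t} \<subseteq> {0..T}" using t by auto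
  have "(E' has_integral (E t - E 0)) {0..t}"
  proof (rule fundamental_theorem_of_calculus)
    show "0 \<le> t" using t by simp
    show "(E has_vector_derivative E' s) (at s within {0..t})" if "s \<in> {0..t}" for s
      using DERIV_subset[OF d sub] that sub by (auto simp: has_real_derivative_iff_has_vector_derivative)
  qed
  moreover have "(\<beta> has_integral integral {0..t} \<beta>) {0..t}"
    by (intro integrable_integral integrable_continuous_interval continuous_on_subset[OF c sub])
  ultimately have "E t - E 0 \<le> integral {0..t} \<beta>"
    by (rule has_integral_le) (use le sub in auto)
  then show ?thesis by simp
qed

text \<open>The integral form, as suits norms known to be merely continuous in time: the right-hand
  side \<open>Y\<close>, multiplied by \<open>exp (- I t)\<close>, has nonpositive
  derivative.\<close>

lemma Gronwall:
  fixes y a :: "real \<Rightarrow> real"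
  assumes y: "continuous_on {0..T} y" and a: "continuous_on {0..T} a" and a0: "\<And>t. t \<in> {0..T} \<Longrightarrow> 0 \<le> a t"
    and le: "\<And>t. t \<in> {0..T} \<Longrightarrow> y t \<le> C + integral {0..t} (\<lambda>s. a s * y s)" and t: "t \<in> {0..T}"
  shows "y t \<le> C * exp (integral {0..t} a)"
proof -
  define Y where "Y t = C + integral {0..t} (\<lambda>s. a s * y s)" for t
  define I where "I t = integral {0..t} a" for t
  have ay: "continuous_on {0..T} (\<lambda>s. a s * y s)" by (intro continuous_intros a y)
  have dI: "(I has_real_derivative a s) (at s within {0..T})" if "s \<in> {0..T}" for s
    unfolding I_def has_real_derivative_iff_has_vector_derivative by (rule integral_has_vector_derivative[OF a that])
  have dY: "(Y has_real_derivative a s * y s) (at s within {0..T})" if "s \<in> {0..T}" for s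
  proof -
    have "((\<lambda>t. integral {0..t} (\<lambda>s. a s * y s)) has_real_derivative a s * y s) (at s within {0..T})"
      unfolding has_real_derivative_iff_has_vector_derivative by (rule integral_has_vector_derivative[OF ay that])
    from DERIV_add[OF DERIV_const[of C] this] show ?thesis unfolding Y_def by simp
  qed
  have "Y t * exp (- I t) \<le> Y 0 * exp (- I 0) + integral {0..t} (\<lambda>_. 0)"
  proof (rule derivative_bound_integral[OF _ _ _ t])
    fix s assume s: "s \<in> {0..T}"
    show "((\<lambda>s. Y s * exp (- I s)) has_real_derivative (a s * y s * exp (- I s) - Y s * (exp (- I s) * a s))) (at s within {0..T})"
      using dY[OF s] dI[OF s] by (auto intro!: derivative_eq_intros)
    have "a s * y s \<le> a s * Y s" using le[OF s] a0[OF s] by (intro mult_left_mono) (auto simp: Y_def)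
    then have "a s * y s * exp (- I s) \<le> a s * Y s * exp (- I s)" by (rule mult_right_mono) simp
    then show "a s * y s * exp (- I s) - Y s * (exp (- I s) * a s) \<le> 0" by (simp add: mult_ac)
  qed simp
  then have "Y t * exp (- I t) \<le> C" by (simp add: Y_def I_def)
  from mult_right_mono[OF this, of "exp (I t)"] have "Y t \<le> C * exp (I t)"
    by (simp add: mult.assoc flip: exp_add)
  then show ?thesis using le[OF t] by (simp add: Y_def I_def)
qed

lemma has_real_derivative_cmod_square:
  assumes "(z has_vector_derivative z') (at t within S)"
  shows "((\<lambda>t. (cmod (z t))\<^sup>2) has_real_derivative 2 * Re (cnj (z t) * z')) (at t within S)"
proof -
  have d: "((\<lambda>t. Re (z t)) has_real_derivative Re z') (at t within S)"
    "((\<lambda>t. Im (z t)) has_real_derivative Im z') (at t within S)"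
    unfolding has_real_derivative_iff_has_vector_derivative
    by (rule bounded_linear.has_vector_derivative[OF bounded_linear_Re assms]
             bounded_linear.has_vector_derivative[OF bounded_linear_Im assms])+
  have "((\<lambda>t. (Re (z t))\<^sup>2 + (Im (z t))\<^sup>2) has_real_derivative 2 * (Re (z t) * Re z' + Im (z t) * Im z')) (at t within S)"
    by (rule DERIV_cong[OF DERIV_add[OF DERIV_power[OF d(1), of 2] DERIV_power[OF d(2), of 2]]]) (simp add: algebra_simps)
  then show ?thesis by (simp add: cmod_power2)
qed

text \<open>Applying the bounded functional \<open>fc\<close> to the integral equation turns it into
  an equation for each coefficient with continuous integrand. Coefficients are therefore
  continuously differentiable, and a finite weighted sum of their squares may be differentiated
  although the full norm may not.\<close>

lemma energy_inequality:
  fixes c F :: "real \<Rightarrow> l2_torus" and \<beta> :: "real \<Rightarrow> real"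
  assumes sol: "\<And>t. t \<in> {0..T} \<Longrightarrow> F integrable_on {0..t} \<and> c t = c0 - integral {0..t} F"
    and cont: "\<And>k. continuous_on {0..T} (\<lambda>t. fc (F t) k)"
    and le: "\<And>t. t \<in> {0..T} \<Longrightarrow> - 2 * (\<Sum>k\<in>K. \<mu> k * Re (cnj (fc (c t) k) * fc (F t) k)) \<le> \<beta> t"
    and \<beta>: "continuous_on {0..T} \<beta>" and t: "t \<in> {0..T}"
  shows "(\<Sum>k\<in>K. \<mu> k * (cmod (fc (c t) k))\<^sup>2) \<le> (\<Sum>k\<in>K. \<mu> k * (cmod (fc c0 k))\<^sup>2) + integral {0..t} \<beta>"
proof -
  have eq: "fc (c t) k = fc c0 k - integral {0..t} (\<lambda>s. fc (F s) k)" if "t \<in> {0..T}" for t k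
    using sol[OF that] integral_linear[OF _ bounded_linear_fc, of F "{0..t}" k] by (simp add: fc_diff o_def)
  have d: "((\<lambda>t. fc (c t) k) has_vector_derivative - fc (F t) k) (at t within {0..T})" if "t \<in> {0..T}" for t k
  proof -
    have "((\<lambda>t. fc c0 k - integral {0..t} (\<lambda>s. fc (F s) k)) has_vector_derivative 0 - fc (F t) k) (at t within {0..T})"
      by (intro has_vector_derivative_diff has_vector_derivative_const integral_has_vector_derivative cont that)
    then show ?thesis
      using has_vector_derivative_transform[OF that eq] by simp
  qed
  have "(\<Sum>k\<in>K. \<mu> k * (cmod (fc (c t) k))\<^sup>2) \<le> (\<Sum>k\<in>K. \<mu> k * (cmod (fc (c 0) k))\<^sup>2) + integral {0..t} \<beta>"
  proof (rule derivative_bound_integral[OF _ _ \<beta> t])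
    fix t assume t: "t \<in> {0..T}"
    show "((\<lambda>t. \<Sum>k\<in>K. \<mu> k * (cmod (fc (c t) k))\<^sup>2) has_real_derivative
        (\<Sum>k\<in>K. \<mu> k * (2 * Re (cnj (fc (c t) k) * - fc (F t) k)))) (at t within {0..T})"
      by (intro DERIV_sum DERIV_cmult has_real_derivative_cmod_square d t)
    have "(\<Sum>k\<in>K. \<mu> k * (2 * Re (cnj (fc (c t) k) * - fc (F t) k))) = - 2 * (\<Sum>k\<in>K. \<mu> k * Re (cnj (fc (c t) k) * fc (F t) k))"
      unfolding sum_distrib_left by (intro sum.cong refl) (simp add: algebra_simps)
    then show "(\<Sum>k\<in>K. \<mu> k * (2 * Re (cnj (fc (c t) k) * - fc (F t) k))) \<le> \<beta> t" using le[OF t] by simp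
  qed
  moreover have "fc (c 0) k = fc c0 k" for k using eq[of 0 k] t by simp
  ultimately show ?thesis by simp
qed

lemma continuous_sobolev_norm:
  assumes "continuous_sobolev T s c"
  shows "continuous_on {0..T} (\<lambda>t. sobolev_norm s (c t))"
  unfolding continuous_on_def
proof
  fix t assume t: "t \<in> {0..T}"
  have lim: "((\<lambda>r. sobolev_norm s (c r - c t)) \<longlongrightarrow> 0) (at t within {0..T})"
    using assms t unfolding continuous_sobolev_def by blast
  show "((\<lambda>t. sobolev_norm s (c t)) \<longlongrightarrow> sobolev_norm s (c t)) (at t within {0..T})"
  proof (rule Lim_null[THEN iffD2], rule Lim_null_comparison[OF _ lim])
    show "\<forall>\<^sub>F r in at t within {0..T}. norm (sobolev_norm s (c r) - sobolev_norm s (c t)) \<le> sobolev_norm s (c r - c t)"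
      using assms t unfolding continuous_sobolev_def
      by (auto simp: eventually_at_filter intro!: always_eventually sobolev_norm_triangle)
  qed
qed

lemma continuous_sobolev_L2:
  assumes "continuous_sobolev T s c" shows "continuous_on {0..T} c"
  unfolding continuous_on_def
proof
  fix t assume t: "t \<in> {0..T}"
  have lim: "((\<lambda>r. sobolev_norm s (c r - c t)) \<longlongrightarrow> 0) (at t within {0..T})"
    using assms t unfolding continuous_sobolev_def by blast
  show "(c \<longlongrightarrow> c t) (at t within {0..T})"
    by (rule Lim_null[THEN iffD2], rule Lim_null_comparison[OF _ lim])
       (auto intro!: always_eventually norm_le_sobolev_norm)
qed

lemma velocity_speed:
  assumes a: "\<alpha> > 0" and th: "\<omega> - f \<in> sobolev 2"
  shows "l2b (\<lambda>l. lam l ^ 3 * speed (fc (fst (velocity \<alpha> f \<omega>))) (fc (snd (velocity \<alpha> f \<omega>))) l) (2 * Cvel \<alpha> * norm (\<omega> - f))"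
proof (rule l2b_mono[OF l2b_fc])
  show "0 \<le> 2 * Cvel \<alpha>" using a by (simp add: Cvel_def)
  fix l
  show "\<bar>lam l ^ 3 * speed (fc (fst (velocity \<alpha> f \<omega>))) (fc (snd (velocity \<alpha> f \<omega>))) l\<bar> \<le> 2 * Cvel \<alpha> * \<bar>cmod (fc (\<omega> - f) l)\<bar>"
    using velocity_bound[OF a th, of l] by (simp add: distrib_left abs_mult)
qed

lemma l2b_remove_lam:
  assumes "l2b (\<lambda>l. lam l ^ 3 * x l) X" shows "l2b x X"
proof -
  have "l2b x (1 * X)"
  proof (rule l2b_mono[OF assms])
    fix l
    have "1 * \<bar>x l\<bar> \<le> lam l ^ 3 * \<bar>x l\<bar>" by (intro mult_right_mono one_le_power lam_ge_1) auto
    then show "\<bar>x l\<bar> \<le> 1 * \<bar>lam l ^ 3 * x l\<bar>" by (simp add: abs_mult)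
  qed simp
  then show ?thesis by simp
qed

text \<open>
  The velocity is linear in \<open>\<omega> - f\<close>, so a difference of velocities is the velocity for \<open>f = \<omega>'\<close>.
\<close>

lemma velocity_diff:
  assumes a: "\<alpha> > 0" and th: "\<omega> - f \<in> sobolev 2" "\<omega>' - f \<in> sobolev 2"
  shows "l2b (\<lambda>l. cmod (fc (fst (velocity \<alpha> f \<omega>)) l - fc (fst (velocity \<alpha> f \<omega>')) l) +
    cmod (fc (snd (velocity \<alpha> f \<omega>)) l - fc (snd (velocity \<alpha> f \<omega>')) l)) (2 * Cvel \<alpha> * norm (\<omega> - \<omega>'))"
proof -
  have d: "\<omega> - \<omega>' \<in> sobolev 2" using sobolev_diff[OF th] by simp
  have "fc (fst (velocity \<alpha> f \<omega>)) l - fc (fst (velocity \<alpha> f \<omega>')) l = fc (fst (velocity \<alpha> \<omega>' \<omega>)) l"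
    "fc (snd (velocity \<alpha> f \<omega>)) l - fc (snd (velocity \<alpha> f \<omega>')) l = fc (snd (velocity \<alpha> \<omega>' \<omega>)) l" for l
    unfolding fc_velocity[OF a th(1)] fc_velocity[OF a th(2)] fc_velocity[OF a d]
    by (simp_all add: fc_diff diff_divide_distrib[symmetric] algebra_simps add_divide_distrib[symmetric]
        del: of_real_mult of_real_add)
  then show ?thesis using l2b_remove_lam[OF velocity_speed[OF a d]] by simp
qed

lemma has_sum_divergence:
  assumes g: "g \<in> sobolev 1" and M: "l2b (\<lambda>l. lam l ^ 3 * speed (fc u1) (fc u2) l) M"
  shows "(adv_term (fc u1) (fc u2) (fc g) k has_sum fc (divergence (mult_vec g (u1, u2))) k) UNIV"
proof -
  have l: "l1b (\<lambda>l. lam l * speed (fc u1) (fc u2) l) (4 * M)"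
    by (rule l1b_of_l2b) (use M in \<open>simp add: power2_eq_square power3_eq_cube mult.assoc\<close>)
  have "l1b (\<lambda>k. lam k * cmod (fc u1 k)) (1 * (4 * M))" "l1b (\<lambda>k. lam k * cmod (fc u2 k)) (1 * (4 * M))"
    by (rule l1b_mono[OF l]; simp add: abs_mult distrib_left)+
  from fc_divergence[OF g this] show ?thesis unfolding adv_term_def .
qed

section \<open>The sup norm of the gradient of the buoyancy\<close>

lemma l1b_infsum_le:
  assumes "l1b z Z" "\<And>k. 0 \<le> z k" shows "infsum z UNIV \<le> Z"
proof (rule infsum_le_finite_sums)
  show "z summable_on UNIV" using l1b_summable[OF assms(1)] assms(2) by simp
  show "sum z F \<le> Z" if "finite F" for F
    using assms that unfolding l1b_def by (simp add: abs_of_nonneg)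
qed

text \<open>The product of \<open>2 * pi\<close> for the derivative, 4 from
  \<open>l1b_of_l2b\<close> and 81 from \<open>l2b_sobolev\<close>.\<close>

definition Cgrad :: real where "Cgrad = 648 * pi"

lemma grad_l1:
  assumes b: "b \<in> sobolev 3" and mn: "m + n = 1"
  shows "l1 (fc (weak_deriv m n b))" "AE p in torus. \<bar>repr (weak_deriv m n b) p\<bar> \<le> Cgrad * sobolev_norm 3 b"
proof -
  have "l2b (\<lambda>k. (lam k)\<^sup>2 * (lam k * cmod (fc b k))) (81 * sobolev_norm 3 b)"
    using l2b_sobolev[OF b] by (simp add: power2_eq_square power3_eq_cube mult.assoc)
  from l1b_of_l2b[OF this] have "l1b (\<lambda>k. lam k * cmod (fc b k)) (324 * sobolev_norm 3 b)" by simp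
  then have l: "l1b (\<lambda>k. cmod (fc (weak_deriv m n b) k)) (2 * pi * (324 * sobolev_norm 3 b))"
  proof (rule l1b_mono)
    fix k
    have "cmod (dsym m n k) \<le> 2 * pi * lam k" using norm_dsym_le[of m n k] mn by simp
    then show "\<bar>cmod (fc (weak_deriv m n b) k)\<bar> \<le> 2 * pi * \<bar>lam k * cmod (fc b k)\<bar>"
      using sobolevD[OF b, of m n k] mn by (simp add: norm_mult abs_mult mult_right_mono flip: mult.assoc)
  qed simp
  show s: "l1 (fc (weak_deriv m n b))" using l1b_summable[OF l] by simp
  have "(\<Sum>\<^sub>\<infinity>k. cmod (fc (weak_deriv m n b) k)) \<le> 2 * pi * (324 * sobolev_norm 3 b)"
    by (rule l1b_infsum_le[OF l]) simp
  then have le: "(\<Sum>\<^sub>\<infinity>k. cmod (fc (weak_deriv m n b) k)) \<le> Cgrad * sobolev_norm 3 b" by (simp add: Cgrad_def)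
  show "AE p in torus. \<bar>repr (weak_deriv m n b) p\<bar> \<le> Cgrad * sobolev_norm 3 b"
    using repr_bound[OF s] by eventually_elim (use le in linarith)
qed

abbreviation grad_sup :: "l2_torus \<Rightarrow> real" where
  "grad_sup b \<equiv> enn2real (Linf_norm (grad b))"

lemma measurable_grad:
  "(\<lambda>p. ennreal (norm (repr (fst (grad b)) p, repr (snd (grad b)) p))) \<in> borel_measurable torus"
  unfolding norm_prod_def by measurable

text \<open>First derivatives of a W^{3,2} function have absolutely convergent Fourier series and
  are bounded. Finiteness matters because \<open>enn2real\<close> sends infinity to 0; the first
  conclusion says that \<open>grad_sup\<close> is the genuine norm.\<close>

lemma Linf_norm_grad:
  assumes b: "b \<in> sobolev 3"
  shows "Linf_norm (grad b) = ennreal (grad_sup b)"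
    "AE p in torus. norm (repr (weak_deriv 1 0 b) p, repr (weak_deriv 0 1 b) p) \<le> grad_sup b"
    "grad_sup b \<le> 2 * Cgrad * sobolev_norm 3 b"
proof -
  have C: "0 \<le> 2 * Cgrad * sobolev_norm 3 b" by (simp add: Cgrad_def sobolev_norm_nonneg)
  have gx: "AE p in torus. \<bar>repr (weak_deriv 1 0 b) p\<bar> \<le> Cgrad * sobolev_norm 3 b"
    and gy: "AE p in torus. \<bar>repr (weak_deriv 0 1 b) p\<bar> \<le> Cgrad * sobolev_norm 3 b"
    by (intro grad_l1(2)[OF b]; simp)+
  have le: "Linf_norm (grad b) \<le> ennreal (2 * Cgrad * sobolev_norm 3 b)"
    unfolding Linf_norm_def
  proof (rule esssup_I[OF measurable_grad])
    show "AE p in torus. ennreal (norm (repr (fst (grad b)) p, repr (snd (grad b)) p)) \<le> ennreal (2 * Cgrad * sobolev_norm 3 b)"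
      using gx gy
    proof eventually_elim
      case (elim p)
      have "norm (repr (fst (grad b)) p, repr (snd (grad b)) p) \<le> \<bar>repr (weak_deriv 1 0 b) p\<bar> + \<bar>repr (weak_deriv 0 1 b) p\<bar>"
        using norm_Pair_le[of "repr (weak_deriv 1 0 b) p" "repr (weak_deriv 0 1 b) p"] by (simp add: grad_def)
      then show ?case using elim by (intro ennreal_leI) simp
    qed
  qed
  then have fin: "Linf_norm (grad b) < top" using le_less_trans ennreal_less_top by blast
  then show e: "Linf_norm (grad b) = ennreal (grad_sup b)" by simp
  show "grad_sup b \<le> 2 * Cgrad * sobolev_norm 3 b"
    using enn2real_mono[OF le] C by simp
  have "AE p in torus. ennreal (norm (repr (fst (grad b)) p, repr (snd (grad b)) p)) \<le> Linf_norm (grad b)"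
    unfolding Linf_norm_def by (rule esssup_AE)
  then show "AE p in torus. norm (repr (weak_deriv 1 0 b) p, repr (weak_deriv 0 1 b) p) \<le> grad_sup b"
  proof eventually_elim
    case (elim p)
    then have "ennreal (norm (repr (fst (grad b)) p, repr (snd (grad b)) p)) \<le> ennreal (grad_sup b)"
      using e by (rule ord_le_eq_trans)
    then show ?case by (simp add: grad_def)
  qed
qed

lemma grad_sup_le:
  assumes b: "b \<in> sobolev 3" and c: "c \<in> sobolev 3"
  shows "grad_sup b \<le> grad_sup c + 2 * Cgrad * sobolev_norm 3 (b - c)"
proof -
  have bc: "b - c \<in> sobolev 3" by (rule sobolev_diff[OF b c])
  define R where "R = grad_sup c + 2 * Cgrad * sobolev_norm 3 (b - c)"
  have R: "0 \<le> R" by (simp add: R_def Cgrad_def sobolev_norm_nonneg)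
  have "Linf_norm (grad b) \<le> ennreal R"
    unfolding Linf_norm_def
  proof (rule esssup_I[OF measurable_grad])
    have x: "AE p in torus. repr (weak_deriv 1 0 (b - c)) p = repr (weak_deriv 1 0 b) p - repr (weak_deriv 1 0 c) p"
      and y: "AE p in torus. repr (weak_deriv 0 1 (b - c)) p = repr (weak_deriv 0 1 b) p - repr (weak_deriv 0 1 c) p"
      using repr_diff by (simp_all add: weak_deriv_diff[OF b c])
    show "AE p in torus. ennreal (norm (repr (fst (grad b)) p, repr (snd (grad b)) p)) \<le> ennreal R"
      using x y Linf_norm_grad(2)[OF c] Linf_norm_grad(2)[OF bc]
    proof eventually_elim
      case (elim p)
      have "norm (repr (fst (grad b)) p, repr (snd (grad b)) p) =
          norm ((repr (weak_deriv 1 0 c) p, repr (weak_deriv 0 1 c) p) + (repr (weak_deriv 1 0 (b - c)) p, repr (weak_deriv 0 1 (b - c)) p))"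
        using elim by (simp add: grad_def)
      also have "\<dots> \<le> grad_sup c + grad_sup (b - c)"
        by (rule order.trans[OF norm_triangle_ineq]) (intro add_mono elim)
      also have "\<dots> \<le> R" using Linf_norm_grad(3)[OF bc] by (simp add: R_def)
      finally show ?case by (rule ennreal_leI)
    qed
  qed
  from enn2real_mono[OF this] show ?thesis using R by (simp add: R_def)
qed

text \<open>The sup norm of the gradient is Lipschitz for the W^{3,2} norm by
  \<open>grad_sup_le\<close>. Continuity in time makes it an admissible rate in
  \<open>Gronwall\<close>.\<close>

lemma continuous_grad_sup:
  assumes "continuous_sobolev T 3 c"
  shows "continuous_on {0..T} (\<lambda>t. grad_sup (c t))"
  unfolding continuous_on_def
proof
  fix t assume t: "t \<in> {0..T}"
  have lim: "((\<lambda>r. sobolev_norm 3 (c r - c t)) \<longlongrightarrow> 0) (at t within {0..T})"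
    and s: "\<And>r. r \<in> {0..T} \<Longrightarrow> c r \<in> sobolev 3"
    using assms t unfolding continuous_sobolev_def by blast+
  have lim': "((\<lambda>r. 2 * Cgrad * sobolev_norm 3 (c r - c t)) \<longlongrightarrow> 0) (at t within {0..T})"
    using tendsto_mult[OF tendsto_const[of "2 * Cgrad"] lim] by simp
  show "((\<lambda>t. grad_sup (c t)) \<longlongrightarrow> grad_sup (c t)) (at t within {0..T})"
  proof (rule Lim_null[THEN iffD2], rule Lim_null_comparison[OF _ lim'])
    have "norm (grad_sup (c r) - grad_sup (c t)) \<le> 2 * Cgrad * sobolev_norm 3 (c r - c t)" if "r \<in> {0..T}" for r
      using grad_sup_le[OF s[OF that] s[OF t]] grad_sup_le[OF s[OF t] s[OF that]]
        sobolev_norm_minus_commute[OF s[OF t] s[OF that]] by simp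
    then show "\<forall>\<^sub>F r in at t within {0..T}. norm (grad_sup (c r) - grad_sup (c t)) \<le> 2 * Cgrad * sobolev_norm 3 (c r - c t)"
      by (auto simp: eventually_at_filter intro!: always_eventually)
  qed
qed

section \<open>The weighted energy method and continuity of the coefficients in time\<close>

lemma norm_mult_L2_bounded:
  assumes "AE p in torus. \<bar>repr g p\<bar> \<le> A" "0 \<le> A" "square_integrable (\<lambda>p. repr f p * repr g p)"
  shows "norm (mult_L2 f g) \<le> A * norm f"
proof -
  have "(norm (mult_L2 f g))\<^sup>2 = (LINT p|torus. (repr f p * repr g p)\<^sup>2)"
    unfolding mult_L2_def by (rule norm_to_L2[OF assms(3)])
  also have "\<dots> \<le> (LINT p|torus. A\<^sup>2 * (repr f p)\<^sup>2)"
  proof (rule integral_mono_AE)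
    show "integrable torus (\<lambda>p. (repr f p * repr g p)\<^sup>2)" using assms(3) by (simp add: square_integrable_def)
    show "integrable torus (\<lambda>p. A\<^sup>2 * (repr f p)\<^sup>2)"
      using square_integrable_repr[of f] by (simp add: square_integrable_def)
    show "AE p in torus. (repr f p * repr g p)\<^sup>2 \<le> A\<^sup>2 * (repr f p)\<^sup>2"
      using assms(1)
    proof eventually_elim
      case (elim p)
      from power_mono[OF this, of 2] have "(repr g p)\<^sup>2 \<le> A\<^sup>2" by simp
      then have "(repr g p)\<^sup>2 * (repr f p)\<^sup>2 \<le> A\<^sup>2 * (repr f p)\<^sup>2" by (rule mult_right_mono) simp
      then show ?case by (simp only: power_mult_distrib mult.commute)
    qed
  qed
  also have "\<dots> = (A * norm f)\<^sup>2" by (simp add: power_mult_distrib norm_repr)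
  finally show ?thesis by (rule power2_le_imp_le) (use assms(2) in simp)
qed

text \<open>The common part of the two top-order bounds. Since the rate does not depend on
  \<open>N\<close>, the truncated balances pass to the limit and bound the weighted l2 norm;
  \<open>sobolev_norm_le\<close> converts this into an integral inequality for Gronwall. Working
  with 1 plus the squared norm lets source terms that are linear in the norm fit the same
  pattern.\<close>

lemma sobolev_energy:
  assumes s: "continuous_sobolev T s c"
    and sol: "\<And>t. t \<in> {0..T} \<Longrightarrow> F integrable_on {0..t} \<and> c t = c0 - integral {0..t} F"
    and cont: "\<And>k. continuous_on {0..T} (\<lambda>t. fc (F t) k)"
    and le: "\<And>N t. N > 0 \<Longrightarrow> t \<in> {0..T} \<Longrightarrow>
      - 2 * (\<Sum>k | lam k < N. lam k ^ (2 * s) * cutoff N k * Re (cnj (fc (c t) k) * fc (F t) k)) \<le>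
        \<kappa> * (1 + (sobolev_norm s (c t))\<^sup>2)"
    and \<kappa>: "0 \<le> \<kappa>" and t: "t \<in> {0..T}"
  shows "1 + (sobolev_norm s (c t))\<^sup>2 \<le>
    (1 + (Csob s)\<^sup>2 * (3 * 3 ^ s * sobolev_norm s c0)\<^sup>2) * exp ((Csob s)\<^sup>2 * \<kappa> * t)"
proof -
  define y where "y t = 1 + (sobolev_norm s (c t))\<^sup>2" for t
  define X0 where "X0 = (3 * 3 ^ s * sobolev_norm s c0)\<^sup>2"
  have cs: "c t \<in> sobolev s" if "t \<in> {0..T}" for t using s that unfolding continuous_sobolev_def by blast
  \<comment> \<open>The initial class inherits its regularity from the solution at time 0, where the
    integral vanishes.\<close>
  have c0: "c0 \<in> sobolev s" using cs[of 0] sol[of 0] t by simp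
  have y: "continuous_on {0..T} y"
    unfolding y_def by (intro continuous_intros continuous_sobolev_norm s)
  have \<beta>: "continuous_on {0..T} (\<lambda>t. \<kappa> * y t)" by (intro continuous_intros y)
  have bound: "(sobolev_norm s (c t))\<^sup>2 \<le> (Csob s)\<^sup>2 * (X0 + integral {0..t} (\<lambda>s. \<kappa> * y s))" if t: "t \<in> {0..T}" for t
  proof -
    define R where "R = X0 + integral {0..t} (\<lambda>s. \<kappa> * y s)"
    have iy: "0 \<le> integral {0..t} (\<lambda>s. \<kappa> * y s)"
      using \<kappa> t by (intro integral_nonneg integrable_continuous_interval continuous_on_subset[OF \<beta>])
        (auto simp: y_def)
    then have R: "0 \<le> R" by (simp add: R_def X0_def)
    have cut: "(\<Sum>k | lam k < N. (lam k ^ (2 * s) * (cmod (fc (c t) k))\<^sup>2) * cutoff N k) \<le> R" if N: "N > 0" for N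
    proof -
      have "(\<Sum>k | lam k < N. lam k ^ (2 * s) * cutoff N k * (cmod (fc (c t) k))\<^sup>2) \<le>
          (\<Sum>k | lam k < N. lam k ^ (2 * s) * cutoff N k * (cmod (fc c0 k))\<^sup>2) + integral {0..t} (\<lambda>s. \<kappa> * y s)"
        using le[OF N] by (intro energy_inequality[OF sol cont _ \<beta> t]) (auto simp: y_def)
      also have "(\<Sum>k | lam k < N. lam k ^ (2 * s) * cutoff N k * (cmod (fc c0 k))\<^sup>2) \<le>
          (\<Sum>k | lam k < N. (lam k ^ s * cmod (fc c0 k))\<^sup>2)"
      proof (rule sum_mono)
        fix k
        have "lam k ^ (2 * s) * cutoff N k * (cmod (fc c0 k))\<^sup>2 \<le> lam k ^ (2 * s) * 1 * (cmod (fc c0 k))\<^sup>2"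
          using cutoff_bounds[OF N, of k] by (intro mult_right_mono mult_left_mono) auto
        then show "lam k ^ (2 * s) * cutoff N k * (cmod (fc c0 k))\<^sup>2 \<le> (lam k ^ s * cmod (fc c0 k))\<^sup>2"
          by (simp add: power_mult_distrib power_mult[symmetric] mult.commute[of s])
      qed
      also have "\<dots> \<le> X0"
        using l2b_sobolev[OF c0] finite_lam_less unfolding l2b_def X0_def by blast
      finally show ?thesis by (simp add: R_def mult_ac)
    qed
    have "(\<Sum>k\<in>A. lam k ^ (2 * s) * (cmod (fc (c t) k))\<^sup>2) \<le> R" if "finite A" for A
    proof (rule cutoff_limit[OF _ _ that])
      show "(\<Sum>k | lam k < real (Suc n). lam k ^ (2 * s) * (cmod (fc (c t) k))\<^sup>2 * cutoff (real (Suc n)) k)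
          \<le> R + 0 / real (Suc n)" for n
        using cut[of "real (Suc n)"] by (simp only: div_0 add_0_right of_nat_0_less_iff zero_less_Suc simp_thms)
    qed simp
    then have "l2b (\<lambda>k. lam k ^ s * cmod (fc (c t) k)) (sqrt R)"
      unfolding l2b_def using R by (simp add: power_mult_distrib power_mult[symmetric] mult.commute[of s])
    from sobolev_norm_le[OF cs[OF t] this] have "sobolev_norm s (c t) \<le> Csob s * sqrt R" .
    from power_mono[OF this sobolev_norm_nonneg, of 2] show ?thesis using R by (simp add: power_mult_distrib R_def)
  qed
  have "y t \<le> (1 + (Csob s)\<^sup>2 * X0) * exp (integral {0..t} (\<lambda>_. (Csob s)\<^sup>2 * \<kappa>))"
  proof (rule Gronwall[OF y _ _ _ t])
    show "y t \<le> 1 + (Csob s)\<^sup>2 * X0 + integral {0..t} (\<lambda>r. (Csob s)\<^sup>2 * \<kappa> * y r)" if "t \<in> {0..T}" for t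
    proof -
      have "integral {0..t} (\<lambda>r. (Csob s)\<^sup>2 * \<kappa> * y r) = (Csob s)\<^sup>2 * integral {0..t} (\<lambda>r. \<kappa> * y r)"
        by (simp only: mult.assoc integral_mult_right)
      moreover have "y t = 1 + (sobolev_norm s (c t))\<^sup>2" by (simp add: y_def)
      ultimately show ?thesis using bound[OF that] unfolding distrib_left by linarith
    qed
  qed (use \<kappa> in auto)
  then show ?thesis using t by (simp add: y_def X0_def mult_ac)
qed

text \<open>The path \<open>w\<close> controls the change of the velocity: it is the vorticity for
  the velocity of the solution, while \<open>C = 0\<close> covers the steady field.\<close>

lemma adv_continuous:
  fixes c v1 v2 w :: "real \<Rightarrow> l2_torus"
  assumes c: "continuous_on S c" and w: "continuous_on S w"
    and hs: "\<And>t. t \<in> S \<Longrightarrow> (adv_term (fc (v1 t)) (fc (v2 t)) (fc (c t)) k has_sum a t) UNIV"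
    and D: "\<And>s t. s \<in> S \<Longrightarrow> t \<in> S \<Longrightarrow>
      l2b (\<lambda>l. cmod (fc (v1 s) l - fc (v1 t) l) + cmod (fc (v2 s) l - fc (v2 t) l)) (C * norm (w s - w t))"
    and U: "\<And>t. t \<in> S \<Longrightarrow> l2b (speed (fc (v1 t)) (fc (v2 t))) (V t)"
  shows "continuous_on S a"
  unfolding continuous_on_def
proof
  fix t assume t: "t \<in> S"
  have ct: "(c \<longlongrightarrow> c t) (at t within S)" and wt: "(w \<longlongrightarrow> w t) (at t within S)"
    using c w t unfolding continuous_on_def by blast+
  have "((\<lambda>s. 2 * pi * lam k * (C * norm (w s - w t) * norm (c s) + V t * norm (c s - c t))) \<longlongrightarrow>
      2 * pi * lam k * (C * norm (w t - w t) * norm (c t) + V t * norm (c t - c t))) (at t within S)"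
    by (intro tendsto_intros ct wt)
  then have lim: "((\<lambda>s. 2 * pi * lam k * (C * norm (w s - w t) * norm (c s) + V t * norm (c s - c t))) \<longlongrightarrow> 0) (at t within S)"
    by simp
  show "(a \<longlongrightarrow> a t) (at t within S)"
  proof (rule Lim_null[THEN iffD2], rule Lim_null_comparison[OF _ lim])
    have "cmod (a s - a t) \<le> 2 * pi * lam k * (C * norm (w s - w t) * norm (c s) + V t * norm (c s - c t))" if s: "s \<in> S" for s
      using adv_diff_bound[OF hs[OF s] hs[OF t] D[OF s t] l2b_fc U[OF t], of "norm (c s - c t)"] l2b_fc[of "c s - c t"]
      by (simp add: fc_diff)
    then show "\<forall>\<^sub>F s in at t within S. norm (a s - a t) \<le> 2 * pi * lam k * (C * norm (w s - w t) * norm (c s) + V t * norm (c s - c t))"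
      by (auto simp: eventually_at_filter intro!: always_eventually)
  qed
qed

lemma weighted_inner_le:
  assumes N: "N > 0"
  shows "\<bar>\<Sum>k | lam k < N. cutoff N k * Re (cnj (fc g k) * fc h k)\<bar> \<le> norm g * norm h"
proof -
  have "\<bar>\<Sum>k | lam k < N. cutoff N k * Re (cnj (fc g k) * fc h k)\<bar> \<le> (\<Sum>k | lam k < N. \<bar>cmod (fc g k) * cmod (fc h k)\<bar>)"
  proof (rule order.trans[OF sum_abs], rule sum_mono)
    fix k
    have "\<bar>Re (cnj (fc g k) * fc h k)\<bar> \<le> cmod (fc g k) * cmod (fc h k)"
      using abs_Re_le_cmod[of "cnj (fc g k) * fc h k"] by (simp add: norm_mult)
    then have "\<bar>cutoff N k\<bar> * \<bar>Re (cnj (fc g k) * fc h k)\<bar> \<le> 1 * (cmod (fc g k) * cmod (fc h k))"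
      using cutoff_bounds[OF N, of k] by (intro mult_mono) auto
    then show "\<bar>cutoff N k * Re (cnj (fc g k) * fc h k)\<bar> \<le> \<bar>cmod (fc g k) * cmod (fc h k)\<bar>"
      by (simp add: abs_mult)
  qed
  also have "\<dots> \<le> norm g * norm h"
    using l1b_mult[OF l2b_fc[of g] l2b_fc[of h]] finite_lam_less[of N] unfolding l1b_def by blast
  finally show ?thesis .
qed

section \<open>A priori bounds for solutions\<close>

locale tqg_solution =
  fixes \<alpha> :: real and f uh1 uh2 b0 \<omega>0 :: l2_torus and b \<omega> :: "real \<Rightarrow> l2_torus" and T :: real
  assumes alpha: "\<alpha> > 0" and f: "f \<in> sobolev 2" and uh: "uh1 \<in> sobolev 3" "uh2 \<in> sobolev 3"
    and uhdf: "div_free (fc uh1) (fc uh2)"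
    and sol: "local_strong_solution \<alpha> (uh1, uh2) f b0 \<omega>0 b \<omega> T"
begin

definition "u1 t = fst (velocity \<alpha> f (\<omega> t))"
definition "u2 t = snd (velocity \<alpha> f (\<omega> t))"
definition "Fb t = divergence (mult_vec (b t) (u1 t, u2 t))"
definition "Fh t = divergence (mult_vec (b t) (uh1, uh2))"
definition "Fw t = divergence (mult_vec (\<omega> t) (u1 t, u2 t))"
definition "Gw t = divergence (mult_vec (\<omega> t - b t) (u1 t, u2 t)) + Fh t"
definition "Mh = 81 * sobolev_norm 3 uh1 + 81 * sobolev_norm 3 uh2"

lemma T_pos: "T > 0" and continuous_b: "continuous_sobolev T 3 b" and continuous_w: "continuous_sobolev T 2 \<omega>"
  and b_eq: "t \<in> {0..T} \<Longrightarrow> Fb integrable_on {0..t} \<and> b t = b0 - integral {0..t} Fb"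
  and w_eq: "t \<in> {0..T} \<Longrightarrow> Gw integrable_on {0..t} \<and> \<omega> t = \<omega>0 - integral {0..t} Gw"
  using sol unfolding local_strong_solution_def Let_def Fb_def[abs_def] Gw_def[abs_def] Fh_def u1_def u2_def prod.collapse
  by blast+

lemma b_sobolev: "t \<in> {0..T} \<Longrightarrow> b t \<in> sobolev 3" and w_sobolev: "t \<in> {0..T} \<Longrightarrow> \<omega> t \<in> sobolev 2"
  using continuous_b continuous_w unfolding continuous_sobolev_def by blast+

lemma b_sobolev_1: "t \<in> {0..T} \<Longrightarrow> b t \<in> sobolev 1" and w_sobolev_1: "t \<in> {0..T} \<Longrightarrow> \<omega> t \<in> sobolev 1"
  using b_sobolev w_sobolev sobolev_mono[of 1 3] sobolev_mono[of 1 2] by auto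

lemma w_diff_sobolev: "t \<in> {0..T} \<Longrightarrow> \<omega> t - f \<in> sobolev 2"
  by (intro sobolev_diff w_sobolev f)

lemma speed_bound_u:
  "t \<in> {0..T} \<Longrightarrow> l2b (\<lambda>l. lam l ^ 3 * speed (fc (u1 t)) (fc (u2 t)) l) (2 * Cvel \<alpha> * norm (\<omega> t - f))"
  unfolding u1_def u2_def by (rule velocity_speed[OF alpha w_diff_sobolev])

lemma div_free_u: "t \<in> {0..T} \<Longrightarrow> div_free (fc (u1 t)) (fc (u2 t))"
  unfolding u1_def u2_def div_free_def using velocity_div_free[OF alpha w_diff_sobolev] by blast

lemma speed_bound_uh: "l2b (\<lambda>l. lam l ^ 3 * speed (fc uh1) (fc uh2) l) Mh"
  using l2b_add[OF l2b_sobolev[OF uh(1)] l2b_sobolev[OF uh(2)]]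
  unfolding Mh_def by (simp add: distrib_left)

lemma has_sum_Fb: "t \<in> {0..T} \<Longrightarrow> (adv_term (fc (u1 t)) (fc (u2 t)) (fc (b t)) k has_sum fc (Fb t) k) UNIV"
  unfolding Fb_def by (rule has_sum_divergence[OF b_sobolev_1 speed_bound_u])

lemma has_sum_Fh: "t \<in> {0..T} \<Longrightarrow> (adv_term (fc uh1) (fc uh2) (fc (b t)) k has_sum fc (Fh t) k) UNIV"
  unfolding Fh_def by (rule has_sum_divergence[OF b_sobolev_1 speed_bound_uh])

lemma has_sum_Fw: "t \<in> {0..T} \<Longrightarrow> (adv_term (fc (u1 t)) (fc (u2 t)) (fc (\<omega> t)) k has_sum fc (Fw t) k) UNIV"
  unfolding Fw_def by (rule has_sum_divergence[OF w_sobolev_1 speed_bound_u])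

text \<open>Linearity of the flux is read off from the uniqueness of the convolution sums. The split
  separates the transport \<open>Fw\<close>, which cancels, from the sources \<open>Fb\<close> and
  \<open>Fh\<close>.\<close>

lemma fc_Gw: assumes t: "t \<in> {0..T}" shows "fc (Gw t) k = fc (Fw t) k - fc (Fb t) k + fc (Fh t) k"
proof -
  have "(adv_term (fc (u1 t)) (fc (u2 t)) (fc (\<omega> t - b t)) k has_sum
      fc (divergence (mult_vec (\<omega> t - b t) (u1 t, u2 t))) k) UNIV"
    by (rule has_sum_divergence[OF sobolev_diff[OF w_sobolev_1[OF t] b_sobolev_1[OF t]] speed_bound_u[OF t]])
  moreover have "((\<lambda>j. adv_term (fc (u1 t)) (fc (u2 t)) (fc (\<omega> t)) k j + - adv_term (fc (u1 t)) (fc (u2 t)) (fc (b t)) k j)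
      has_sum (fc (Fw t) k + - fc (Fb t) k)) UNIV"
    using has_sum_Fb[OF t, of k] by (intro has_sum_add has_sum_Fw[OF t]) (simp add: has_sum_uminus)
  moreover have "adv_term (fc (u1 t)) (fc (u2 t)) (fc (\<omega> t)) k j + - adv_term (fc (u1 t)) (fc (u2 t)) (fc (b t)) k j =
      adv_term (fc (u1 t)) (fc (u2 t)) (fc (\<omega> t - b t)) k j" for j
    by (simp add: adv_term_def fc_diff algebra_simps)
  ultimately have "fc (divergence (mult_vec (\<omega> t - b t) (u1 t, u2 t))) k = fc (Fw t) k + - fc (Fb t) k"
    using has_sum_unique by simp
  then show ?thesis by (simp add: Gw_def fc_add)
qed

lemma continuous_L2: "continuous_on {0..T} b" "continuous_on {0..T} \<omega>"
  by (rule continuous_sobolev_L2[OF continuous_b], rule continuous_sobolev_L2[OF continuous_w])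

lemma continuous_fc_transport:
  assumes c: "continuous_on {0..T} c"
    and hs: "\<And>t. t \<in> {0..T} \<Longrightarrow> (adv_term (fc (u1 t)) (fc (u2 t)) (fc (c t)) k has_sum a t) UNIV"
  shows "continuous_on {0..T} a"
proof (rule adv_continuous[OF c continuous_L2(2) hs])
  show "l2b (speed (fc (u1 t)) (fc (u2 t))) (2 * Cvel \<alpha> * norm (\<omega> t - f))" if "t \<in> {0..T}" for t
    using l2b_remove_lam[OF speed_bound_u[OF that]] .
  show "l2b (\<lambda>l. cmod (fc (u1 s) l - fc (u1 t) l) + cmod (fc (u2 s) l - fc (u2 t) l)) (2 * Cvel \<alpha> * norm (\<omega> s - \<omega> t))"
    if "s \<in> {0..T}" "t \<in> {0..T}" for s t
    unfolding u1_def u2_def by (rule velocity_diff[OF alpha w_diff_sobolev[OF that(1)] w_diff_sobolev[OF that(2)]])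
qed

lemma continuous_fc_Fb: "continuous_on {0..T} (\<lambda>t. fc (Fb t) k)"
  by (rule continuous_fc_transport[OF continuous_L2(1) has_sum_Fb])

lemma continuous_fc_Gw: "continuous_on {0..T} (\<lambda>t. fc (Gw t) k)"
proof -
  have "continuous_on {0..T} (\<lambda>t. fc (Fh t) k)"
  proof (rule adv_continuous[OF continuous_L2(1) continuous_L2(2) has_sum_Fh])
    show "l2b (speed (fc uh1) (fc uh2)) Mh" using l2b_remove_lam[OF speed_bound_uh] .
    show "l2b (\<lambda>l. cmod (fc uh1 l - fc uh1 l) + cmod (fc uh2 l - fc uh2 l)) (0 * norm (\<omega> s - \<omega> t))" for s t
      by (simp add: l2b_def)
  qed
  then have "continuous_on {0..T} (\<lambda>t. fc (Fw t) k - fc (Fb t) k + fc (Fh t) k)"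
    by (intro continuous_intros continuous_fc_Fb continuous_fc_transport[OF continuous_L2(2) has_sum_Fw])
  then show ?thesis by (rule continuous_on_eq) (simp add: fc_Gw)
qed

text \<open>Chosen so that \<open>grad_sup (b t) * Pw\<close> times 1 plus the squared norm of the
  vorticity dominates the source paired with the vorticity.\<close>

definition "Pw = 4 * Cvel \<alpha> + 4 * Cvel \<alpha> * norm f + norm uh1 + norm uh2"

lemma Cvel_nonneg: "0 \<le> Cvel \<alpha>" using alpha by (simp add: Cvel_def)

lemma Pw_nonneg: "0 \<le> Pw" unfolding Pw_def using Cvel_nonneg by simp

lemma norm_u:
  assumes t: "t \<in> {0..T}"
  shows "norm (u1 t) \<le> 2 * Cvel \<alpha> * norm (\<omega> t - f)" "norm (u2 t) \<le> 2 * Cvel \<alpha> * norm (\<omega> t - f)"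
proof -
  note s = l2b_remove_lam[OF speed_bound_u[OF t]]
  have "l2b (\<lambda>k. cmod (fc (u1 t) k)) (1 * (2 * Cvel \<alpha> * norm (\<omega> t - f)))"
    "l2b (\<lambda>k. cmod (fc (u2 t) k)) (1 * (2 * Cvel \<alpha> * norm (\<omega> t - f)))"
    by (rule l2b_mono[OF s]; simp)+
  then show "norm (u1 t) \<le> 2 * Cvel \<alpha> * norm (\<omega> t - f)" "norm (u2 t) \<le> 2 * Cvel \<alpha> * norm (\<omega> t - f)"
    by (auto intro: norm_le_l2b)
qed

text \<open>By incompressibility the net source is the product of \<open>u - uh\<close> with the
  gradient of \<open>b\<close>. Written as a class of pointwise products, it lets the sup norm of
  the gradient be pulled out, which leaves only L2 norms of the velocities.\<close>

lemma source_L2: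
  assumes t: "t \<in> {0..T}"
  obtains h where "\<And>k. fc h k = fc (Fb t) k - fc (Fh t) k"
    "norm h \<le> grad_sup (b t) * (4 * Cvel \<alpha> * (norm (\<omega> t) + norm f) + norm uh1 + norm uh2)"
proof
  let ?x = "weak_deriv 1 0 (b t)" and ?y = "weak_deriv 0 1 (b t)"
  let ?h = "mult_L2 (u1 t - uh1) ?x + mult_L2 (u2 t - uh2) ?y"
  have x: "l1 (fc ?x)" and y: "l1 (fc ?y)" by (rule grad_l1[OF b_sobolev[OF t]]; simp)+
  show "fc ?h k = fc (Fb t) k - fc (Fh t) k" for k
  proof -
    have "((\<lambda>l. fc ?x l * fc (u1 t - uh1) (k - l) + fc ?y l * fc (u2 t - uh2) (k - l)) has_sum fc ?h k) UNIV"
      unfolding fc_add by (intro has_sum_add mult_l1 x y)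
    moreover have "((\<lambda>l. adv_term (fc (u1 t)) (fc (u2 t)) (fc (b t)) k l + - adv_term (fc uh1) (fc uh2) (fc (b t)) k l)
        has_sum (fc (Fb t) k + - fc (Fh t) k)) UNIV"
      using has_sum_Fh[OF t, of k] by (intro has_sum_add has_sum_Fb[OF t]) (simp add: has_sum_uminus)
    moreover have "adv_term (fc (u1 t)) (fc (u2 t)) (fc (b t)) k l + - adv_term (fc uh1) (fc uh2) (fc (b t)) k l =
        fc ?x l * fc (u1 t - uh1) (k - l) + fc ?y l * fc (u2 t - uh2) (k - l)" for l
      unfolding adv_term_def div_free_shift[OF div_free_u[OF t], of k l] div_free_shift[OF uhdf, of k l]
      using sobolevD[OF b_sobolev_1[OF t], of 1 0 l] sobolevD[OF b_sobolev_1[OF t], of 0 1 l]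
      by (simp add: dsym_def fc_diff algebra_simps)
    ultimately show ?thesis using has_sum_unique by simp
  qed
  have A: "0 \<le> grad_sup (b t)" by simp
  have gx: "AE p in torus. \<bar>repr ?x p\<bar> \<le> grad_sup (b t)"
    using Linf_norm_grad(2)[OF b_sobolev[OF t]]
  proof eventually_elim
    case (elim p)
    then show ?case using norm_fst_le[of "repr ?x p" "repr ?y p"] by simp
  qed
  have gy: "AE p in torus. \<bar>repr ?y p\<bar> \<le> grad_sup (b t)"
    using Linf_norm_grad(2)[OF b_sobolev[OF t]]
  proof eventually_elim
    case (elim p)
    then show ?case using norm_snd_le[of "repr ?y p" "repr ?x p"] by simp
  qed
  have "norm ?h \<le> grad_sup (b t) * norm (u1 t - uh1) + grad_sup (b t) * norm (u2 t - uh2)"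
    by (rule order.trans[OF norm_triangle_ineq])
       (intro add_mono norm_mult_L2_bounded gx gy A mult_l1 x y)
  also have "\<dots> = grad_sup (b t) * (norm (u1 t - uh1) + norm (u2 t - uh2))" by (simp add: distrib_left)
  also have "\<dots> \<le> grad_sup (b t) * (4 * Cvel \<alpha> * (norm (\<omega> t) + norm f) + norm uh1 + norm uh2)"
  proof (rule mult_left_mono[OF _ A])
    have "2 * Cvel \<alpha> * norm (\<omega> t - f) \<le> 2 * Cvel \<alpha> * (norm (\<omega> t) + norm f)"
      using Cvel_nonneg by (intro mult_left_mono norm_triangle_ineq4) auto
    then show "norm (u1 t - uh1) + norm (u2 t - uh2) \<le> 4 * Cvel \<alpha> * (norm (\<omega> t) + norm f) + norm uh1 + norm uh2"
      using norm_u[OF t] norm_triangle_ineq4[of "u1 t" uh1] norm_triangle_ineq4[of "u2 t" uh2] by linarith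
  qed
  finally show "norm ?h \<le> grad_sup (b t) * (4 * Cvel \<alpha> * (norm (\<omega> t) + norm f) + norm uh1 + norm uh2)" .
qed

text \<open>For the tapered sums the transport contributes \<open>q t / N\<close>. Its time integral
  is a constant over \<open>N\<close> and is removed by \<open>cutoff_limit\<close> before Gronwall
  is applied, so only the source rate \<open>2 * Pw * grad_sup (b s)\<close> reaches the
  exponent.\<close>

lemma vorticity_L2_bound:
  assumes t: "t \<in> {0..T}"
  shows "1 + (norm (\<omega> t))\<^sup>2 \<le> (1 + (norm \<omega>0)\<^sup>2) * exp (integral {0..t} (\<lambda>s. 2 * Pw * grad_sup (b s)))"
proof -
  define y where "y t = 1 + (norm (\<omega> t))\<^sup>2" for t
  define a where "a s = 2 * Pw * grad_sup (b s)" for s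
  \<comment> \<open>Twice the bound of \<open>transport_estimate_L2\<close>, with the derivative of
    the vorticity bounded through \<open>l2b_sobolev\<close>. Continuity makes it integrable in
    time, whatever its size.\<close>
  define q where "q t = 2 * (8 * pi * (2 * Cvel \<alpha> * norm (\<omega> t - f)) * norm (\<omega> t) * (27 * sobolev_norm 2 (\<omega> t)))" for t
  have cy: "continuous_on {0..T} y" unfolding y_def by (intro continuous_intros continuous_L2)
  have ca: "continuous_on {0..T} a" unfolding a_def by (intro continuous_intros continuous_grad_sup continuous_b)
  have cq: "continuous_on {0..T} q" unfolding q_def by (intro continuous_intros continuous_L2 continuous_sobolev_norm continuous_w)
  have cay: "continuous_on {0..T} (\<lambda>s. a s * y s)" by (intro continuous_intros ca cy)
  have rate: "- 2 * (\<Sum>k | lam k < N. cutoff N k * Re (cnj (fc (\<omega> t) k) * fc (Gw t) k)) \<le> q t / N + a t * y t"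
    if N: "N > 0" and t: "t \<in> {0..T}" for N t
  proof -
    obtain h where h: "\<And>k. fc h k = fc (Fb t) k - fc (Fh t) k"
      "norm h \<le> grad_sup (b t) * (4 * Cvel \<alpha> * (norm (\<omega> t) + norm f) + norm uh1 + norm uh2)"
      using source_L2[OF t] by blast
    define S1 where "S1 = (\<Sum>k | lam k < N. cutoff N k * Re (cnj (fc (\<omega> t) k) * fc (Fw t) k))"
    define S2 where "S2 = (\<Sum>k | lam k < N. cutoff N k * Re (cnj (fc (\<omega> t) k) * fc h k))"
    have split: "(\<Sum>k | lam k < N. cutoff N k * Re (cnj (fc (\<omega> t) k) * fc (Gw t) k)) = S1 - S2"
      unfolding S1_def S2_def sum_subtractf[symmetric]
      by (intro sum.cong refl) (simp add: fc_Gw[OF t] h algebra_simps)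
    have "l2b (\<lambda>k. lam k * cmod (fc (\<omega> t) k)) (1 * (3 * 3 ^ 2 * sobolev_norm 2 (\<omega> t)))"
    proof (rule l2b_mono[OF l2b_sobolev[OF w_sobolev[OF t]]])
      fix k
      have "lam k * cmod (fc (\<omega> t) k) \<le> (lam k)\<^sup>2 * cmod (fc (\<omega> t) k)"
        by (intro mult_right_mono self_le_power lam_ge_1) auto
      then show "\<bar>lam k * cmod (fc (\<omega> t) k)\<bar> \<le> 1 * \<bar>(lam k)\<^sup>2 * cmod (fc (\<omega> t) k)\<bar>" by (simp add: abs_mult)
    qed simp
    then have G1: "l2b (\<lambda>k. lam k * cmod (fc (\<omega> t) k)) (27 * sobolev_norm 2 (\<omega> t))" by simp
    have "\<bar>S1\<bar> \<le> 8 * pi * (2 * Cvel \<alpha> * norm (\<omega> t - f)) * norm (\<omega> t) * (27 * sobolev_norm 2 (\<omega> t)) / N"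
      unfolding S1_def
      by (rule transport_estimate_L2[OF div_free_u[OF t] speed_bound_u[OF t] fc_cnj fc_cnj N l2b_fc G1 has_sum_Fw[OF t]])
    then have 1: "2 * \<bar>S1\<bar> \<le> q t / N" by (simp add: q_def)
    have "\<bar>S2\<bar> \<le> norm (\<omega> t) * norm h" unfolding S2_def by (rule weighted_inner_le[OF N])
    also have "\<dots> \<le> norm (\<omega> t) * (grad_sup (b t) * (4 * Cvel \<alpha> * (norm (\<omega> t) + norm f) + norm uh1 + norm uh2))"
      by (intro mult_left_mono h) simp
    also have "\<dots> = grad_sup (b t) * (4 * Cvel \<alpha> * (norm (\<omega> t))\<^sup>2 + (4 * Cvel \<alpha> * norm f + norm uh1 + norm uh2) * norm (\<omega> t))"
      by (simp add: algebra_simps power2_eq_square)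
    also have "\<dots> \<le> grad_sup (b t) * (4 * Cvel \<alpha> * y t + (4 * Cvel \<alpha> * norm f + norm uh1 + norm uh2) * y t)"
    proof (intro mult_left_mono add_mono)
      \<comment> \<open>From \<open>2 * x \<le> 1 + x\<^sup>2\<close>; the term linear in the norm
        is absorbed in this way.\<close>
      show "norm (\<omega> t) \<le> y t"
        using sum_squares_bound[of 1 "norm (\<omega> t)"] norm_ge_zero[of "\<omega> t"] unfolding y_def by (simp, linarith)
    qed (use Cvel_nonneg in \<open>auto simp: y_def\<close>)
    also have "\<dots> = grad_sup (b t) * (Pw * y t)" by (simp add: Pw_def algebra_simps)
    finally have 2: "2 * \<bar>S2\<bar> \<le> a t * y t" by (simp add: a_def mult_ac)
    have "- 2 * (S1 - S2) \<le> 2 * \<bar>S1\<bar> + 2 * \<bar>S2\<bar>"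
      using abs_ge_minus_self[of S1] abs_ge_self[of S2] unfolding right_diff_distrib by linarith
    also have "\<dots> \<le> q t / N + a t * y t" by (rule add_mono[OF 1 2])
    finally show ?thesis unfolding split .
  qed
  have bound: "(norm (\<omega> t))\<^sup>2 \<le> (norm \<omega>0)\<^sup>2 + integral {0..t} (\<lambda>s. a s * y s)" if t: "t \<in> {0..T}" for t
  proof -
    have sub: "{0..t} \<subseteq> {0..T}" using t by auto
    have ia: "(\<lambda>s. a s * y s) integrable_on {0..t}"
      by (intro integrable_continuous_interval continuous_on_subset[OF cay sub])
    have cut: "(\<Sum>k | lam k < N. (cmod (fc (\<omega> t) k))\<^sup>2 * cutoff N k) \<le>
        ((norm \<omega>0)\<^sup>2 + integral {0..t} (\<lambda>s. a s * y s)) + integral {0..t} q / N" if N: "N > 0" for N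
    proof -
      have "(\<Sum>k | lam k < N. cutoff N k * (cmod (fc (\<omega> t) k))\<^sup>2) \<le>
          (\<Sum>k | lam k < N. cutoff N k * (cmod (fc \<omega>0 k))\<^sup>2) + integral {0..t} (\<lambda>s. q s / N + a s * y s)"
        by (rule energy_inequality[OF w_eq continuous_fc_Gw rate[OF N] _ t])
           (use N in \<open>auto intro!: continuous_intros cq cay\<close>)
      also have "(\<Sum>k | lam k < N. cutoff N k * (cmod (fc \<omega>0 k))\<^sup>2) \<le> (\<Sum>k | lam k < N. 1 * (cmod (fc \<omega>0 k))\<^sup>2)"
        using cutoff_bounds[OF N] by (intro sum_mono mult_right_mono) auto
      also have "\<dots> \<le> (norm \<omega>0)\<^sup>2" using Bessel[OF finite_lam_less] by simp
      also have "integral {0..t} (\<lambda>s. q s / N + a s * y s) = integral {0..t} q / N + integral {0..t} (\<lambda>s. a s * y s)"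
      proof -
        have "(\<lambda>s. q s / N) integrable_on {0..t}"
          by (intro integrable_continuous_interval continuous_intros continuous_on_subset[OF cq sub]) (use N in simp)
        from integral_add[OF this ia] show ?thesis by simp
      qed
      finally show ?thesis by (simp add: mult_ac)
    qed
    have "(\<Sum>k\<in>A. (cmod (fc (\<omega> t) k))\<^sup>2) \<le> (norm \<omega>0)\<^sup>2 + integral {0..t} (\<lambda>s. a s * y s)" if "finite A" for A
      by (rule cutoff_limit[OF _ cut that]) auto
    then show ?thesis using has_sum_le_finite_sums[OF Parseval[of "\<omega> t"]] by blast
  qed
  have "y t \<le> (1 + (norm \<omega>0)\<^sup>2) * exp (integral {0..t} a)"
  proof (rule Gronwall[OF cy ca _ _ t])
    show "0 \<le> a s" for s using Pw_nonneg by (simp add: a_def)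
    show "y s \<le> 1 + (norm \<omega>0)\<^sup>2 + integral {0..s} (\<lambda>s. a s * y s)" if "s \<in> {0..T}" for s
      using bound[OF that] by (simp add: y_def)
  qed
  then show ?thesis by (simp add: y_def a_def[abs_def])
qed

text \<open>The hypothesis on \<open>R\<close> bounds the velocity in W^{3,2}, so
  \<open>transport_estimate\<close> gives a constant rate. The numbers are 672 = 2 * 336 and 6561 =
  81 squared.\<close>

lemma buoyancy_H3_bound:
  assumes R: "\<And>t. t \<in> {0..T} \<Longrightarrow> norm (\<omega> t - f) \<le> R" and t: "t \<in> {0..T}"
  shows "1 + (sobolev_norm 3 (b t))\<^sup>2 \<le>
    (1 + (Csob 3)\<^sup>2 * (3 * 3 ^ 3 * sobolev_norm 3 b0)\<^sup>2) *
      exp ((Csob 3)\<^sup>2 * (672 * pi * (2 * Cvel \<alpha> * R) * 6561) * t)"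
proof (rule sobolev_energy[OF continuous_b b_eq continuous_fc_Fb _ _ t])
  have R0: "0 \<le> R" using R[OF t] norm_ge_zero order.trans by blast
  then show "0 \<le> 672 * pi * (2 * Cvel \<alpha> * R) * 6561" using Cvel_nonneg by simp
  fix N t assume N: "(N::real) > 0" and t: "t \<in> {0..T}"
  have M: "l2b (\<lambda>l. lam l ^ 3 * speed (fc (u1 t)) (fc (u2 t)) l) (2 * Cvel \<alpha> * R)"
    by (rule l2b_le[OF speed_bound_u[OF t]]) (intro mult_left_mono R t, use Cvel_nonneg in simp)
  have G: "l2b (\<lambda>k. lam k ^ 3 * cmod (fc (b t) k)) (81 * sobolev_norm 3 (b t))"
    using l2b_sobolev[OF b_sobolev[OF t]] by simp
  define S where "S = (\<Sum>k | lam k < N. lam k ^ (2 * 3) * cutoff N k * Re (cnj (fc (b t) k) * fc (Fb t) k))"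
  have "\<bar>S\<bar> \<le> 336 * pi * (2 * Cvel \<alpha> * R) * (81 * sobolev_norm 3 (b t))\<^sup>2"
    unfolding S_def by (rule transport_estimate[OF div_free_u[OF t] M fc_cnj fc_cnj _ N G has_sum_Fb[OF t]]) simp
  moreover have "- 2 * S \<le> 2 * \<bar>S\<bar>" by linarith
  ultimately have "- 2 * S \<le> 2 * (336 * pi * (2 * Cvel \<alpha> * R) * (81 * sobolev_norm 3 (b t))\<^sup>2)"
    by linarith
  also have "\<dots> = 672 * pi * (2 * Cvel \<alpha> * R) * 6561 * (sobolev_norm 3 (b t))\<^sup>2"
    by (simp add: power_mult_distrib)
  also have "\<dots> \<le> 672 * pi * (2 * Cvel \<alpha> * R) * 6561 * (1 + (sobolev_norm 3 (b t))\<^sup>2)"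
    using R0 Cvel_nonneg by (intro mult_left_mono) auto
  finally show "- 2 * (\<Sum>k | lam k < N. lam k ^ (2 * 3) * cutoff N k * Re (cnj (fc (b t) k) * fc (Fb t) k)) \<le>
      672 * pi * (2 * Cvel \<alpha> * R) * 6561 * (1 + (sobolev_norm 3 (b t))\<^sup>2)"
    unfolding S_def .
qed

text \<open>Transport is quadratic in the norm of the vorticity, and the sources are linear in it
  once \<open>b\<close> is bounded in W^{3,2}. The constants are 672 = 2 * 336, 729 = 27 squared, 64
  = 2 * 32 and 2187 = 27 * 81.\<close>

lemma vorticity_H2_bound:
  assumes R: "\<And>t. t \<in> {0..T} \<Longrightarrow> norm (\<omega> t - f) \<le> R"
    and B: "\<And>t. t \<in> {0..T} \<Longrightarrow> sobolev_norm 3 (b t) \<le> B" and t: "t \<in> {0..T}"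
  shows "1 + (sobolev_norm 2 (\<omega> t))\<^sup>2 \<le>
    (1 + (Csob 2)\<^sup>2 * (3 * 3 ^ 2 * sobolev_norm 2 \<omega>0)\<^sup>2) *
      exp ((Csob 2)\<^sup>2 * (672 * pi * (2 * Cvel \<alpha> * R) * 729 + 64 * pi * 2187 * B * (2 * Cvel \<alpha> * R + Mh)) * t)"
proof (rule sobolev_energy[OF continuous_w w_eq continuous_fc_Gw _ _ t])
  have R0: "0 \<le> R" using R[OF t] norm_ge_zero order.trans by blast
  have B0: "0 \<le> B" using B[OF t] sobolev_norm_nonneg order.trans by blast
  have Mh: "0 \<le> Mh" by (simp add: Mh_def sobolev_norm_nonneg)
  define M where "M = 2 * Cvel \<alpha> * R"
  have M0: "0 \<le> M" using R0 Cvel_nonneg by (simp add: M_def)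
  show "0 \<le> 672 * pi * (2 * Cvel \<alpha> * R) * 729 + 64 * pi * 2187 * B * (2 * Cvel \<alpha> * R + Mh)"
    using M0 B0 Mh unfolding M_def[symmetric] by simp
  fix N t assume N: "(N::real) > 0" and t: "t \<in> {0..T}"
  have M: "l2b (\<lambda>l. lam l ^ 3 * speed (fc (u1 t)) (fc (u2 t)) l) M"
    unfolding M_def by (rule l2b_le[OF speed_bound_u[OF t]]) (intro mult_left_mono R t, use Cvel_nonneg in simp)
  define Z where "Z = sobolev_norm 2 (\<omega> t)"
  have Z0: "0 \<le> Z" by (simp add: Z_def sobolev_norm_nonneg)
  have W: "l2b (\<lambda>k. (lam k)\<^sup>2 * cmod (fc (\<omega> t) k)) (27 * Z)"
    using l2b_sobolev[OF w_sobolev[OF t]] by (simp add: Z_def)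
  have G: "l2b (\<lambda>k. lam k ^ 3 * cmod (fc (b t) k)) (81 * B)"
    by (rule l2b_le[OF l2b_sobolev[OF b_sobolev[OF t]]]) (use B[OF t] in simp)
  define S where "S H = (\<Sum>k | lam k < N. lam k ^ 4 * cutoff N k * Re (cnj (fc (\<omega> t) k) * fc H k))" for H
  have 1: "\<bar>S (Fw t)\<bar> \<le> 336 * pi * M * (27 * Z)\<^sup>2"
    using transport_estimate[OF div_free_u[OF t] M fc_cnj fc_cnj _ N, of 2 "fc (\<omega> t)" "27 * Z", OF _ W has_sum_Fw[OF t]]
    by (simp add: S_def)
  have 2: "\<bar>S (Fb t)\<bar> \<le> 32 * pi * (27 * Z) * (81 * B) * M"
    unfolding S_def by (rule source_estimate[OF div_free_u[OF t] M N W G has_sum_Fb[OF t]])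
  have 3: "\<bar>S (Fh t)\<bar> \<le> 32 * pi * (27 * Z) * (81 * B) * Mh"
    unfolding S_def by (rule source_estimate[OF uhdf speed_bound_uh N W G has_sum_Fh[OF t]])
  have split: "(\<Sum>k | lam k < N. lam k ^ (2 * 2) * cutoff N k * Re (cnj (fc (\<omega> t) k) * fc (Gw t) k)) = S (Fw t) - S (Fb t) + S (Fh t)"
    unfolding S_def sum_subtractf[symmetric] sum.distrib[symmetric]
    by (intro sum.cong refl) (simp add: fc_Gw[OF t] algebra_simps)
  have Z2: "Z \<le> 1 + Z\<^sup>2" using sum_squares_bound[of 1 Z] Z0 by simp
  have "- 2 * (S (Fw t) - S (Fb t) + S (Fh t)) \<le> 2 * \<bar>S (Fw t)\<bar> + 2 * \<bar>S (Fb t)\<bar> + 2 * \<bar>S (Fh t)\<bar>"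
    using abs_ge_minus_self[of "S (Fw t)"] abs_ge_self[of "S (Fb t)"] abs_ge_minus_self[of "S (Fh t)"]
    unfolding distrib_left right_diff_distrib by linarith
  also have "\<dots> \<le> 2 * (336 * pi * M * (27 * Z)\<^sup>2) + 2 * (32 * pi * (27 * Z) * (81 * B) * M) + 2 * (32 * pi * (27 * Z) * (81 * B) * Mh)"
    using 1 2 3 by (intro add_mono mult_left_mono) auto
  also have "\<dots> = 672 * pi * M * 729 * Z\<^sup>2 + 64 * pi * 2187 * B * (M + Mh) * Z"
    by (simp add: power_mult_distrib algebra_simps)
  also have "\<dots> \<le> 672 * pi * M * 729 * (1 + Z\<^sup>2) + 64 * pi * 2187 * B * (M + Mh) * (1 + Z\<^sup>2)"
    using M0 B0 Mh Z2 by (intro add_mono mult_left_mono) auto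
  also have "\<dots> = (672 * pi * M * 729 + 64 * pi * 2187 * B * (M + Mh)) * (1 + Z\<^sup>2)" by (simp only: distrib_right)
  finally show "- 2 * (\<Sum>k | lam k < N. lam k ^ (2 * 2) * cutoff N k * Re (cnj (fc (\<omega> t) k) * fc (Gw t) k)) \<le>
      (672 * pi * (2 * Cvel \<alpha> * R) * 729 + 64 * pi * 2187 * B * (2 * Cvel \<alpha> * R + Mh)) * (1 + (sobolev_norm 2 (\<omega> t))\<^sup>2)"
    unfolding split M_def Z_def .
qed

end

section \<open>Excluding blow-up in finite time\<close>

lemma grad_sup_integral_le:
  assumes c: "continuous_sobolev T 3 b" and T: "ereal T \<le> Tmax"
  shows "ennreal (integral {0..T} (\<lambda>t. grad_sup (b t))) \<le>
    (\<integral>\<^sup>+t\<in>{t. 0 \<le> t \<and> ereal t < Tmax}. Linf_norm (grad (b t)) \<partial>lborel)"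
proof -
  let ?A = "\<lambda>t. indicator {0..T} t *\<^sub>R grad_sup (b t)"
  have b_sobolev: "b t \<in> sobolev 3" if "t \<in> {0..T}" for t using c that unfolding continuous_sobolev_def by blast
  have si: "set_integrable lborel {0..T} (\<lambda>t. grad_sup (b t))"
    by (rule borel_integrable_atLeastAtMost'[OF continuous_grad_sup[OF c]])
  then have i: "integrable lborel ?A" by (simp add: set_integrable_def)
  have "integral {0..T} (\<lambda>t. grad_sup (b t)) = (LINT t|lborel. ?A t)"
    using set_borel_integral_eq_integral(2)[OF si] by (simp add: set_lebesgue_integral_def)
  then have "ennreal (integral {0..T} (\<lambda>t. grad_sup (b t))) = (\<integral>\<^sup>+t. ennreal (?A t) \<partial>lborel)"
    using nn_integral_eq_integral[OF i] by simp
  also have "\<dots> \<le> (\<integral>\<^sup>+t\<in>{t. 0 \<le> t \<and> ereal t < Tmax}. Linf_norm (grad (b t)) \<partial>lborel)"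
  proof (rule nn_integral_mono_AE)
    \<comment> \<open>\<open>T = Tmax\<close> is allowed while the domain on the right omits
      \<open>Tmax\<close>; the endpoint is a null set.\<close>
    have "AE t in lborel. t \<noteq> T" by (rule AE_lborel_singleton)
    then show "AE t in lborel. ennreal (?A t) \<le> Linf_norm (grad (b t)) * indicator {t. 0 \<le> t \<and> ereal t < Tmax} t"
    proof eventually_elim
      case (elim t)
      show ?case
      proof (cases "t \<in> {0..T}")
        case True
        then have "ereal t < ereal T" using elim by simp
        then have "ereal t < Tmax" using T by (rule less_le_trans)
        then show ?thesis using True Linf_norm_grad(1)[OF b_sobolev[OF True]] by (simp add: indicator_def)
      qed simp
    qed
  qed
  finally show ?thesis .
qed

lemma le_sqrt_if_one_plus_square_le: "1 + x\<^sup>2 \<le> K \<Longrightarrow> 0 \<le> x \<Longrightarrow> x \<le> sqrt K"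
  by (rule real_le_rsqrt) simp

theorem theorem5p1:
  fixes \<alpha> :: real
    and h f b0 \<omega>0 :: l2_torus
    and uh :: "l2_torus \<times> l2_torus"
    and b \<omega> :: "real \<Rightarrow> l2_torus"
    and Tmax :: ereal
  assumes "\<alpha> > 0"
    and "h \<in> sobolev 1" and "h \<in> zero_average"
    and "uh = (1/2) *\<^sub>R grad_perp h" and "uh \<in> sobolev_div 3"
    and "f \<in> sobolev 2" and "f \<in> zero_average"
    and "b0 \<in> sobolev 3" and "b0 \<in> zero_average"
    and "\<omega>0 \<in> sobolev 2" and "\<omega>0 \<in> zero_average"
    and "maximal_solution \<alpha> uh f b0 \<omega>0 b \<omega> Tmax"
    and "Tmax < \<infinity>"
  shows "(\<integral>\<^sup>+t\<in>{t. 0 \<le> t \<and> ereal t < Tmax}. Linf_norm (grad (b t)) \<partial>lborel) = \<infinity>"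
proof (rule ccontr)
  define J where "J = (\<integral>\<^sup>+t\<in>{t. 0 \<le> t \<and> ereal t < Tmax}. Linf_norm (grad (b t)) \<partial>lborel)"
  assume "(\<integral>\<^sup>+t\<in>{t. 0 \<le> t \<and> ereal t < Tmax}. Linf_norm (grad (b t)) \<partial>lborel) \<noteq> \<infinity>"
  \<comment> \<open>Finiteness is what allows the return from the real number, because
    \<open>enn2real\<close> maps infinity to 0.\<close>
  then have J: "J = ennreal (enn2real J)" by (simp add: J_def top.not_eq_extremum)
  obtain T :: "nat \<Rightarrow> real" where T: "incseq T" "(\<lambda>n. ereal (T n)) \<longlonglongrightarrow> Tmax"
    "\<And>n. local_strong_solution \<alpha> uh f b0 \<omega>0 b \<omega> (T n)"
    "limsup (\<lambda>n. ereal ((M_norm (b (T n), \<omega> (T n)))\<^sup>2)) = \<infinity>"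
    using assms(12,13) unfolding maximal_solution_def by blast
  have TT: "ereal (T n) \<le> Tmax" for n
    by (rule incseq_le[OF _ T(2)]) (use T(1) in \<open>auto simp: incseq_def\<close>)
  obtain \<tau> where \<tau>: "Tmax = ereal \<tau>"
    using assms(13) TT[of 0] by (cases Tmax) auto
  have T\<tau>: "T n \<le> \<tau>" for n using TT[of n] by (simp add: \<tau>)
  define uh1 uh2 where "uh1 = fst uh" and "uh2 = snd uh"
  have uh: "uh = (uh1, uh2)" by (simp add: uh1_def uh2_def)
  have uhs: "uh1 \<in> sobolev 3" "uh2 \<in> sobolev 3"
    using assms(5) unfolding uh sobolev_div_def by auto
  \<comment> \<open>The field is a perpendicular gradient, so its two coefficients are the symbols
    of the partial derivatives applied to one function, and the combination in
    \<open>div_free\<close> cancels.\<close>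
  have "fc uh1 k = - (1/2) *\<^sub>R (dsym 0 1 k * fc h k)" "fc uh2 k = (1/2) *\<^sub>R (dsym 1 0 k * fc h k)" for k
    using sobolevD[OF assms(2), of 0 1 k] sobolevD[OF assms(2), of 1 0 k]
    by (simp_all add: uh1_def uh2_def assms(4) grad_perp_def fc_scaleR fc_minus)
  then have df: "div_free (fc uh1) (fc uh2)"
    by (simp add: div_free_def dsym_def scaleR_conv_of_real)
  have tqg: "tqg_solution \<alpha> f uh1 uh2 b0 \<omega>0 b \<omega> (T n)" for n
    using assms(1,6) uhs df T(3)[of n] by (simp add: tqg_solution_def uh)
  \<comment> \<open>This constant depends on the data alone, not on \<open>T n\<close>, so the
    bounds below are uniform in \<open>n\<close>.\<close>
  define P where "P = tqg_solution.Pw \<alpha> f uh1 uh2"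
  define K1 where "K1 = (1 + (norm \<omega>0)\<^sup>2) * exp (2 * P * enn2real J)"
  have P0: "0 \<le> P" unfolding P_def by (rule tqg_solution.Pw_nonneg[OF tqg[of 0]])
  have b1: "1 + (norm (\<omega> t))\<^sup>2 \<le> K1" if t: "t \<in> {0..T n}" for t n
  proof -
    interpret tqg_solution \<alpha> f uh1 uh2 b0 \<omega>0 b \<omega> "T n" by (rule tqg)
    have ca: "continuous_on {0..t} (\<lambda>s. grad_sup (b s))"
      using continuous_on_subset[OF continuous_grad_sup[OF continuous_b], of "{0..t}"] t by auto
    have "continuous_sobolev t 3 b"
      unfolding continuous_sobolev_def
    proof (intro conjI ballI)
      fix s assume s: "s \<in> {0..t}"
      then have s': "s \<in> {0..T n}" using t by auto
      then show "b s \<in> sobolev 3" by (rule b_sobolev)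
      have "((\<lambda>r. sobolev_norm 3 (b r - b s)) \<longlongrightarrow> 0) (at s within {0..T n})"
        using continuous_b s' unfolding continuous_sobolev_def by blast
      then show "((\<lambda>r. sobolev_norm 3 (b r - b s)) \<longlongrightarrow> 0) (at s within {0..t})"
        by (rule tendsto_within_subset) (use t in auto)
    qed
    moreover have "ereal t \<le> Tmax" using t TT[of n] by (meson atLeastAtMost_iff ereal_less_eq(3) order.trans)
    ultimately have "ennreal (integral {0..t} (\<lambda>s. grad_sup (b s))) \<le> ennreal (enn2real J)"
      unfolding J[symmetric] unfolding J_def by (rule grad_sup_integral_le)
    then have "integral {0..t} (\<lambda>s. grad_sup (b s)) \<le> enn2real J" by simp
    then have "integral {0..t} (\<lambda>s. 2 * Pw * grad_sup (b s)) \<le> 2 * P * enn2real J"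
      using P0 by (simp add: P_def mult_left_mono)
    then have "(1 + (norm \<omega>0)\<^sup>2) * exp (integral {0..t} (\<lambda>s. 2 * Pw * grad_sup (b s))) \<le> K1"
      unfolding K1_def by (intro mult_left_mono) auto
    then show ?thesis using vorticity_L2_bound[OF t] by linarith
  qed
  define R where "R = sqrt K1 + norm f"
  have R: "norm (\<omega> t - f) \<le> R" if "t \<in> {0..T n}" for t n
    using norm_triangle_ineq4[of "\<omega> t" f] le_sqrt_if_one_plus_square_le[OF b1[OF that]] by (simp add: R_def)
  have T0: "0 \<le> T n" for n using tqg_solution.T_pos[OF tqg[of n]] by simp
  have R0: "0 \<le> R" by (rule order.trans[OF norm_ge_zero R[of 0 0]]) (simp add: T0)
  define c2 where "c2 = (Csob 3)\<^sup>2 * (672 * pi * (2 * Cvel \<alpha> * R) * 6561)"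
  have C0: "0 \<le> Cvel \<alpha>" using assms(1) by (simp add: Cvel_def)
  have c20: "0 \<le> c2" unfolding c2_def using R0 C0 by simp
  \<comment> \<open>The finite maximal time \<open>\<tau>\<close> replaces \<open>t\<close> in the
    exponent; all \<open>T n\<close> are at most \<open>\<tau>\<close>.\<close>
  define K2' where "K2' = (1 + (Csob 3)\<^sup>2 * (3 * 3 ^ 3 * sobolev_norm 3 b0)\<^sup>2) * exp (c2 * \<tau>)"
  have b2: "sobolev_norm 3 (b t) \<le> sqrt K2'" if t: "t \<in> {0..T n}" for t n
  proof (rule le_sqrt_if_one_plus_square_le[OF order.trans])
    show "1 + (sobolev_norm 3 (b t))\<^sup>2 \<le> (1 + (Csob 3)\<^sup>2 * (3 * 3 ^ 3 * sobolev_norm 3 b0)\<^sup>2) * exp (c2 * t)"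
      unfolding c2_def by (rule tqg_solution.buoyancy_H3_bound[OF tqg R t])
    have "c2 * t \<le> c2 * \<tau>" using c20 t T\<tau>[of n] by (intro mult_left_mono) auto
    then show "(1 + (Csob 3)\<^sup>2 * (3 * 3 ^ 3 * sobolev_norm 3 b0)\<^sup>2) * exp (c2 * t) \<le> K2'"
      unfolding K2'_def by (intro mult_left_mono) auto
  qed (rule sobolev_norm_nonneg)
  define B where "B = sqrt K2'"
  have B0: "0 \<le> B" by (simp add: B_def K2'_def)
  define c3 where "c3 = (Csob 2)\<^sup>2 * (672 * pi * (2 * Cvel \<alpha> * R) * 729 +
    64 * pi * 2187 * B * (2 * Cvel \<alpha> * R + tqg_solution.Mh uh1 uh2))"
  have "0 \<le> tqg_solution.Mh uh1 uh2"
    using l2b_nonneg[OF tqg_solution.speed_bound_uh[OF tqg[of 0]]] .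
  then have c30: "0 \<le> c3" unfolding c3_def using R0 C0 B0 by simp
  define K3 where "K3 = (1 + (Csob 2)\<^sup>2 * (3 * 3 ^ 2 * sobolev_norm 2 \<omega>0)\<^sup>2) * exp (c3 * \<tau>)"
  have b3: "sobolev_norm 2 (\<omega> t) \<le> sqrt K3" if t: "t \<in> {0..T n}" for t n
  proof (rule le_sqrt_if_one_plus_square_le[OF order.trans])
    show "1 + (sobolev_norm 2 (\<omega> t))\<^sup>2 \<le> (1 + (Csob 2)\<^sup>2 * (3 * 3 ^ 2 * sobolev_norm 2 \<omega>0)\<^sup>2) * exp (c3 * t)"
      unfolding c3_def by (rule tqg_solution.vorticity_H2_bound[OF tqg R b2[folded B_def] t])
    have "c3 * t \<le> c3 * \<tau>" using c30 t T\<tau>[of n] by (intro mult_left_mono) auto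
    then show "(1 + (Csob 2)\<^sup>2 * (3 * 3 ^ 2 * sobolev_norm 2 \<omega>0)\<^sup>2) * exp (c3 * t) \<le> K3"
      unfolding K3_def by (intro mult_left_mono) auto
  qed (rule sobolev_norm_nonneg)
  \<comment> \<open>Both norms are bounded at all times \<open>T n\<close> by constants independent
    of \<open>n\<close>, against the blow-up clause of maximality.\<close>
  have "limsup (\<lambda>n. ereal ((M_norm (b (T n), \<omega> (T n)))\<^sup>2)) \<le> ereal ((sqrt K2' + sqrt K3)\<^sup>2)"
  proof (intro Limsup_bounded always_eventually allI)
    fix n
    have "M_norm (b (T n), \<omega> (T n)) \<le> sqrt K2' + sqrt K3"
      using b2[of "T n" n] b3[of "T n" n] T0[of n] by (simp add: M_norm_def)
    moreover have "0 \<le> M_norm (b (T n), \<omega> (T n))" by (simp add: M_norm_def sobolev_norm_nonneg)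
    ultimately show "ereal ((M_norm (b (T n), \<omega> (T n)))\<^sup>2) \<le> ereal ((sqrt K2' + sqrt K3)\<^sup>2)"
      by (simp add: power_mono)
  qed
  then show False using T(4) by simp
qed

end
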